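(* Let $K$ be a field of characteristic zero, let $R = K[x_1,x_2,x_3,x_4]$, and let $I = (x_1^a, x_2^b, x_3^c, x_4^d) \subset R$, where $a,b,c,d$ are positive integers at least one of which is equal to two. Then the generic initial ideal $\operatorname{gin}(I)$ of $I$ with respect to the reverse lexicographic order is equal to the almost revlex ideal $J\subset R$ corresponding to the same Hilbert function; that is, $\operatorname{gin}(I)$ is the unique almost revlex ideal $J$ of $R$ such that $R/J$ has the same Hilbert function as $R/I$.
   Context: The term order on $R$ is the (degree) reverse lexicographic order with $x_1 > x_2 > x_3 > x_4$, and $\operatorname{in}(\cdot)$ denotes the initial ideal with respect to it. The group $GL_4(K)$ acts on $R$ by linear changes of coordinates, and $\operatorname{gin}(I)$ denotes the generic initial ideal of $I$: the common value of $\operatorname{in}(gI)$ for all $g$ in a nonempty Zariski-open subset of $GL_4(K)$. A monomial ideal $J$ of $R$ is called an almost revlex ideal if, for each monomial $u$ in the minimal generating set of $J$, every monomial $v$ with $\deg v = \deg u$ and $v > u$ in the reverse lexicographic order belongs to $J$. Two almost revlex ideals with the same Hilbert function are equal. The Hilbert function of a graded algebra $A=\bigoplus_i A_i$ is $i\mapsto \dim_K A_i$. *)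

theory Defs
  imports "HOL-Analysis.Analysis" "HOL-Library.Poly_Mapping" "HOL-Library.Numeral_Type"
begin

section \<open>Polynomials in finitely many variables\<close>

text \<open>
  A polynomial over \<open>'k\<close> in the variables indexed by \<open>'v\<close> is a finitely supported map from
  exponent vectors to coefficients; the ring structure is that of \<^theory>\<open>HOL-Library.Poly_Mapping\<close>.
\<close>

type_synonym 'v monomial = "'v \<Rightarrow>\<^sub>0 nat"
type_synonym ('v, 'k) mpoly = "'v monomial \<Rightarrow>\<^sub>0 'k"

abbreviation Const :: "'k::zero \<Rightarrow> ('v, 'k) mpoly" where
  "Const c \<equiv> Poly_Mapping.single 0 c"

abbreviation Monom :: "'v monomial \<Rightarrow> ('v, 'k::zero_neq_one) mpoly" where
  "Monom m \<equiv> Poly_Mapping.single m 1"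

abbreviation Var :: "'v \<Rightarrow> ('v, 'k::zero_neq_one) mpoly" where
  "Var i \<equiv> Monom (Poly_Mapping.single i 1)"

text \<open>
  \<open>eval_with h x p\<close> maps the coefficients by \<open>h\<close> and replaces each variable \<open>i\<close> by \<open>x i\<close>.
\<close>

definition eval_with ::
  "('k::zero \<Rightarrow> 'b::comm_semiring_1) \<Rightarrow> ('v::finite \<Rightarrow> 'b) \<Rightarrow> ('v, 'k) mpoly \<Rightarrow> 'b" where
  "eval_with h x p =
     (\<Sum>m \<in> Poly_Mapping.keys p.
        h (Poly_Mapping.lookup p m) * (\<Prod>i\<in>UNIV. x i ^ Poly_Mapping.lookup m i))"

section \<open>The ring in four variables and its ideals\<close>

text \<open>
  The variables $x_1, x_2, x_3, x_4$ are indexed by \<open>0 < 1 < 2 < 3\<close> in the four-element type \<open>4\<close>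
  (in which \<open>4 = 0\<close>, so that the indices \<open>1, 2, 3, 4\<close> would not be increasing).
\<close>

type_synonym mon4 = "4 monomial"
type_synonym 'k poly4 = "(4, 'k) mpoly"

lemma index_order: "(0::4) < 1" "(1::4) < 2" "(2::4) < 3"
  by (simp_all only: less_bit0_def bit0.Rep_numeral bit0.Rep_0 bit0.Rep_1) simp_all

lemma index_UNIV: "(UNIV :: 4 set) = {0, 1, 2, 3}"
proof -
  have "(4::4) = 0" by simp
  then show ?thesis unfolding UNIV_4 by auto
qed

text \<open>An ideal is a submodule of the ring regarded as a module over itself.\<close>

lemma module_self: "module ((*) :: 'a::comm_ring_1 \<Rightarrow> 'a \<Rightarrow> 'a)"
  by unfold_locales (simp_all add: algebra_simps)

definition ideal_span :: "'a::comm_ring_1 set \<Rightarrow> 'a set" where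
  "ideal_span = module.span (*)"

section \<open>Hilbert functions\<close>

definition mdeg :: "mon4 \<Rightarrow> nat" where
  "mdeg m = (\<Sum>i\<in>UNIV. Poly_Mapping.lookup m i)"

definition homog_part :: "nat \<Rightarrow> 'k::zero poly4 set" where
  "homog_part i = {p. \<forall>m \<in> Poly_Mapping.keys p. mdeg m = i}"

text \<open>
  \<open>quotient_basis B V W\<close>: the classes modulo \<open>W\<close> of the elements of \<open>B \<subseteq> V\<close> are pairwise distinct
  and form a \<open>K\<close>-basis of the image of \<open>V\<close> in the quotient by \<open>W\<close>.
\<close>

definition quotient_basis ::
  "'k::field poly4 set \<Rightarrow> 'k poly4 set \<Rightarrow> 'k poly4 set \<Rightarrow> bool" where
  "quotient_basis B V W \<longleftrightarrow> finite B \<and> B \<subseteq> V \<and>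
     (\<forall>v\<in>V. \<exists>!\<gamma> :: 'k poly4 \<Rightarrow> 'k.
        (\<forall>b. b \<notin> B \<longrightarrow> \<gamma> b = 0) \<and> v - (\<Sum>b\<in>B. Const (\<gamma> b) * b) \<in> W)"

definition quotient_dim :: "'k::field poly4 set \<Rightarrow> 'k poly4 set \<Rightarrow> nat" where
  "quotient_dim V W = (THE n. \<exists>B. quotient_basis B V W \<and> card B = n)"

text \<open>
  The Hilbert function of the quotient of \<open>R\<close> by a homogeneous ideal \<open>J\<close>; the component of degree
  \<open>i\<close> of the quotient is the image of the component of degree \<open>i\<close> of \<open>R\<close>.
\<close>

definition hilbert_function :: "'k::field poly4 set \<Rightarrow> nat \<Rightarrow> nat" where
  "hilbert_function J i = quotient_dim (homog_part i) J"

section \<open>Initial ideals\<close>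

text \<open>The degree reverse lexicographic order on monomials.\<close>

definition revlex_less :: "mon4 \<Rightarrow> mon4 \<Rightarrow> bool" where
  "revlex_less u v \<longleftrightarrow> mdeg u < mdeg v \<or>
     mdeg u = mdeg v \<and>
       (\<exists>i. Poly_Mapping.lookup v i < Poly_Mapping.lookup u i \<and>
            (\<forall>j>i. Poly_Mapping.lookup u j = Poly_Mapping.lookup v j))"

definition lead_monom :: "'k::zero poly4 \<Rightarrow> mon4" where
  "lead_monom p = (THE m. m \<in> Poly_Mapping.keys p \<and>
     (\<forall>n \<in> Poly_Mapping.keys p. n \<noteq> m \<longrightarrow> revlex_less n m))"

definition initial_ideal :: "'k::field poly4 set \<Rightarrow> 'k poly4 set" where
  "initial_ideal I = ideal_span {Monom (lead_monom p) | p. p \<in> I \<and> p \<noteq> 0}"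

section \<open>Generic initial ideals\<close>

text \<open>The matrix \<open>g\<close> acts on \<open>R\<close> by substituting \<open>\<Sum>i. g\<^sub>i\<^sub>j x\<^sub>i\<close> for \<open>x\<^sub>j\<close>.\<close>

definition lin_change :: "'k::field ^ 4 ^ 4 \<Rightarrow> 'k poly4 \<Rightarrow> 'k poly4" where
  "lin_change g = eval_with Const (\<lambda>j. \<Sum>i\<in>UNIV. Const (g $ i $ j) * Var i)"

text \<open>
  Zariski-open subsets of the general linear group. Polynomials in the 16 matrix entries suffice:
  the coordinate ring also contains the inverse of the determinant, but that is a unit.
\<close>

definition zariski_open_GL4 :: "('k::field ^ 4 ^ 4) set \<Rightarrow> bool" where
  "zariski_open_GL4 U \<longleftrightarrow>
     (\<exists>F :: (4 \<times> 4, 'k) mpoly set.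
        U = {g. invertible g \<and> (\<exists>f\<in>F. eval_with id (\<lambda>(i, j). g $ i $ j) f \<noteq> 0)})"

definition gin :: "'k::field poly4 set \<Rightarrow> 'k poly4 set" where
  "gin I = (THE J. \<exists>U. zariski_open_GL4 U \<and> U \<noteq> {} \<and>
     (\<forall>g\<in>U. initial_ideal (lin_change g ` I) = J))"

section \<open>Almost revlex ideals\<close>

definition minimal_monomial_generators :: "mon4 set \<Rightarrow> 'k::field poly4 set \<Rightarrow> bool" where
  "minimal_monomial_generators G J \<longleftrightarrow>
     ideal_span (Monom ` G) = J \<and> (\<forall>H. H \<subset> G \<longrightarrow> ideal_span (Monom ` H) \<noteq> J)"

text \<open>
  Every monomial ideal has exactly one minimal set \<open>G\<close> of monomial generators, so the quantifier
  over \<open>G\<close> expresses that \<open>J\<close> is a monomial ideal and gives a name to this set.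
\<close>

definition almost_revlex_ideal :: "'k::field poly4 set \<Rightarrow> bool" where
  "almost_revlex_ideal J \<longleftrightarrow>
     (\<exists>G. minimal_monomial_generators G J \<and>
        (\<forall>u\<in>G. \<forall>v. mdeg v = mdeg u \<and> revlex_less u v \<longrightarrow> Monom v \<in> J))"

end

theory Submission
  imports Defs "HOL-Computational_Algebra.Polynomial"
begin

text \<open>
  Let \<open>A\<close> be the quotient by \<open>(x\<^sub>1\<^sup>a, x\<^sub>2\<^sup>b, x\<^sub>3\<^sup>c, x\<^sub>4\<^sup>d)\<close>. In the reverse lexicographic order, the number of
  standard monomials of degree \<open>j\<close> divisible by \<open>x\<^sub>4\<^sup>s\<close> is the rank of multiplication by \<open>x\<^sub>4\<^sup>s\<close> into
  degree \<open>j\<close> of \<open>A\<close>, and similarly for \<open>x\<^sub>3\<^sup>s\<close> modulo \<open>x\<^sub>4\<close>. For a generic change of coordinates these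
  ranks are maximal, so they may be bounded below in one special system of coordinates.

  Multiplication by a linear form with nonzero coefficients is the raising operator of an
  \<open>sl\<^sub>2\<close>-action on \<open>A\<close>, so \<open>A\<close> has the strong Lefschetz property. Since one of the exponents is two,
  \<open>A\<close> modulo a linear form is the quotient of \<open>K[x, y, z]/(z\<^sup>2)\<close> by powers of three linear forms. By
  apolarity, a functional on its degree \<open>j\<close> part that also vanishes on the multiples of \<open>L\<^sup>s\<close> is a pair
  of univariate polynomials with prescribed zeros, and counting these pairs shows that
  multiplication by \<open>L\<^sup>s\<close> has maximal rank. So the standard monomials form strings in the directions
  \<open>x\<^sub>4\<close> and \<open>x\<^sub>3\<close> whose lengths force the minimal generators to be almost revlex, up to the order of
  generators that differ in \<open>x\<^sub>1\<close> and \<open>x\<^sub>2\<close> only. That order follows from the Borel move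
  \<open>x\<^sub>2 \<rightarrow> x\<^sub>1\<close>, which holds because a linear system of dimension \<open>w\<close> of univariate
  polynomials in characteristic zero vanishes to order \<open>w\<close> at finitely many points only.
\<close>

text \<open>The matrix \<open>special\<close> is a single system of coordinates that serves both
  rank estimates, and it need not be generic. Divisibility by a power of x4, and likewise
  \<open>bsupp\<close>, cuts out lower segments of the order; passing to a generic matrix can only
  increase the number of standard monomials there, so, the total being fixed, it can only decrease
  it in the complement. Two demands shape the matrix: the form that becomes x4 must have four
  nonzero coefficients, and modulo x4 three generator forms together with x3 must be X + kY + c_k Z
  for k = 0, 1, 2, 3 and c = 0, 0, 1, 1, where Z is the form whose square is a generator. This is
  where the exponent two enters: modulo Z^2 a functional is known from its values on the parts of
  degree 0 and 1 in Z, hence from only two univariate polynomials.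

  The quotient by x4 is never given an exact Hilbert function. Instead the upper bound
  \<open>special_rank_2\<close> and the elementary bounds \<open>card_std_le\<close> and
  \<open>card_std_ge\<close> meet in the degrees up to half the socle degree, which are the only
  ones where a generator free of x4 could go wrong.\<close>

abbreviation cf :: "('a \<Rightarrow>\<^sub>0 'b::zero) \<Rightarrow> 'a \<Rightarrow> 'b" where
  "cf \<equiv> Poly_Mapping.lookup"

abbreviation supp :: "('a \<Rightarrow>\<^sub>0 'b::zero) \<Rightarrow> 'a set" where
  "supp \<equiv> Poly_Mapping.keys"

section \<open>Linear algebra\<close>

text \<open>A pivot \<open>z\<close> removes the equation \<open>y\<close> from the other unknowns,
  and induction does the rest. Most dimension comparisons below are reduced to this count of
  unknowns and equations.\<close>

lemma homogeneous_system:
  fixes v :: "'x \<Rightarrow> 'y \<Rightarrow> 'k::field"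
  assumes "finite Y" "finite X" "card Y < card X"
  shows "\<exists>\<alpha>. (\<exists>x\<in>X. \<alpha> x \<noteq> 0) \<and> (\<forall>y\<in>Y. (\<Sum>x\<in>X. \<alpha> x * v x y) = 0)"
  using assms
proof (induction Y arbitrary: X v rule: finite_induct)
  case empty
  then obtain x where "x \<in> X" by (metis card.empty equals0I less_irrefl)
  then show ?case by (intro exI[of _ "\<lambda>_. 1"]) auto
next
  case (insert y Y)
  show ?case
  proof (cases "\<forall>x\<in>X. v x y = 0")
    case True
    have "card Y < card X" using insert by simp
    from insert.IH[OF insert.prems(1) this] obtain \<alpha> where
      "\<exists>x\<in>X. \<alpha> x \<noteq> 0" "\<forall>y\<in>Y. (\<Sum>x\<in>X. \<alpha> x * v x y) = 0" by blast
    with True show ?thesis by (intro exI[of _ \<alpha>]) simp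
  next
    case False
    then obtain z where z: "z \<in> X" "v z y \<noteq> 0" by blast
    define w where "w x y' = v x y' - v x y / v z y * v z y'" for x y'
    have "card Y < card (X - {z})" using insert z by simp
    from insert.IH[OF _ this, of w] insert.prems obtain \<beta> where
      \<beta>: "\<exists>x\<in>X - {z}. \<beta> x \<noteq> 0" "\<forall>y\<in>Y. (\<Sum>x\<in>X - {z}. \<beta> x * w x y) = 0" by auto
    define \<alpha> where "\<alpha> x = (if x = z then - (\<Sum>x\<in>X - {z}. \<beta> x * v x y / v z y) else \<beta> x)" for x
    have sum: "(\<Sum>x\<in>X. \<alpha> x * v x y') = (\<Sum>x\<in>X - {z}. \<beta> x * w x y')" for y'
    proof -
      have "(\<Sum>x\<in>X. \<alpha> x * v x y') = \<alpha> z * v z y' + (\<Sum>x\<in>X - {z}. \<alpha> x * v x y')"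
        using insert.prems z by (simp add: sum.remove)
      also have "(\<Sum>x\<in>X - {z}. \<alpha> x * v x y') = (\<Sum>x\<in>X - {z}. \<beta> x * v x y')"
        by (intro sum.cong) (auto simp: \<alpha>_def)
      also have "\<alpha> z * v z y' = - (\<Sum>x\<in>X - {z}. \<beta> x * v x y / v z y * v z y')"
        by (simp add: \<alpha>_def sum_distrib_right)
      finally show ?thesis by (simp add: w_def algebra_simps sum_subtractf)
    qed
    have "(\<Sum>x\<in>X. \<alpha> x * v x y) = 0" unfolding sum w_def using z by simp
    moreover have "\<exists>x\<in>X. \<alpha> x \<noteq> 0" using \<beta>(1) by (auto simp: \<alpha>_def)
    ultimately show ?thesis using \<beta>(2) sum by (intro exI[of _ \<alpha>]) auto
  qed
qed

text \<open>The witness \<open>D\<close> is a minor of the matrix \<open>v\<close>, computed by fraction-free Gaussian elimination.\<close>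

lemma independence_is_open:
  fixes v :: "'x \<Rightarrow> 'y \<Rightarrow> 'g \<Rightarrow> 'k::field"
  assumes one: "(\<lambda>_. 1) \<in> \<A>"
    and diff: "\<And>f h. f \<in> \<A> \<Longrightarrow> h \<in> \<A> \<Longrightarrow> (\<lambda>g. f g - h g) \<in> \<A>"
    and mult: "\<And>f h. f \<in> \<A> \<Longrightarrow> h \<in> \<A> \<Longrightarrow> (\<lambda>g. f g * h g) \<in> \<A>"
    and "finite X" "\<And>x y. v x y \<in> \<A>"
    and "\<And>\<alpha>. (\<And>y. (\<Sum>x\<in>X. \<alpha> x * v x y g0) = 0) \<Longrightarrow> \<forall>x\<in>X. \<alpha> x = 0"
  shows "\<exists>D\<in>\<A>. D g0 \<noteq> 0 \<and> (\<forall>g \<alpha>. D g \<noteq> 0 \<longrightarrow>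
           (\<forall>y. (\<Sum>x\<in>X. \<alpha> x * v x y g) = 0) \<longrightarrow> (\<forall>x\<in>X. \<alpha> x = 0))"
  using assms(4-)
proof (induction X arbitrary: v rule: finite_induct)
  case empty
  then show ?case using one by (intro bexI[of _ "\<lambda>_. 1"]) auto
next
  case (insert z X)
  have "\<exists>y. v z y g0 \<noteq> 0"
  proof (rule ccontr)
    assume "\<nexists>y. v z y g0 \<noteq> 0"
    then have "(\<Sum>x\<in>insert z X. (if x = z then 1 else 0) * v x y g0) = 0" for y
      by (intro sum.neutral) auto
    from insert.prems(2)[OF this] show False by auto
  qed
  then obtain y0 where y0: "v z y0 g0 \<noteq> 0" by blast
  \<comment> \<open>Cross-multiplied rows: column \<open>y0\<close> becomes zero, and since nothing
    is divided the entries stay in \<open>\<A>\<close>.\<close>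
  define w where "w x y = (\<lambda>g. v z y0 g * v x y g - v x y0 g * v z y g)" for x y
  have red: "(\<Sum>x\<in>X. \<beta> x * w x y g) =
      (\<Sum>x\<in>insert z X. (if x = z then - (\<Sum>x\<in>X. \<beta> x * v x y0 g) else v z y0 g * \<beta> x) * v x y g)"
    for \<beta> y g
  proof -
    have "(\<Sum>x\<in>X. (if x = z then - (\<Sum>x\<in>X. \<beta> x * v x y0 g) else v z y0 g * \<beta> x) * v x y g) =
        (\<Sum>x\<in>X. v z y0 g * \<beta> x * v x y g)"
      using insert.hyps by (intro sum.cong) auto
    then show ?thesis using insert.hyps
      by (simp add: w_def algebra_simps sum_subtractf sum_distrib_left)
  qed
  have wA: "w x y \<in> \<A>" for x y unfolding w_def by (intro diff mult insert.prems)
  have "\<forall>x\<in>X. \<beta> x = 0" if "\<And>y. (\<Sum>x\<in>X. \<beta> x * w x y g0) = 0" for \<beta>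
  proof
    fix x assume "x \<in> X"
    moreover have "\<forall>x\<in>insert z X. (if x = z then - (\<Sum>x\<in>X. \<beta> x * v x y0 g0) else v z y0 g0 * \<beta> x) = 0"
      using insert.prems(2)[of "\<lambda>x. if x = z then - (\<Sum>x\<in>X. \<beta> x * v x y0 g0) else v z y0 g0 * \<beta> x"]
        that unfolding red .
    ultimately have "v z y0 g0 * \<beta> x = 0" using insert.hyps by (metis insertCI)
    then show "\<beta> x = 0" using y0 by simp
  qed
  note indep = this
  have "\<exists>D\<in>\<A>. D g0 \<noteq> 0 \<and> (\<forall>g \<alpha>. D g \<noteq> 0 \<longrightarrow>
      (\<forall>y. (\<Sum>x\<in>X. \<alpha> x * w x y g) = 0) \<longrightarrow> (\<forall>x\<in>X. \<alpha> x = 0))"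
    by (rule insert.IH) (rule wA, rule indep)
  then obtain D where D: "D \<in> \<A>" "D g0 \<noteq> 0"
    "\<forall>g \<alpha>. D g \<noteq> 0 \<longrightarrow> (\<forall>y. (\<Sum>x\<in>X. \<alpha> x * w x y g) = 0) \<longrightarrow> (\<forall>x\<in>X. \<alpha> x = 0)"
    by (elim bexE conjE) (rule that)
  have "\<forall>x\<in>insert z X. \<alpha> x = 0"
    if "D g * v z y0 g \<noteq> 0" "\<forall>y. (\<Sum>x\<in>insert z X. \<alpha> x * v x y g) = 0" for g \<alpha>
  proof -
    have nz: "D g \<noteq> 0" "v z y0 g \<noteq> 0" using that(1) by auto
    have eq: "\<alpha> z * v z y g + (\<Sum>x\<in>X. \<alpha> x * v x y g) = 0" for y
      using that(2)[rule_format, of y] insert.hyps by simp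
    have "(\<Sum>x\<in>X. \<alpha> x * w x y g) = 0" for y
    proof -
      have "(\<Sum>x\<in>X. \<alpha> x * w x y g) =
          v z y0 g * (\<Sum>x\<in>X. \<alpha> x * v x y g) - v z y g * (\<Sum>x\<in>X. \<alpha> x * v x y0 g)"
        by (simp add: w_def algebra_simps sum_subtractf sum_distrib_left)
      also have "\<dots> = 0" using eq[of y] eq[of y0] by (simp add: add_eq_0_iff)
      finally show ?thesis .
    qed
    with D(3) nz have 0: "\<forall>x\<in>X. \<alpha> x = 0" by simp
    with eq[of y0] nz have "\<alpha> z = 0" by simp
    with 0 show ?thesis by simp
  qed
  then have "\<forall>g \<alpha>. D g * v z y0 g \<noteq> 0 \<longrightarrow>
      (\<forall>y. (\<Sum>x\<in>insert z X. \<alpha> x * v x y g) = 0) \<longrightarrow> (\<forall>x\<in>insert z X. \<alpha> x = 0)" by blast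
  moreover have "(\<lambda>g. D g * v z y0 g) \<in> \<A>" using D(1) insert.prems(1) by (rule mult)
  moreover have "D g0 * v z y0 g0 \<noteq> 0" using D(2) y0 by simp
  ultimately show ?case by (intro bexI[of _ "\<lambda>g. D g * v z y0 g"] conjI)
qed

section \<open>Polynomials\<close>

lemma cf_Const_times [simp]: "cf (Const c * p) m = c * cf p m"
proof -
  have "cf (Poly_Mapping.map ((*) c) p) m = c * cf p m"
    by (simp add: Poly_Mapping.map.rep_eq when_def)
  then show ?thesis by (simp add: mult_map_scale_conv_mult)
qed

lemma cf_sum: "cf (sum p X) m = (\<Sum>x\<in>X. cf (p x) m)"
  by (rule lookup_sum)

lemma Const_0 [simp]: "(Const 0 :: ('v, 'k::zero) mpoly) = 0"
  by simp

lemma Const_1 [simp]: "(Const 1 :: ('v, 'k::comm_ring_1) mpoly) = 1"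
  by simp

lemma Const_add: "(Const (c + d) :: ('v, 'k::comm_ring_1) mpoly) = Const c + Const d"
  by (rule single_add)

lemma Const_mult: "(Const (c * d) :: ('v, 'k::comm_ring_1) mpoly) = Const c * Const d"
  by (simp add: mult_single)

lemma Const_uminus: "(Const (- c) :: ('v, 'k::comm_ring_1) mpoly) = - Const c"
  by (rule single_uminus)

lemma Const_sum: "(Const (sum c X) :: ('v, 'k::comm_ring_1) mpoly) = (\<Sum>x\<in>X. Const (c x))"
  by (induction X rule: infinite_finite_induct) (simp_all add: single_add)

lemma Monom_add: "(Monom (m + n) :: ('v, 'k::comm_ring_1) mpoly) = Monom m * Monom n"
  by (simp add: mult_single)

lemma Var_power: "Var i ^ n = (Monom (Poly_Mapping.single i n) :: ('v, 'k::comm_ring_1) mpoly)"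
  by (induction n) (simp_all add: mult_single flip: single_add)

lemma cf_Monom: "cf (Monom m :: ('v, 'k::zero_neq_one) mpoly) n = (if n = m then 1 else 0)"
  by (simp add: lookup_single when_def)

lemma cf_sum_Monom:
  fixes c :: "'v monomial \<Rightarrow> 'k::comm_ring_1"
  assumes "finite A"
  shows "cf (\<Sum>m\<in>A. Const (c m) * Monom m) n = (if n \<in> A then c n else 0)"
proof -
  have "cf (\<Sum>m\<in>A. Const (c m) * Monom m) n = (\<Sum>m\<in>A. if n = m then c m else 0)"
    by (auto simp: cf_sum cf_Monom intro!: sum.cong)
  then show ?thesis using assms by simp
qed

lemma sum_monomials:
  fixes p :: "('v, 'k::comm_ring_1) mpoly"
  assumes "finite A" "supp p \<subseteq> A"
  shows "p = (\<Sum>m\<in>A. Const (cf p m) * Monom m)"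
  by (rule poly_mapping_eqI) (use assms in \<open>auto simp: cf_sum_Monom in_keys_iff\<close>)

lemma mpoly_induct [case_names Monom add]:
  fixes p :: "('v, 'k::comm_ring_1) mpoly"
  assumes "\<And>m c. P (Const c * Monom m)" "\<And>p q. P p \<Longrightarrow> P q \<Longrightarrow> P (p + q)"
  shows "P p"
proof -
  have "P (\<Sum>m\<in>A. Const (c m) * Monom m)" if "finite A" for c A
    using that by (induction A rule: finite_induct)
      (use assms(1)[of 0 0] assms in \<open>auto simp: mult_single\<close>)
  from this[of "supp p" "cf p"] show ?thesis using sum_monomials[OF finite_keys order_refl, of p] by simp
qed

lemma cf_Monom_times_add [simp]:
  fixes p :: "('v, 'k::comm_ring_1) mpoly"
  shows "cf (Monom m * p) (m + n) = cf p n"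
proof (induction p rule: mpoly_induct)
  case (Monom k c)
  then show ?case by (simp add: mult_single lookup_single when_def)
qed (simp add: algebra_simps lookup_add)

lemma cf_Monom_times_0:
  fixes p :: "('v, 'k::comm_ring_1) mpoly"
  assumes "\<And>k. n \<noteq> m + k"
  shows "cf (Monom m * p) n = 0"
proof (induction p rule: mpoly_induct)
  case (Monom k c)
  then show ?case using assms by (simp add: mult_single lookup_single when_def) metis
qed (simp add: algebra_simps lookup_add)

lemma supp_Monom_times:
  fixes p :: "('v, 'k::comm_ring_1) mpoly"
  shows "supp (Monom m * p) = (+) m ` supp p"
proof -
  have "n \<in> (+) m ` supp p" if "n \<in> supp (Monom m * p)" for n
  proof (cases "\<exists>k. n = m + k")
    case True
    then show ?thesis using that by (auto simp: in_keys_iff)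
  next
    case False
    then show ?thesis using that cf_Monom_times_0[of n m p] by (auto simp: in_keys_iff)
  qed
  then show ?thesis by (auto simp: in_keys_iff)
qed

text \<open>The index set depends on \<open>n\<close> alone and not on the supports. When the
  factors vary with a matrix, each coefficient of the product is then one fixed sum of products, as
  \<open>coeff_polys_mult\<close> requires.\<close>

lemma cf_times:
  fixes p q :: "('v, 'k::comm_ring_1) mpoly"
  assumes "finite A" "\<And>k l. n = k + l \<Longrightarrow> (k, l) \<in> A"
  shows "cf (p * q) n = (\<Sum>(k, l)\<in>A. if n = k + l then cf p k * cf q l else 0)"
proof (induction p rule: mpoly_induct)
  case (Monom m c)
  show ?case
  proof (cases "\<exists>k. n = m + k")
    case True
    then obtain k where k: "n = m + k" by blast
    have "(\<Sum>(k', l)\<in>A. if n = k' + l then cf (Const c * Monom m) k' * cf q l else 0) =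
        (\<Sum>(k', l)\<in>{(m, k)}. if n = k' + l then cf (Const c * Monom m) k' * cf q l else 0)"
      using assms k by (intro sum.mono_neutral_right) (auto simp: cf_Monom split: if_splits)
    then show ?thesis using k by (simp add: cf_Monom mult.assoc)
  next
    case False
    then have "(\<Sum>(k', l)\<in>A. if n = k' + l then cf (Const c * Monom m) k' * cf q l else 0) = 0"
      by (intro sum.neutral) (auto simp: cf_Monom)
    then show ?thesis using cf_Monom_times_0[of n m q] False by (simp add: mult.assoc)
  qed
next
  case (add p1 p2)
  then show ?case
    by (simp add: algebra_simps lookup_add flip: sum.distrib)
      (auto intro!: sum.cong simp: algebra_simps lookup_add)
qed

text \<open>The K-linear extension of a map that is prescribed on monomials.\<close>

definition lincomb :: "('v monomial \<Rightarrow> ('w, 'k) mpoly) \<Rightarrow> ('v, 'k::comm_ring_1) mpoly \<Rightarrow> ('w, 'k) mpoly" where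
  "lincomb f p = (\<Sum>m\<in>supp p. Const (cf p m) * f m)"

definition klinear :: "(('v, 'k::comm_ring_1) mpoly \<Rightarrow> ('w, 'k) mpoly) \<Rightarrow> bool" where
  "klinear F \<longleftrightarrow> (\<forall>p q. F (p + q) = F p + F q) \<and> (\<forall>c p. F (Const c * p) = Const c * F p)"

lemma klinear_add: "klinear F \<Longrightarrow> F (p + q) = F p + F q"
  and klinear_Const: "klinear F \<Longrightarrow> F (Const c * p) = Const c * F p"
  by (simp_all add: klinear_def)

lemma klinear_0: "klinear F \<Longrightarrow> F 0 = 0"
  using klinear_Const[of F 0 0] by simp

lemma klinear_uminus: "klinear F \<Longrightarrow> F (- p) = - F p"
  using klinear_Const[of F "-1" p] by (simp add: Const_uminus del: single_uminus)

lemma klinear_diff: "klinear F \<Longrightarrow> F (p - q) = F p - F q"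
  using klinear_add[of F p "- q"] by (simp add: klinear_uminus)

lemma klinear_sum: "klinear F \<Longrightarrow> F (sum p X) = (\<Sum>x\<in>X. F (p x))"
  by (induction X rule: infinite_finite_induct) (simp_all add: klinear_0 klinear_add)

lemma klinear_eq:
  assumes "klinear F" "klinear G" "\<And>m. F (Monom m) = G (Monom m)"
  shows "F p = G p"
  by (induction p rule: mpoly_induct) (use assms in \<open>simp_all add: klinear_add klinear_Const\<close>)

lemma lincomb_superset:
  assumes "finite A" "supp p \<subseteq> A"
  shows "lincomb f p = (\<Sum>m\<in>A. Const (cf p m) * f m)"
  unfolding lincomb_def using assms by (intro sum.mono_neutral_left) (auto simp: in_keys_iff)

lemma klinear_lincomb: "klinear (lincomb f)"
  unfolding klinear_def
proof (intro conjI allI)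
  fix p q :: "('a, 'b) mpoly"
  have "supp (p + q) \<subseteq> supp p \<union> supp q" by (rule Poly_Mapping.keys_add)
  then show "lincomb f (p + q) = lincomb f p + lincomb f q"
    by (simp add: lincomb_superset[of "supp p \<union> supp q"] lookup_add Const_add algebra_simps sum.distrib)
next
  fix c and p :: "('a, 'b) mpoly"
  have "supp (Const c * p) \<subseteq> supp p" by (auto simp: in_keys_iff)
  then show "lincomb f (Const c * p) = Const c * lincomb f p"
    by (simp add: lincomb_superset[of "supp p"] Const_mult sum_distrib_left mult.assoc)
qed

lemma lincomb_Monom [simp]: "lincomb f (Monom m) = f m"
  by (simp add: lincomb_def)

section \<open>Evaluation\<close>

text \<open>Two coefficient maps occur: \<open>Const\<close>, for substituting polynomials into
  polynomials, and \<open>id\<close>, for evaluating at matrix entries. The homomorphism laws are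
  proved once for both.\<close>

locale coeff_hom =
  fixes h :: "'k::comm_ring_1 \<Rightarrow> 'b::comm_ring_1"
  assumes h_add: "h (c + d) = h c + h d" and h_mult: "h (c * d) = h c * h d" and h_1: "h 1 = 1"
begin

lemma h_0: "h 0 = 0" using h_add[of 0 0] by simp

lemma eval_superset:
  assumes "finite A" "supp p \<subseteq> A"
  shows "eval_with h x p = (\<Sum>m\<in>A. h (cf p m) * (\<Prod>i\<in>UNIV. x i ^ cf m i))"
  unfolding eval_with_def using assms
  by (intro sum.mono_neutral_left) (auto simp: in_keys_iff h_0)

lemma eval_add: "eval_with h x (p + q) = eval_with h x p + eval_with h x q"
  using Poly_Mapping.keys_add[of p q]
  by (simp add: eval_superset[of "supp p \<union> supp q"] lookup_add h_add algebra_simps sum.distrib)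

lemma eval_Monom: "eval_with h x (Monom m) = (\<Prod>i\<in>UNIV. x i ^ cf m i)"
  by (simp add: eval_with_def h_1)

lemma eval_Const_times: "eval_with h x (Const c * p) = h c * eval_with h x p"
proof -
  have "supp (Const c * p) \<subseteq> supp p" by (auto simp: in_keys_iff)
  then show ?thesis
    by (simp add: eval_superset[of "supp p"] h_mult sum_distrib_left mult.assoc)
qed

lemma eval_0: "eval_with h x 0 = 0"
  by (simp add: eval_with_def)

lemma eval_1: "eval_with h x 1 = 1"
  using eval_Monom[of x 0] by simp

lemma eval_Const: "eval_with h x (Const c) = h c"
  using eval_Const_times[of x c 1] by (simp add: eval_1)

lemma eval_Monom_times: "eval_with h x (Monom m * q) = eval_with h x (Monom m) * eval_with h x q"
proof (induction q rule: mpoly_induct)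
  case (Monom n c)
  have "Monom m * (Const c * Monom n) = Const c * Monom (m + n)"
    by (simp add: mult_single)
  then show ?case
    by (simp only: eval_Const_times eval_Monom lookup_add power_add prod.distrib) (simp add: mult_ac)
qed (simp add: eval_add algebra_simps)

lemma eval_mult: "eval_with h x (p * q) = eval_with h x p * eval_with h x q"
proof (induction p rule: mpoly_induct)
  case (Monom m c)
  then show ?case
    by (simp only: mult.assoc eval_Const_times eval_Monom_times)
qed (simp add: eval_add algebra_simps)

lemma eval_uminus: "eval_with h x (- p) = - eval_with h x p"
  using eval_add[of x p "- p"] by (simp add: eval_0 add_eq_0_iff2)

lemma eval_diff: "eval_with h x (p - q) = eval_with h x p - eval_with h x q"
  using eval_add[of x p "- q"] by (simp add: eval_uminus)

lemma eval_power: "eval_with h x (p ^ n) = eval_with h x p ^ n"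
  by (induction n) (simp_all add: eval_1 eval_mult)

lemma eval_prod: "eval_with h x (prod p X) = (\<Prod>i\<in>X. eval_with h x (p i))"
  by (induction X rule: infinite_finite_induct) (simp_all add: eval_1 eval_mult)

lemma eval_Var: "eval_with h x (Var i) = x i"
proof -
  have "(\<Prod>k\<in>UNIV. x k ^ cf (Poly_Mapping.single i 1) k) = (\<Prod>k\<in>UNIV. if i = k then x k else 1)"
    by (intro prod.cong) (auto simp: lookup_single when_def)
  then show ?thesis by (simp add: eval_Monom)
qed

end

interpretation Const: coeff_hom "Const :: 'k::comm_ring_1 \<Rightarrow> ('v, 'k) mpoly"
  by unfold_locales (simp_all add: Const_add Const_mult)

interpretation id: coeff_hom "id :: 'k::comm_ring_1 \<Rightarrow> 'k"
  by unfold_locales simp_all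

lemma klinear_eval: "klinear (eval_with Const x)"
  by (simp add: klinear_def Const.eval_add Const.eval_Const_times)

lemma Monom_eq_prod: "(Monom m :: ('v::finite, 'k::comm_ring_1) mpoly) = (\<Prod>i\<in>UNIV. Var i ^ cf m i)"
proof -
  have "(\<Prod>i\<in>A. Var i ^ cf m i) = (Monom (\<Sum>i\<in>A. Poly_Mapping.single i (cf m i)) :: ('v, 'k) mpoly)"
    if "finite A" for A
    using that by (induction A rule: finite_induct) (simp_all add: Var_power mult_single del: One_nat_def)
  moreover have "(\<Sum>i\<in>UNIV. Poly_Mapping.single i (cf m i)) = m"
    by (rule poly_mapping_eqI) (simp add: cf_sum lookup_single when_def)
  ultimately show ?thesis by simp
qed

lemma eval_Var_self: "eval_with Const Var p = (p :: ('v::finite, 'k::comm_ring_1) mpoly)"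
proof (induction p rule: mpoly_induct)
  case (Monom m c)
  show ?case unfolding Const.eval_Const_times Const.eval_Monom Monom_eq_prod[symmetric] ..
qed (simp add: Const.eval_add)

lemma eval_eval:
  fixes p :: "('u::finite, 'k::comm_ring_1) mpoly" and x :: "'u \<Rightarrow> ('v::finite, 'k) mpoly"
  shows "eval_with Const y (eval_with Const x p) = eval_with Const (\<lambda>i. eval_with Const y (x i)) p"
proof (induction p rule: mpoly_induct)
  case (Monom m c)
  then show ?case
    by (simp only: Const.eval_Const_times Const.eval_Monom Const.eval_prod Const.eval_power)
qed (simp add: Const.eval_add)

section \<open>Monomials and the reverse lexicographic order\<close>

definition mons :: "nat \<Rightarrow> mon4 set" where
  "mons j = {m. mdeg m = j}"

lemma sum_4: "(\<Sum>i\<in>UNIV. f i) = f 0 + f 1 + f 2 + f (3::4)"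
  unfolding index_UNIV using index_order by (simp add: add.assoc)

lemma prod_4: "(\<Prod>i\<in>UNIV. f i) = f 0 * f 1 * f 2 * (f (3::4) :: 'a::comm_monoid_mult)"
  unfolding index_UNIV using index_order by (simp add: mult.assoc)

lemma all_4: "(\<forall>i::4. P i) \<longleftrightarrow> P 0 \<and> P 1 \<and> P 2 \<and> P 3"
  using index_UNIV by (metis UNIV_I insertE singletonD)

lemma ex_4: "(\<exists>i::4. P i) \<longleftrightarrow> P 0 \<or> P 1 \<or> P 2 \<or> P 3"
  using all_4[of "\<lambda>i. \<not> P i"] by blast

lemma index_less [simp]: "(0::4) < 1" "(0::4) < 2" "(0::4) < 3" "(1::4) < 2" "(1::4) < 3" "(2::4) < 3"
  using index_order by auto

lemma index_not_less [simp]: "\<not> (1::4) < 0" "\<not> (2::4) < 0" "\<not> (3::4) < 0" "\<not> (2::4) < 1"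
    "\<not> (3::4) < 1" "\<not> (3::4) < 2"
  using index_less by (simp_all add: not_less order_less_imp_le del: index_less)

lemma index_neq [simp]: "(0::4) \<noteq> 1" "(0::4) \<noteq> 2" "(0::4) \<noteq> 3" "(1::4) \<noteq> 0" "(1::4) \<noteq> 2" "(1::4) \<noteq> 3"
    "(2::4) \<noteq> 0" "(2::4) \<noteq> 1" "(2::4) \<noteq> 3" "(3::4) \<noteq> 0" "(3::4) \<noteq> 1" "(3::4) \<noteq> 2"
  using index_less by (metis less_irrefl)+

lemma mdeg_eq: "mdeg m = cf m 0 + cf m 1 + cf m 2 + cf m 3"
  unfolding mdeg_def sum_4 ..

lemma mon_eqI: "cf m 0 = cf n 0 \<Longrightarrow> cf m 1 = cf n 1 \<Longrightarrow> cf m 2 = cf n 2 \<Longrightarrow> cf m 3 = cf n 3 \<Longrightarrow> m = (n :: mon4)"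
  by (rule poly_mapping_eqI) (use all_4[of "\<lambda>i. cf m i = cf n i"] in blast)

lemma mdeg_add [simp]: "mdeg (m + n) = mdeg m + mdeg n"
  by (simp add: mdeg_def lookup_add sum.distrib)

lemma mdeg_single [simp]: "mdeg (Poly_Mapping.single i n) = n"
  by (simp add: mdeg_def lookup_single when_def)

lemma mdeg_0 [simp]: "mdeg 0 = 0"
  by (simp add: mdeg_def)

lemma mdeg_eq_0_iff [simp]: "mdeg m = 0 \<longleftrightarrow> m = 0"
proof
  assume "mdeg m = 0"
  then show "m = 0" by (intro mon_eqI) (simp_all add: mdeg_eq)
qed simp

lemma mon_factor:
  fixes m n :: "'v \<Rightarrow>\<^sub>0 nat"
  assumes "\<And>i. cf m i \<le> cf n i"
  shows "n = m + (n - m)"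
  using assms by (intro poly_mapping_eqI) (simp add: lookup_add lookup_minus)

lemma single_factor:
  "t \<le> cf m i \<Longrightarrow> Poly_Mapping.single i t + (m - Poly_Mapping.single i t) = (m :: 'v \<Rightarrow>\<^sub>0 nat)"
  by (rule mon_factor[symmetric]) (auto simp: lookup_single when_def)

lemma mdeg_minus_single: "t \<le> cf m i \<Longrightarrow> mdeg m = t + mdeg (m - Poly_Mapping.single i t)"
  using arg_cong[OF single_factor, of t m i mdeg] by (simp only: mdeg_add mdeg_single)

lemma inj_on_minus_single:
  assumes "\<And>m. m \<in> S \<Longrightarrow> t \<le> cf (m :: 'v \<Rightarrow>\<^sub>0 nat) i"
  shows "inj_on (\<lambda>m. m - Poly_Mapping.single i t) S"
proof (rule inj_onI)
  fix m m' assume "m \<in> S" "m' \<in> S" and eq: "m - Poly_Mapping.single i t = m' - Poly_Mapping.single i t"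
  then show "m = m'" by (metis assms single_factor)
qed

lemma finite_mons [simp]: "finite (mons j)"
proof (rule finite_imageD)
  show "finite ((\<lambda>m::mon4. (cf m 0, cf m 1, cf m 2, cf m 3)) ` mons j)"
    by (rule finite_subset[of _ "{..j} \<times> {..j} \<times> {..j} \<times> {..j}"])
      (auto simp: mons_def mdeg_eq)
  show "inj_on (\<lambda>m::mon4. (cf m 0, cf m 1, cf m 2, cf m 3)) (mons j)"
    by (rule inj_onI) (auto intro: mon_eqI)
qed

lemma revlex_less_iff:
  "revlex_less u v \<longleftrightarrow> mdeg u < mdeg v \<or> mdeg u = mdeg v \<and>
     (cf v 3 < cf u 3 \<or> cf v 3 = cf u 3 \<and>
       (cf v 2 < cf u 2 \<or> cf v 2 = cf u 2 \<and> cf v 1 < cf u 1))"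
  unfolding revlex_less_def ex_4 all_4 by (auto simp: mdeg_eq)

lemma revlex_irrefl [simp]: "\<not> revlex_less u u"
  by (simp add: revlex_less_iff)

lemma revlex_trans: "revlex_less u v \<Longrightarrow> revlex_less v w \<Longrightarrow> revlex_less u w"
  unfolding revlex_less_iff by linarith

lemma revlex_asym: "revlex_less u v \<Longrightarrow> \<not> revlex_less v u"
  unfolding revlex_less_iff by linarith

lemma revlex_total: "u \<noteq> v \<Longrightarrow> revlex_less u v \<or> revlex_less v u"
  unfolding revlex_less_iff using mon_eqI[of u v] mdeg_eq[of u] mdeg_eq[of v] by linarith

lemma revlex_add: "revlex_less (n + u) (n + v) \<longleftrightarrow> revlex_less u v"
  by (simp add: revlex_less_iff lookup_add)

text \<open>For such sets reduction modulo an ideal never leaves the set, so the number of standard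
  monomials in it is the dimension of its image in the quotient. In the reverse lexicographic order
  divisibility by a power of x4 (index 3) cuts out such a set in each degree.\<close>

definition lower_segment :: "nat \<Rightarrow> mon4 set \<Rightarrow> bool" where
  "lower_segment j N \<longleftrightarrow> N \<subseteq> mons j \<and> (\<forall>n\<in>N. \<forall>m\<in>mons j. revlex_less m n \<longrightarrow> m \<in> N)"

lemma revlex_max:
  assumes "finite A" "A \<noteq> {}"
  shows "\<exists>m\<in>A. \<forall>n\<in>A. n \<noteq> m \<longrightarrow> revlex_less n m"
  using assms
proof (induction A rule: finite_ne_induct)
  case (insert x A)
  then obtain m where m: "m \<in> A" "\<forall>n\<in>A. n \<noteq> m \<longrightarrow> revlex_less n m" by blast
  show ?case
  proof (cases "revlex_less m x")
    case True
    then show ?thesis using m by (intro bexI[of _ x]) (metis insertE revlex_trans, simp)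
  next
    case False
    then show ?thesis using m by (intro bexI[of _ m]) (metis insertE revlex_total, simp)
  qed
qed simp

lemma lead_monom_eqI:
  assumes "m \<in> supp p" "\<And>n. n \<in> supp p \<Longrightarrow> n \<noteq> m \<Longrightarrow> revlex_less n m"
  shows "lead_monom p = m"
  unfolding lead_monom_def by (rule the_equality) (use assms revlex_asym in metis)+

lemma lead_monom:
  assumes "p \<noteq> 0"
  shows lead_monom_in: "lead_monom p \<in> supp p"
    and lead_monom_max: "n \<in> supp p \<Longrightarrow> n \<noteq> lead_monom p \<Longrightarrow> revlex_less n (lead_monom p)"
proof -
  from assms have "supp p \<noteq> {}" by (metis in_keys_iff lookup_zero poly_mapping_eqI empty_iff)
  then obtain m where "m \<in> supp p" "\<forall>n\<in>supp p. n \<noteq> m \<longrightarrow> revlex_less n m"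
    using revlex_max[of "supp p"] by auto
  with lead_monom_eqI[of m p] show "lead_monom p \<in> supp p"
    "n \<in> supp p \<Longrightarrow> n \<noteq> lead_monom p \<Longrightarrow> revlex_less n (lead_monom p)" by auto
qed

lemma lead_monom_Monom_times:
  fixes p :: "'k::comm_ring_1 poly4"
  assumes "p \<noteq> 0"
  shows "lead_monom (Monom m * p) = m + lead_monom p"
  by (rule lead_monom_eqI) (use lead_monom[OF assms] in \<open>auto simp: supp_Monom_times revlex_add\<close>)

section \<open>Monomial ideals\<close>

definition up_closed :: "mon4 set \<Rightarrow> bool" where
  "up_closed E \<longleftrightarrow> (\<forall>m\<in>E. \<forall>k. m + k \<in> E)"

lemma up_closedD: "up_closed E \<Longrightarrow> m \<in> E \<Longrightarrow> m + k \<in> E"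
  by (simp add: up_closed_def)

lemma up_closed_minus_single:
  assumes E: "up_closed E" and m: "m \<notin> E" "t \<le> cf m i"
  shows "m - Poly_Mapping.single i t \<notin> E"
  using up_closedD[OF E, of "m - Poly_Mapping.single i t" "Poly_Mapping.single i t"] m
  by (auto simp: add.commute single_factor)

lemma ideal_span_add: "p \<in> ideal_span S \<Longrightarrow> q \<in> ideal_span S \<Longrightarrow> p + q \<in> ideal_span S"
  unfolding ideal_span_def by (rule module.span_add[OF module_self])

lemma ideal_span_0: "0 \<in> ideal_span S"
  unfolding ideal_span_def by (rule module.span_zero[OF module_self])

lemma ideal_span_times: "p \<in> ideal_span S \<Longrightarrow> r * p \<in> ideal_span S"
  unfolding ideal_span_def by (rule module.span_scale[OF module_self])

lemma ideal_span_base: "p \<in> S \<Longrightarrow> p \<in> ideal_span S"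
  unfolding ideal_span_def by (rule module.span_base[OF module_self])

lemma ideal_span_diff: "p \<in> ideal_span S \<Longrightarrow> q \<in> ideal_span S \<Longrightarrow> p - q \<in> ideal_span S"
  unfolding ideal_span_def by (rule module.span_diff[OF module_self])

lemma ideal_span_sum: "(\<And>x. x \<in> A \<Longrightarrow> p x \<in> ideal_span S) \<Longrightarrow> sum p A \<in> ideal_span S"
  unfolding ideal_span_def by (rule module.span_sum[OF module_self])

lemma monomial_ideal_iff:
  fixes p :: "'k::comm_ring_1 poly4"
  shows "p \<in> ideal_span (Monom ` G) \<longleftrightarrow> supp p \<subseteq> {g + k |g k. g \<in> G}"
proof
  assume "p \<in> ideal_span (Monom ` G)"
  then show "supp p \<subseteq> {g + k |g k. g \<in> G}" unfolding ideal_span_def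
  proof (rule module.span_induct_alt[OF module_self])
    show "supp (0 :: 'k poly4) \<subseteq> {g + k |g k. g \<in> G}" by simp
  next
    fix c x y :: "'k poly4"
    assume x: "x \<in> Monom ` G" and y: "supp y \<subseteq> {g + k |g k. g \<in> G}"
    then obtain g where "g \<in> G" "x = Monom g" by blast
    then have "supp (c * x) \<subseteq> {g + k |g k. g \<in> G}"
      by (auto simp: mult.commute[of c] supp_Monom_times)
    with y show "supp (c * x + y) \<subseteq> {g + k |g k. g \<in> G}"
      using Poly_Mapping.keys_add[of "c * x" y] by blast
  qed
next
  assume sub: "supp p \<subseteq> {g + k |g k. g \<in> G}"
  have "(\<Sum>m\<in>supp p. Const (cf p m) * Monom m) \<in> ideal_span (Monom ` G)"
  proof (rule ideal_span_sum)
    fix m assume "m \<in> supp p"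
    then obtain g k where g: "g \<in> G" "m = g + k" using sub by blast
    have "Const (cf p m) * Monom m = (Const (cf p m) * Monom k) * (Monom g :: 'k poly4)"
      by (simp add: g mult_single add.commute)
    also have "\<dots> \<in> ideal_span (Monom ` G)"
      using g by (intro ideal_span_times ideal_span_base) blast
    finally show "Const (cf p m) * Monom m \<in> ideal_span (Monom ` G)" .
  qed
  then show "p \<in> ideal_span (Monom ` G)"
    using sum_monomials[OF finite_keys order_refl, of p] by simp
qed

lemma up_closed_generated: "up_closed {g + k |g k. g \<in> G}"
  unfolding up_closed_def using add.assoc by blast

lemma monomial_ideal_up_closed:
  fixes p :: "'k::comm_ring_1 poly4"
  assumes "up_closed E"
  shows "p \<in> ideal_span (Monom ` E) \<longleftrightarrow> supp p \<subseteq> E"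
proof -
  have "{g + k |g k. g \<in> E} = E"
  proof
    show "{g + k |g k. g \<in> E} \<subseteq> E" using assms by (auto simp: up_closed_def)
    have "\<exists>g k. m = g + k \<and> g \<in> E" if "m \<in> E" for m
      using that by (intro exI[of _ m] exI[of _ 0]) simp
    then show "E \<subseteq> {g + k |g k. g \<in> E}" by blast
  qed
  then show ?thesis by (simp add: monomial_ideal_iff)
qed

lemma Monom_in_monomial_ideal:
  assumes "up_closed E"
  shows "(Monom m :: 'k::comm_ring_1 poly4) \<in> ideal_span (Monom ` E) \<longleftrightarrow> m \<in> E"
  using monomial_ideal_up_closed[OF assms, of "Monom m :: 'k poly4"] by simp

section \<open>Hilbert functions\<close>

text \<open>Uniqueness of the coefficients that represent 0 is linear independence modulo
  \<open>W\<close>. If \<open>B'\<close> were larger, its expansions in \<open>B\<close> would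
  satisfy a nontrivial linear relation, which gives 0 a second representation.\<close>

lemma quotient_basis_card_le:
  fixes W :: "'k::field poly4 set"
  assumes W: "W = ideal_span S"
    and B: "quotient_basis B V W" and B': "quotient_basis B' V W" and V: "0 \<in> V"
  shows "card B' \<le> card B"
proof (rule ccontr)
  assume "\<not> card B' \<le> card B"
  then have less: "card B < card B'" by simp
  have fin: "finite B" "finite B'" and sub: "B' \<subseteq> V"
    using B B' by (simp_all add: quotient_basis_def)
  have "\<forall>b'\<in>B'. \<exists>\<gamma>. b' - (\<Sum>b\<in>B. Const (\<gamma> b) * b) \<in> W"
    using B sub unfolding quotient_basis_def by blast
  from bchoice[OF this] obtain \<gamma> where
    \<gamma>: "\<And>b'. b' \<in> B' \<Longrightarrow> b' - (\<Sum>b\<in>B. Const (\<gamma> b' b) * b) \<in> W" by blast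
  obtain \<alpha> where \<alpha>: "\<exists>x\<in>B'. \<alpha> x \<noteq> 0" "\<forall>b\<in>B. (\<Sum>x\<in>B'. \<alpha> x * \<gamma> x b) = 0"
    using homogeneous_system[OF fin less, of \<gamma>] by blast
  define \<delta> where "\<delta> x = (if x \<in> B' then - \<alpha> x else 0)" for x
  have "(\<Sum>x\<in>B'. Const (\<alpha> x) * (x - (\<Sum>b\<in>B. Const (\<gamma> x b) * b))) \<in> W"
    using \<gamma> unfolding W by (auto intro!: ideal_span_sum ideal_span_times simp del: single_zero)
  also have "(\<Sum>x\<in>B'. Const (\<alpha> x) * (x - (\<Sum>b\<in>B. Const (\<gamma> x b) * b))) =
      (\<Sum>x\<in>B'. Const (\<alpha> x) * x) - (\<Sum>b\<in>B. Const (\<Sum>x\<in>B'. \<alpha> x * \<gamma> x b) * b)"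
  proof -
    have "(\<Sum>b\<in>B. Const (\<Sum>x\<in>B'. \<alpha> x * \<gamma> x b) * b) =
        (\<Sum>b\<in>B. \<Sum>x\<in>B'. Const (\<alpha> x) * (Const (\<gamma> x b) * b))"
      unfolding Const_sum Const_mult sum_distrib_right mult.assoc ..
    also have "\<dots> = (\<Sum>x\<in>B'. Const (\<alpha> x) * (\<Sum>b\<in>B. Const (\<gamma> x b) * b))"
      unfolding sum_distrib_left by (rule sum.swap)
    finally show ?thesis by (simp only: right_diff_distrib sum_subtractf)
  qed
  also have "\<dots> = 0 - (\<Sum>x\<in>B'. Const (\<delta> x) * x)"
    using \<alpha>(2) by (simp add: \<delta>_def single_uminus sum_negf)
  finally have 1: "0 - (\<Sum>x\<in>B'. Const (\<delta> x) * x) \<in> W" .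
  define Q where "Q \<gamma> \<longleftrightarrow> (\<forall>b. b \<notin> B' \<longrightarrow> \<gamma> b = 0) \<and> 0 - (\<Sum>b\<in>B'. Const (\<gamma> b) * b) \<in> W"
    for \<gamma> :: "'k poly4 \<Rightarrow> 'k"
  have "\<exists>!\<gamma>. Q \<gamma>" using B' V unfolding quotient_basis_def Q_def by blast
  moreover have "Q \<delta>" using 1 by (simp add: Q_def \<delta>_def)
  moreover have "Q (\<lambda>_. 0)" using ideal_span_0 W by (simp add: Q_def)
  ultimately have "\<delta> = (\<lambda>_. 0)" by blast
  from fun_cong[OF this] have "\<alpha> x = 0" if "x \<in> B'" for x
    using that by (metis \<delta>_def neg_equal_0_iff_equal)
  then show False using \<alpha>(1) by blast
qed

lemma quotient_dim_eqI:
  assumes "W = ideal_span S" "quotient_basis B V W" "0 \<in> V"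
  shows "quotient_dim V W = card B"
  unfolding quotient_dim_def
proof (rule the_equality)
  show "\<exists>B'. quotient_basis B' V W \<and> card B' = card B" using assms by blast
  fix n assume "\<exists>B'. quotient_basis B' V W \<and> card B' = n"
  then show "n = card B" using quotient_basis_card_le assms by (metis le_antisym)
qed

lemma hilbert_function_monomial:
  assumes E: "up_closed E"
  shows "hilbert_function (ideal_span (Monom ` E) :: 'k::field poly4 set) i = card (mons i - E)"
proof -
  let ?J = "ideal_span (Monom ` E) :: 'k poly4 set"
  define B where "B = (Monom :: mon4 \<Rightarrow> 'k poly4) ` (mons i - E)"
  have inj: "inj (Monom :: mon4 \<Rightarrow> 'k poly4)"
    by (rule injI) (metis cf_Monom zero_neq_one)
  have sumB: "(\<Sum>b\<in>B. Const (\<gamma> b) * b) = (\<Sum>m\<in>mons i - E. Const (\<gamma> (Monom m)) * Monom m)" for \<gamma>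
    unfolding B_def by (subst sum.reindex) (use inj in \<open>auto simp: inj_on_def\<close>)
  have cfB: "cf (\<Sum>b\<in>B. Const (\<gamma> b) * b) n = (if n \<in> mons i - E then \<gamma> (Monom n) else 0)" for \<gamma> n
    unfolding sumB by (rule cf_sum_Monom) simp
  have "quotient_basis B (homog_part i) ?J"
    unfolding quotient_basis_def
  proof (intro conjI ballI)
    show "finite B" by (simp add: B_def)
    show "B \<subseteq> homog_part i" by (auto simp: B_def homog_part_def mons_def)
    fix v :: "'k poly4" assume v: "v \<in> homog_part i"
    define \<gamma>0 where "\<gamma>0 b = (if b \<in> B then cf v (the_inv Monom b) else 0)" for b
    have \<gamma>0: "\<gamma>0 (Monom n) = cf v n" if "n \<in> mons i - E" for n
      using that the_inv_f_f[OF inj, of n] by (simp add: \<gamma>0_def B_def)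
    show "\<exists>!\<gamma>. (\<forall>b. b \<notin> B \<longrightarrow> \<gamma> b = 0) \<and> v - (\<Sum>b\<in>B. Const (\<gamma> b) * b) \<in> ?J"
    proof (rule ex1I[of _ \<gamma>0], intro conjI allI impI)
      show "\<gamma>0 b = 0" if "b \<notin> B" for b using that by (simp add: \<gamma>0_def)
      show "v - (\<Sum>b\<in>B. Const (\<gamma>0 b) * b) \<in> ?J"
        unfolding monomial_ideal_up_closed[OF E]
        using v \<gamma>0 by (auto simp: in_keys_iff lookup_minus cfB homog_part_def mons_def split: if_splits)
    next
      fix \<gamma> assume \<gamma>: "(\<forall>b. b \<notin> B \<longrightarrow> \<gamma> b = 0) \<and> v - (\<Sum>b\<in>B. Const (\<gamma> b) * b) \<in> ?J"
      have "\<gamma> (Monom n) = cf v n" if "n \<in> mons i - E" for n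
      proof -
        from \<gamma> have "supp (v - (\<Sum>b\<in>B. Const (\<gamma> b) * b)) \<subseteq> E"
          by (simp add: monomial_ideal_up_closed[OF E])
        with that have "cf (v - (\<Sum>b\<in>B. Const (\<gamma> b) * b)) n = 0" by (auto simp: in_keys_iff)
        then show ?thesis using that by (simp add: lookup_minus cfB)
      qed
      then have "\<gamma> b = \<gamma>0 b" if "b \<in> B" for b using that \<gamma>0 by (auto simp: B_def)
      then show "\<gamma> = \<gamma>0" using \<gamma> by (auto simp: \<gamma>0_def)
    qed
  qed
  then have "hilbert_function ?J i = card B"
    unfolding hilbert_function_def by (rule quotient_dim_eqI[OF refl]) (simp add: homog_part_def)
  then show ?thesis
    using inj by (simp add: B_def card_image inj_on_def)
qed

section \<open>Almost revlex ideals\<close>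

lemma almost_revlex_idealI:
  fixes E :: "mon4 set"
  assumes E: "up_closed E"
    and revlex: "\<And>u v. u \<in> E \<Longrightarrow> (\<And>g k. g \<in> E \<Longrightarrow> u = g + k \<Longrightarrow> k = 0) \<Longrightarrow>
      mdeg v = mdeg u \<Longrightarrow> revlex_less u v \<Longrightarrow> v \<in> E"
  shows "almost_revlex_ideal (ideal_span (Monom ` E) :: 'k::field poly4 set)"
proof -
  let ?J = "ideal_span (Monom ` E) :: 'k poly4 set"
  define G where "G = {u\<in>E. \<forall>g k. g \<in> E \<longrightarrow> u = g + k \<longrightarrow> k = 0}"
  have gen: "\<exists>g\<in>G. \<exists>k. u = g + k" if "u \<in> E" for u
    using that
  proof (induction "mdeg u" arbitrary: u rule: less_induct)
    case less
    show ?case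
    proof (cases "u \<in> G")
      case True
      then show ?thesis by (metis add.right_neutral)
    next
      case False
      then obtain g k where gk: "g \<in> E" "u = g + k" "k \<noteq> 0" using less.prems by (auto simp: G_def)
      then have "mdeg g < mdeg u" by (simp add: neq0_conv[symmetric])
      from less.hyps[OF this gk(1)] gk show ?thesis by (metis add.assoc)
    qed
  qed
  have "{g + k |g k. g \<in> G} = E"
  proof
    show "{g + k |g k. g \<in> G} \<subseteq> E" using E by (auto simp: G_def up_closed_def)
    show "E \<subseteq> {g + k |g k. g \<in> G}" using gen by blast
  qed
  then have span: "ideal_span (Monom ` G) = ?J"
    unfolding set_eq_iff monomial_ideal_up_closed[OF E] unfolding monomial_ideal_iff by simp
  have "ideal_span (Monom ` H) \<noteq> ?J" if H: "H \<subset> G" for H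
  proof
    assume eq: "ideal_span (Monom ` H) = ?J"
    obtain u where u: "u \<in> G" "u \<notin> H" using H by blast
    then have "(Monom u :: 'k poly4) \<in> ideal_span (Monom ` H)"
      using Monom_in_monomial_ideal[OF E] eq by (auto simp: G_def)
    then obtain h k where "h \<in> H" "u = h + k" by (auto simp: monomial_ideal_iff)
    moreover have "h \<in> E" using \<open>h \<in> H\<close> H by (auto simp: G_def)
    ultimately show False using u by (auto simp: G_def)
  qed
  then have "minimal_monomial_generators G ?J"
    using span by (simp add: minimal_monomial_generators_def)
  then show ?thesis unfolding almost_revlex_ideal_def
    using revlex Monom_in_monomial_ideal[OF E, where ?'k = 'k] by (intro exI[of _ G]) (auto simp: G_def)
qed

lemma almost_revlex_idealD:
  fixes J :: "'k::field poly4 set"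
  assumes "almost_revlex_ideal J"
  obtains E where "up_closed E" "J = ideal_span (Monom ` E)"
    "\<forall>u\<in>E. \<exists>g\<in>E. \<exists>k. u = g + k \<and> (\<forall>v. mdeg v = mdeg g \<longrightarrow> revlex_less g v \<longrightarrow> v \<in> E)"
proof -
  from assms obtain G where G: "ideal_span (Monom ` G) = J"
    "\<And>u v. u \<in> G \<Longrightarrow> mdeg v = mdeg u \<Longrightarrow> revlex_less u v \<Longrightarrow> Monom v \<in> J"
    unfolding almost_revlex_ideal_def minimal_monomial_generators_def by auto
  define E where "E = {g + k |g k. g \<in> G}"
  have E: "up_closed E" unfolding E_def by (rule up_closed_generated)
  have J: "J = ideal_span (Monom ` E)"
    unfolding G(1)[symmetric] set_eq_iff monomial_ideal_up_closed[OF E] unfolding monomial_ideal_iff E_def by blast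
  have "\<exists>g\<in>E. \<exists>k. u = g + k \<and> (\<forall>v. mdeg v = mdeg g \<longrightarrow> revlex_less g v \<longrightarrow> v \<in> E)" if "u \<in> E" for u
  proof -
    from that obtain g k where g: "g \<in> G" "u = g + k" by (auto simp: E_def)
    moreover have "g \<in> E" using g by (auto simp: E_def) (metis add.right_neutral)
    moreover have "v \<in> E" if "mdeg v = mdeg g" "revlex_less g v" for v
      using G(2)[OF g(1) that] Monom_in_monomial_ideal[OF E] J by blast
    ultimately show ?thesis by blast
  qed
  then have "\<forall>u\<in>E. \<exists>g\<in>E. \<exists>k. u = g + k \<and> (\<forall>v. mdeg v = mdeg g \<longrightarrow> revlex_less g v \<longrightarrow> v \<in> E)" ..
  from that[OF E J this] show thesis .
qed

text \<open>In the first degree where the ideals differ, equal Hilbert functions give each of them a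
  monomial that the other lacks. Both monomials are generators, so the larger one also belongs to
  the ideal of the smaller one.\<close>

lemma almost_revlex_unique:
  fixes J J' :: "'k::field poly4 set"
  assumes "almost_revlex_ideal J" "almost_revlex_ideal J'"
    and hf: "hilbert_function J = hilbert_function J'"
  shows "J = J'"
proof -
  from assms(1) obtain E where E: "up_closed E" "J = ideal_span (Monom ` E)"
    "\<forall>u\<in>E. \<exists>g\<in>E. \<exists>k. u = g + k \<and> (\<forall>v. mdeg v = mdeg g \<longrightarrow> revlex_less g v \<longrightarrow> v \<in> E)"
    by (rule almost_revlex_idealD) (rule that)
  from assms(2) obtain E' where E': "up_closed E'" "J' = ideal_span (Monom ` E')"
    "\<forall>u\<in>E'. \<exists>g\<in>E'. \<exists>k. u = g + k \<and> (\<forall>v. mdeg v = mdeg g \<longrightarrow> revlex_less g v \<longrightarrow> v \<in> E')"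
    by (rule almost_revlex_idealD) (rule that)
  have card: "card (mons j - E) = card (mons j - E')" for j
    using fun_cong[OF hf, of j] by (simp add: E(2) E'(2) hilbert_function_monomial E(1) E'(1))
  have "mons j \<inter> E = mons j \<inter> E'" for j
  proof (induction j rule: less_induct)
    case (less j)
    have low: "\<forall>u. mdeg u < j \<longrightarrow> (u \<in> E \<longleftrightarrow> u \<in> E')"
      using less by (auto simp: mons_def)
    then have low': "\<forall>u. mdeg u < j \<longrightarrow> (u \<in> E' \<longleftrightarrow> u \<in> E)" by simp
    \<comment> \<open>A divisor \<open>g\<close> of smaller degree would lie in both ideals and
      bring \<open>u\<close> into \<open>F'\<close>. So \<open>g\<close> has degree \<open>j\<close>
      and equals \<open>u\<close>.\<close>
    have new: "\<forall>v. mdeg v = j \<longrightarrow> revlex_less u v \<longrightarrow> v \<in> F"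
      if F: "\<forall>u\<in>F. \<exists>g\<in>F. \<exists>k. u = g + k \<and> (\<forall>v. mdeg v = mdeg g \<longrightarrow> revlex_less g v \<longrightarrow> v \<in> F)"
        and F': "up_closed F'" and eq: "\<forall>u. mdeg u < j \<longrightarrow> (u \<in> F \<longleftrightarrow> u \<in> F')"
        and u: "u \<in> mons j" "u \<in> F" "u \<notin> F'" for F F' u
    proof -
      obtain g k where g: "g \<in> F" "u = g + k" "\<forall>v. mdeg v = mdeg g \<longrightarrow> revlex_less g v \<longrightarrow> v \<in> F"
        using F u(2) by blast
      have "\<not> mdeg g < j" using g(1,2) eq u(3) up_closedD[OF F', of g k] by blast
      moreover have "mdeg g + mdeg k = j" using g(2) u(1) by (simp add: mons_def)
      ultimately have "mdeg k = 0" by linarith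
      then show ?thesis using g(2,3) u(1) by (simp add: mons_def)
    qed
    show ?case
    proof (rule ccontr)
      assume neq: "mons j \<inter> E \<noteq> mons j \<inter> E'"
      have "\<not> mons j - E \<subseteq> mons j - E'" "\<not> mons j - E' \<subseteq> mons j - E"
        using card_subset_eq[of "mons j - E'" "mons j - E"] card_subset_eq[of "mons j - E" "mons j - E'"]
          card[of j] neq by auto
      then obtain u u' where u: "u \<in> mons j" "u \<in> E" "u \<notin> E'" and u': "u' \<in> mons j" "u' \<in> E'" "u' \<notin> E"
        by blast
      have "revlex_less u u' \<or> revlex_less u' u" using revlex_total[of u u'] u(2) u'(3) by auto
      then show False
      proof
        assume "revlex_less u u'"
        then show False using new[OF E(3) E'(1) low u] u' by (simp add: mons_def)
      next
        assume "revlex_less u' u"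
        then show False using new[OF E'(3) E(1) low' u'] u by (simp add: mons_def)
      qed
    qed
  qed
  then have "m \<in> mons (mdeg m) \<inter> E \<longleftrightarrow> m \<in> mons (mdeg m) \<inter> E'" for m by simp
  then have "E = E'" unfolding set_eq_iff by (simp add: mons_def)
  then show ?thesis by (simp add: E(2) E'(2))
qed

section \<open>Leading monomials of graded pieces\<close>

definition kspace :: "('v, 'k::comm_ring_1) mpoly set \<Rightarrow> bool" where
  "kspace P \<longleftrightarrow> 0 \<in> P \<and> (\<forall>p\<in>P. \<forall>q\<in>P. p + q \<in> P) \<and> (\<forall>c. \<forall>p\<in>P. Const c * p \<in> P)"

lemma kspace_0: "kspace P \<Longrightarrow> 0 \<in> P"
  and kspace_add: "kspace P \<Longrightarrow> p \<in> P \<Longrightarrow> q \<in> P \<Longrightarrow> p + q \<in> P"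
  and kspace_Const: "kspace P \<Longrightarrow> p \<in> P \<Longrightarrow> Const c * p \<in> P"
  by (simp_all add: kspace_def)

lemma kspace_uminus: "kspace P \<Longrightarrow> p \<in> P \<Longrightarrow> - p \<in> P"
  using kspace_Const[of P p "-1"] by (simp add: single_uminus)

lemma kspace_diff: "kspace P \<Longrightarrow> p \<in> P \<Longrightarrow> q \<in> P \<Longrightarrow> p - q \<in> P"
  using kspace_add[of P p "- q"] kspace_uminus[of P q] by simp

lemma kspace_sum: "kspace P \<Longrightarrow> (\<And>x. x \<in> A \<Longrightarrow> p x \<in> P) \<Longrightarrow> sum p A \<in> P"
  by (induction A rule: infinite_finite_induct) (auto simp: kspace_0 kspace_add)

definition LM :: "'k::comm_ring_1 poly4 set \<Rightarrow> mon4 set" where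
  "LM P = {lead_monom p |p. p \<in> P \<and> p \<noteq> 0}"

text \<open>An element of \<open>P\<close> supported on \<open>N\<close> is a linear relation modulo
  \<open>P\<close> between the monomials of \<open>N\<close>. So this is their linear independence
  modulo \<open>P\<close>.\<close>

definition indep_mod :: "'k::comm_ring_1 poly4 set \<Rightarrow> mon4 set \<Rightarrow> bool" where
  "indep_mod P N \<longleftrightarrow> (\<forall>p\<in>P. supp p \<subseteq> N \<longrightarrow> p = 0)"

lemma indep_mod_LM: "indep_mod P (N - LM P)"
proof (unfold indep_mod_def, intro ballI impI)
  fix p assume p: "p \<in> P" "supp p \<subseteq> N - LM P"
  show "p = 0"
  proof (rule ccontr)
    assume "p \<noteq> 0"
    then have "lead_monom p \<in> supp p" "lead_monom p \<in> LM P"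
      using p lead_monom_in by (auto simp: LM_def)
    then show False using p by blast
  qed
qed

lemma supp_Const_times: "supp (Const c * p) \<subseteq> supp (p :: ('v, 'k::comm_ring_1) mpoly)"
  by (auto simp: in_keys_iff)

lemma supp_diff: "supp (p - q) \<subseteq> supp p \<union> supp (q :: ('v, 'k::comm_ring_1) mpoly)"
  by (auto simp: in_keys_iff lookup_minus)

lemma homog_part_iff: "p \<in> homog_part j \<longleftrightarrow> supp p \<subseteq> mons j"
  by (auto simp: homog_part_def mons_def)

lemma LM_subset: "P \<subseteq> homog_part j \<Longrightarrow> LM P \<subseteq> mons j"
proof
  fix m assume P: "P \<subseteq> homog_part j" and "m \<in> LM P"
  then obtain p where p: "p \<in> P" "p \<noteq> 0" "m = lead_monom p" unfolding LM_def by auto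
  then have "supp p \<subseteq> mons j" using P homog_part_iff[of p j] by auto
  then show "m \<in> mons j" using lead_monom_in[OF p(2)] p(3) by auto
qed

text \<open>If \<open>m\<close> is a leading monomial of \<open>P\<close>, subtracting a multiple of
  the corresponding element leaves only smaller monomials, which are reduced by induction.\<close>

lemma reduce_Monom:
  fixes P :: "'k::field poly4 set"
  assumes P: "kspace P" "P \<subseteq> homog_part j" and m: "m \<in> mons j"
  shows "\<exists>r. supp r \<subseteq> {n\<in>mons j. n = m \<or> revlex_less n m} - LM P \<and> Monom m - r \<in> P"
  using m
proof (induction "card {n\<in>mons j. revlex_less n m}" arbitrary: m rule: less_induct)
  case less
  show ?case
  proof (cases "m \<in> LM P")
    case False
    then show ?thesis using less.prems P by (intro exI[of _ "Monom m"]) (simp add: kspace_0)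
  next
    case True
    then obtain p where p: "p \<in> P" "p \<noteq> 0" "lead_monom p = m" by (auto simp: LM_def)
    define c where "c = cf p m"
    have c: "c \<noteq> 0" using lead_monom_in[OF p(2)] p(3) by (simp add: c_def in_keys_iff)
    define A where "A = {n\<in>mons j. revlex_less n m}"
    have "\<forall>n\<in>A. \<exists>r. supp r \<subseteq> {k\<in>mons j. k = n \<or> revlex_less k n} - LM P \<and> Monom n - r \<in> P"
    proof
      fix n assume n: "n \<in> A"
      then have "{k\<in>mons j. revlex_less k n} \<subset> {n\<in>mons j. revlex_less n m}"
        unfolding A_def using revlex_trans revlex_irrefl[of n] by blast
      then have "card {k\<in>mons j. revlex_less k n} < card {n\<in>mons j. revlex_less n m}"
        by (rule psubset_card_mono[rotated]) simp
      from less.hyps[OF this] n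
      show "\<exists>r. supp r \<subseteq> {k\<in>mons j. k = n \<or> revlex_less k n} - LM P \<and> Monom n - r \<in> P"
        by (simp add: A_def)
    qed
    from bchoice[OF this] obtain r where
      r: "\<And>n. n \<in> A \<Longrightarrow> supp (r n) \<subseteq> {k\<in>mons j. k = n \<or> revlex_less k n} - LM P"
         "\<And>n. n \<in> A \<Longrightarrow> Monom n - r n \<in> P" by blast
    define q where "q = Monom m - Const (inverse c) * p"
    have q: "supp q \<subseteq> A"
    proof
      fix n assume n: "n \<in> supp q"
      have nm: "n \<noteq> m" using n c by (auto simp: in_keys_iff q_def lookup_minus c_def)
      then have "n \<in> supp p" using n by (auto simp: in_keys_iff q_def lookup_minus cf_Monom)
      then show "n \<in> A"
        using nm p P(2) lead_monom_max[OF p(2)] homog_part_iff[of p j] by (auto simp: A_def)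
    qed
    have finA: "finite A" by (simp add: A_def)
    define R where "R = (\<Sum>n\<in>A. Const (cf q n) * r n)"
    have "supp (Const (cf q n) * r n) \<subseteq> {n\<in>mons j. n = m \<or> revlex_less n m} - LM P" if "n \<in> A" for n
    proof -
      have "{k\<in>mons j. k = n \<or> revlex_less k n} \<subseteq> {n\<in>mons j. n = m \<or> revlex_less n m}"
        using that revlex_trans by (auto simp: A_def)
      then show ?thesis using r(1)[OF that] supp_Const_times[of "cf q n" "r n"] by blast
    qed
    then have "supp R \<subseteq> {n\<in>mons j. n = m \<or> revlex_less n m} - LM P"
      unfolding R_def using Poly_Mapping.keys_sum[of "\<lambda>n. Const (cf q n) * r n" A] by blast
    moreover have "Monom m - R \<in> P"
    proof -
      have "Monom m - R = Const (inverse c) * p + (\<Sum>n\<in>A. Const (cf q n) * (Monom n - r n))"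
        using sum_monomials[OF finA q] by (simp add: q_def R_def right_diff_distrib sum_subtractf)
      also have "\<dots> \<in> P"
        by (intro kspace_add[OF P(1)] kspace_Const[OF P(1)] kspace_sum[OF P(1)] p(1) r(2))
      finally show ?thesis .
    qed
    ultimately show ?thesis by blast
  qed
qed

lemma reduce:
  fixes P :: "'k::field poly4 set"
  assumes P: "kspace P" "P \<subseteq> homog_part j" and N: "lower_segment j N" and f: "supp f \<subseteq> N"
  shows "\<exists>r. supp r \<subseteq> N - LM P \<and> f - r \<in> P"
proof -
  have sub: "N \<subseteq> mons j" and low: "\<And>n m. n \<in> N \<Longrightarrow> m \<in> mons j \<Longrightarrow> revlex_less m n \<Longrightarrow> m \<in> N"
    using N unfolding lower_segment_def by blast+
  have finN: "finite N" using sub finite_mons finite_subset by blast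
  have "\<forall>m\<in>N. \<exists>r. supp r \<subseteq> {n\<in>mons j. n = m \<or> revlex_less n m} - LM P \<and> Monom m - r \<in> P"
    using reduce_Monom[OF P] sub by blast
  from bchoice[OF this] obtain r where
    r: "\<And>n. n \<in> N \<Longrightarrow> supp (r n) \<subseteq> {k\<in>mons j. k = n \<or> revlex_less k n} - LM P"
       "\<And>n. n \<in> N \<Longrightarrow> Monom n - r n \<in> P" by blast
  define R where "R = (\<Sum>n\<in>N. Const (cf f n) * r n)"
  have "supp (Const (cf f n) * r n) \<subseteq> N - LM P" if "n \<in> N" for n
  proof -
    have "{k\<in>mons j. k = n \<or> revlex_less k n} \<subseteq> N" using that low by auto
    then show ?thesis using r(1)[OF that] supp_Const_times[of "cf f n" "r n"] by blast
  qed
  then have "supp R \<subseteq> N - LM P"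
    unfolding R_def using Poly_Mapping.keys_sum[of "\<lambda>n. Const (cf f n) * r n" N] by blast
  moreover have "f - R \<in> P"
  proof -
    have "f - R = (\<Sum>n\<in>N. Const (cf f n) * (Monom n - r n))"
      using sum_monomials[OF finN f] by (simp add: R_def right_diff_distrib sum_subtractf)
    also have "\<dots> \<in> P" by (intro kspace_Const[OF P(1)] kspace_sum[OF P(1)] r(2))
    finally show ?thesis .
  qed
  ultimately show ?thesis by blast
qed

text \<open>The monomials of \<open>N'\<close> reduce to combinations of the standard monomials of
  \<open>N\<close>. With fewer of these, some combination of the remainders vanishes, and the same
  combination of the monomials is a nonzero element of \<open>P\<close> supported on
  \<open>N'\<close>. Together with \<open>indep_mod_LM\<close> this characterises the number of
  standard monomials in a lower segment without mentioning leading monomials.\<close>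

lemma indep_card_le:
  fixes P :: "'k::field poly4 set"
  assumes P: "kspace P" "P \<subseteq> homog_part j" and N: "lower_segment j N"
    and N': "N' \<subseteq> N" "indep_mod P N'"
  shows "card N' \<le> card (N - LM P)"
proof (rule ccontr)
  assume "\<not> card N' \<le> card (N - LM P)"
  then have less: "card (N - LM P) < card N'" by simp
  have finN: "finite N" using N finite_mons finite_subset unfolding lower_segment_def by blast
  then have fin: "finite (N - LM P)" "finite N'" using N'(1) finite_subset by auto
  have "\<forall>n\<in>N'. \<exists>r. supp r \<subseteq> N - LM P \<and> Monom n - r \<in> P"
  proof
    fix n assume "n \<in> N'"
    then have "supp (Monom n :: 'k poly4) \<subseteq> N" using N'(1) by auto
    from reduce[OF P N this] show "\<exists>r. supp r \<subseteq> N - LM P \<and> Monom n - r \<in> P" .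
  qed
  from bchoice[OF this] obtain r where
    r: "\<And>n. n \<in> N' \<Longrightarrow> supp (r n) \<subseteq> N - LM P" "\<And>n. n \<in> N' \<Longrightarrow> Monom n - r n \<in> P" by blast
  obtain \<alpha> where \<alpha>: "\<exists>x\<in>N'. \<alpha> x \<noteq> 0" "\<forall>m\<in>N - LM P. (\<Sum>n\<in>N'. \<alpha> n * cf (r n) m) = 0"
    using homogeneous_system[OF fin less, of "\<lambda>n m. cf (r n) m"] by blast
  have R: "(\<Sum>n\<in>N'. Const (\<alpha> n) * r n) = 0"
  proof (rule poly_mapping_eqI)
    fix m
    show "cf (\<Sum>n\<in>N'. Const (\<alpha> n) * r n) m = cf 0 m"
    proof (cases "m \<in> N - LM P")
      case True
      then show ?thesis using \<alpha>(2) by (simp add: cf_sum)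
    next
      case False
      then have "cf (r n) m = 0" if "n \<in> N'" for n
        using r(1)[OF that] by (auto simp: in_keys_iff)
      then show ?thesis by (simp add: cf_sum)
    qed
  qed
  define p where "p = (\<Sum>n\<in>N'. Const (\<alpha> n) * (Monom n - r n))"
  have "p \<in> P" unfolding p_def by (intro kspace_sum[OF P(1)] kspace_Const[OF P(1)] r(2))
  have p: "p = (\<Sum>n\<in>N'. Const (\<alpha> n) * Monom n)"
    using R by (simp add: p_def right_diff_distrib sum_subtractf)
  have cfp: "cf p m = (if m \<in> N' then \<alpha> m else 0)" for m
    unfolding p by (rule cf_sum_Monom[OF fin(2)])
  have "supp p \<subseteq> N'" by (auto simp: in_keys_iff cfp split: if_splits)
  then have "p = 0" using N'(2) \<open>p \<in> P\<close> by (simp add: indep_mod_def)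
  then show False using \<alpha>(1) cfp by (metis lookup_zero)
qed

text \<open>With too few leading monomials, some nonzero element would have coefficient zero at its
  own leading monomial. With too many, elements with distinct leading monomials would be linearly
  dependent, but the largest of these monomials cannot cancel.\<close>

lemma card_LM:
  fixes b :: "'x \<Rightarrow> 'k::field poly4"
  assumes P: "P = {(\<Sum>x\<in>X. Const (c x) * b x) |c. True}" "P \<subseteq> homog_part j" and X: "finite X"
    and indep: "\<And>c. (\<Sum>x\<in>X. Const (c x) * b x) = 0 \<Longrightarrow> \<forall>x\<in>X. c x = 0"
  shows "card (LM P) = card X"
proof (rule antisym; rule ccontr)
  have fin: "finite (LM P)" using LM_subset[OF P(2)] finite_mons finite_subset by blast
  {
    assume "\<not> card X \<le> card (LM P)"
    then have "card (LM P) < card X" by simp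
    from homogeneous_system[OF fin X this, of "\<lambda>x m. cf (b x) m"] obtain \<alpha> where
      \<alpha>: "\<exists>x\<in>X. \<alpha> x \<noteq> 0" "\<forall>m\<in>LM P. (\<Sum>x\<in>X. \<alpha> x * cf (b x) m) = 0" by blast
    define p where "p = (\<Sum>x\<in>X. Const (\<alpha> x) * b x)"
    have "p \<in> P" unfolding P p_def by blast
    moreover have "p \<noteq> 0" using indep[of \<alpha>] \<alpha>(1) by (auto simp: p_def)
    ultimately have "lead_monom p \<in> LM P" "lead_monom p \<in> supp p"
      using lead_monom_in by (auto simp: LM_def)
    then show False using \<alpha>(2) by (auto simp: p_def in_keys_iff cf_sum)
  next
    assume "\<not> card (LM P) \<le> card X"
    then have less: "card X < card (LM P)" by simp
    have "\<forall>m\<in>LM P. \<exists>c. (\<Sum>x\<in>X. Const (c x) * b x) \<noteq> 0 \<and> lead_monom (\<Sum>x\<in>X. Const (c x) * b x) = m"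
      unfolding LM_def P by blast
    from bchoice[OF this] obtain c where
      c: "\<And>m. m \<in> LM P \<Longrightarrow> (\<Sum>x\<in>X. Const (c m x) * b x) \<noteq> 0"
         "\<And>m. m \<in> LM P \<Longrightarrow> lead_monom (\<Sum>x\<in>X. Const (c m x) * b x) = m" by blast
    from homogeneous_system[OF X fin less, of c] obtain \<alpha> where
      \<alpha>: "\<exists>m\<in>LM P. \<alpha> m \<noteq> 0" "\<forall>x\<in>X. (\<Sum>m\<in>LM P. \<alpha> m * c m x) = 0" by blast
    define p where "p m = (\<Sum>x\<in>X. Const (c m x) * b x)" for m
    have "(\<Sum>m\<in>LM P. Const (\<alpha> m) * p m) = (\<Sum>m\<in>LM P. \<Sum>x\<in>X. Const (\<alpha> m * c m x) * b x)"
      unfolding p_def sum_distrib_left Const_mult mult.assoc ..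
    also have "\<dots> = (\<Sum>x\<in>X. Const (\<Sum>m\<in>LM P. \<alpha> m * c m x) * b x)"
      unfolding Const_sum sum_distrib_right by (rule sum.swap)
    also have "\<dots> = 0" using \<alpha>(2) by simp
    finally have 0: "(\<Sum>m\<in>LM P. Const (\<alpha> m) * p m) = 0" .
    define A where "A = {m\<in>LM P. \<alpha> m \<noteq> 0}"
    have "finite A" "A \<noteq> {}" using fin \<alpha>(1) by (auto simp: A_def)
    from revlex_max[OF this] obtain m where m: "m \<in> A" "\<forall>n\<in>A. n \<noteq> m \<longrightarrow> revlex_less n m" by blast
    have mLM: "m \<in> LM P" using m by (simp add: A_def)
    have "cf (\<Sum>m\<in>LM P. Const (\<alpha> m) * p m) m = (\<Sum>n\<in>LM P. if n = m then \<alpha> m * cf (p m) m else 0)"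
      unfolding cf_sum
    proof (rule sum.cong[OF refl])
      fix n assume n: "n \<in> LM P"
      show "cf (Const (\<alpha> n) * p n) m = (if n = m then \<alpha> m * cf (p m) m else 0)"
      proof (cases "n = m \<or> \<alpha> n = 0")
        case False
        then have "revlex_less n m" using m n by (auto simp: A_def)
        moreover have "m \<in> supp (p n) \<Longrightarrow> m \<noteq> n \<Longrightarrow> revlex_less m n"
          using lead_monom_max[of "p n" m] c[OF n] by (simp add: p_def)
        ultimately have "m \<notin> supp (p n)" using False revlex_asym by blast
        then show ?thesis using False by (simp add: in_keys_iff)
      qed auto
    qed
    then have "\<alpha> m * cf (p m) m = 0" using 0 fin mLM by simp
    moreover have "cf (p m) m \<noteq> 0"
      using lead_monom_in[of "p m"] c[OF mLM] by (simp add: p_def in_keys_iff)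
    ultimately show False using m by (simp add: A_def)
  }
qed

section \<open>Linear changes of coordinates\<close>

lemma homog_part_add: "p \<in> homog_part j \<Longrightarrow> q \<in> homog_part j \<Longrightarrow> p + q \<in> homog_part j"
  unfolding homog_part_iff using Poly_Mapping.keys_add[of p q] by blast

lemma homog_part_diff:
  assumes "p \<in> homog_part j" "q \<in> homog_part j"
  shows "p - (q :: 'k::comm_ring_1 poly4) \<in> homog_part j"
  using assms supp_diff[of p q] unfolding homog_part_iff by blast

lemma homog_part_Const: "p \<in> homog_part j \<Longrightarrow> Const c * (p :: 'k::comm_ring_1 poly4) \<in> homog_part j"
  unfolding homog_part_iff using supp_Const_times[of c p] by blast

lemma homog_part_0: "0 \<in> homog_part j"
  by (simp add: homog_part_iff)

lemma homog_part_sum: "(\<And>x. x \<in> A \<Longrightarrow> p x \<in> homog_part j) \<Longrightarrow> sum p A \<in> homog_part j"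
  by (induction A rule: infinite_finite_induct) (auto simp: homog_part_0 homog_part_add)

lemma homog_part_mult:
  "p \<in> homog_part i \<Longrightarrow> q \<in> homog_part j \<Longrightarrow> p * (q :: 'k::comm_ring_1 poly4) \<in> homog_part (i + j)"
  unfolding homog_part_iff using Poly_Mapping.keys_mult[of p q] by (fastforce simp: mons_def)

lemma homog_part_1: "1 \<in> homog_part 0"
  by (simp add: homog_part_iff mons_def)

lemma homog_part_power:
  "(p :: 'k::comm_ring_1 poly4) \<in> homog_part i \<Longrightarrow> p ^ n \<in> homog_part (n * i)"
  by (induction n) (auto intro: homog_part_1 homog_part_mult)

lemma homog_part_prod:
  "(\<And>x. x \<in> A \<Longrightarrow> (p x :: 'k::comm_ring_1 poly4) \<in> homog_part (d x)) \<Longrightarrow> prod p A \<in> homog_part (sum d A)"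
  by (induction A rule: infinite_finite_induct) (auto intro: homog_part_1 homog_part_mult)

lemma homog_part_Var: "Var i \<in> homog_part 1"
  by (simp add: homog_part_iff mons_def)

lemma homog_part_Monom: "Monom m \<in> homog_part (mdeg m)"
  by (simp add: homog_part_iff mons_def)

lemma eval_homog:
  assumes x: "\<And>i. x i \<in> homog_part 1" and p: "p \<in> homog_part j"
  shows "eval_with Const x p \<in> (homog_part j :: 'k::comm_ring_1 poly4 set)"
proof -
  have "Const (cf p m) * (\<Prod>i\<in>UNIV. x i ^ cf m i) \<in> homog_part j" if "m \<in> supp p" for m
  proof -
    have "x i ^ cf m i \<in> homog_part (cf m i)" for i
      using homog_part_power[OF x[of i], of "cf m i"] by simp
    then have "(\<Prod>i\<in>UNIV. x i ^ cf m i) \<in> homog_part (mdeg m)"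
      unfolding mdeg_def by (rule homog_part_prod)
    moreover have "mdeg m = j" using p that by (auto simp: homog_part_iff mons_def)
    ultimately show ?thesis by (simp add: homog_part_Const)
  qed
  then show ?thesis unfolding eval_with_def by (rule homog_part_sum)
qed

lemma klinear_lin_change: "klinear (lin_change g)"
  unfolding lin_change_def by (rule klinear_eval)

lemma lin_change_mult: "lin_change g (p * q) = lin_change g p * lin_change g q"
  unfolding lin_change_def by (rule Const.eval_mult)

lemma lin_change_homog: "p \<in> homog_part j \<Longrightarrow> lin_change g p \<in> homog_part j"
  unfolding lin_change_def
  by (rule eval_homog) (intro homog_part_sum homog_part_Const homog_part_Var)

lemma lin_change_Var: "lin_change g (Var j) = (\<Sum>i\<in>UNIV. Const (g $ i $ j) * Var i)"
  unfolding lin_change_def by (rule Const.eval_Var)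

text \<open>Column \<open>j\<close> holds the image of the variable \<open>j\<close>, so composition
  of substitutions is the matrix product in the same order, a left action.\<close>

lemma lin_change_lin_change: "lin_change A (lin_change B p) = lin_change (A ** B) p"
proof -
  have "lin_change A (\<Sum>i\<in>UNIV. Const (B $ i $ j) * Var i) = (\<Sum>i\<in>UNIV. Const ((A ** B) $ i $ j) * Var i)" for j
  proof -
    have "lin_change A (\<Sum>i\<in>UNIV. Const (B $ i $ j) * Var i) =
        (\<Sum>i\<in>UNIV. \<Sum>k\<in>UNIV. Const (A $ k $ i * B $ i $ j) * Var k)"
      by (simp only: klinear_sum[OF klinear_lin_change] klinear_Const[OF klinear_lin_change]
          lin_change_Var sum_distrib_left Const_mult) (simp only: mult_ac)
    also have "\<dots> = (\<Sum>k\<in>UNIV. \<Sum>i\<in>UNIV. Const (A $ k $ i * B $ i $ j) * Var k)"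
      by (rule sum.swap)
    also have "\<dots> = (\<Sum>k\<in>UNIV. Const ((A ** B) $ k $ j) * Var k)"
      by (simp add: matrix_matrix_mult_def Const_sum sum_distrib_right del: One_nat_def)
    finally show ?thesis .
  qed
  then show ?thesis
    unfolding lin_change_def eval_eval by simp
qed

lemma lin_change_1: "lin_change (mat 1 :: 'a::field ^ 4 ^ 4) p = p"
proof -
  have "(\<Sum>i\<in>UNIV. Const ((mat 1 :: 'a ^ 4 ^ 4) $ i $ j) * Var i) = Var j" for j
  proof -
    have "(\<Sum>i\<in>UNIV. Const ((mat 1 :: 'a ^ 4 ^ 4) $ i $ j) * Var i) = (\<Sum>i\<in>UNIV. if i = j then Var i else 0)"
      by (intro sum.cong refl) (simp add: mat_def)
    also have "\<dots> = Var j" by (simp only: sum.delta finite UNIV_I if_True)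
    finally show ?thesis .
  qed
  then have "(\<lambda>j. \<Sum>i\<in>UNIV. Const ((mat 1 :: 'a ^ 4 ^ 4) $ i $ j) * Var i) = Var" by (rule ext)
  then show ?thesis unfolding lin_change_def by (simp only: eval_Var_self)
qed

lemma lin_change_inverse:
  assumes "invertible (g :: 'k::field ^ 4 ^ 4)"
  obtains g' where "\<And>p. lin_change g' (lin_change g p) = p" "\<And>p. lin_change g (lin_change g' p) = p"
proof -
  from assms obtain g' where "g ** g' = mat 1" "g' ** g = mat 1"
    unfolding invertible_def by blast
  then show thesis by (intro that[of g']) (simp_all add: lin_change_lin_change lin_change_1)
qed

lemma inj_lin_change: "invertible g \<Longrightarrow> inj (lin_change g)"
  by (metis lin_change_inverse injI)

section \<open>Homogeneous components and graded pieces of the transformed ideal\<close>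

definition hcomp :: "nat \<Rightarrow> 'k::comm_ring_1 poly4 \<Rightarrow> 'k poly4" where
  "hcomp j = lincomb (\<lambda>m. if mdeg m = j then Monom m else 0)"

lemma klinear_hcomp: "klinear (hcomp j)"
  unfolding hcomp_def by (rule klinear_lincomb)

lemma hcomp_Monom: "hcomp j (Monom m) = (if mdeg m = j then Monom m else 0)"
  by (simp add: hcomp_def)

lemma cf_hcomp: "cf (hcomp j p) n = (if mdeg n = j then cf p n else 0)"
proof (induction p rule: mpoly_induct)
  case (Monom m c)
  then show ?case by (simp add: klinear_Const[OF klinear_hcomp] hcomp_Monom cf_Monom)
qed (simp add: klinear_add[OF klinear_hcomp] lookup_add)

lemma supp_hcomp: "supp (hcomp j p) = supp p \<inter> mons j"
  by (auto simp: in_keys_iff cf_hcomp mons_def split: if_splits)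

lemma hcomp_homog: "p \<in> homog_part i \<Longrightarrow> hcomp j p = (if i = j then p else 0)"
  by (rule poly_mapping_eqI) (auto simp: cf_hcomp homog_part_def in_keys_iff)

lemma hcomp_lin_change: "hcomp j (lin_change g p) = lin_change g (hcomp j p)"
proof (rule klinear_eq[of "\<lambda>p. hcomp j (lin_change g p)" "\<lambda>p. lin_change g (hcomp j p)"])
  show "klinear (\<lambda>p. hcomp j (lin_change g p))" "klinear (\<lambda>p. lin_change g (hcomp j p))"
    by (simp_all add: klinear_def klinear_add[OF klinear_lin_change] klinear_add[OF klinear_hcomp]
        klinear_Const[OF klinear_lin_change] klinear_Const[OF klinear_hcomp])
  show "hcomp j (lin_change g (Monom m)) = lin_change g (hcomp j (Monom m))" for m
    using hcomp_homog[OF lin_change_homog[OF homog_part_Monom[of m]], of j g]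
    by (simp add: hcomp_Monom klinear_0[OF klinear_lin_change])
qed

text \<open>For up-closed \<open>M\<close> this is the degree \<open>j\<close> part of the
  transformed monomial ideal. Restricting to \<open>mons j\<close> before the substitution is
  legitimate because linear changes preserve degrees, and it makes the space the image of finitely
  many monomials.\<close>

definition piece :: "mon4 set \<Rightarrow> 'k::field ^ 4 ^ 4 \<Rightarrow> nat \<Rightarrow> 'k poly4 set" where
  "piece M g j = lin_change g ` {q. supp q \<subseteq> M \<inter> mons j}"

lemma kspace_supp: "kspace {q :: ('v, 'k::comm_ring_1) mpoly. supp q \<subseteq> A}"
  unfolding kspace_def
proof (intro conjI ballI allI)
  fix p q :: "('v, 'k) mpoly" assume "p \<in> {q. supp q \<subseteq> A}" "q \<in> {q. supp q \<subseteq> A}"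
  then show "p + q \<in> {q. supp q \<subseteq> A}" using Poly_Mapping.keys_add[of p q] by blast
next
  fix c and p :: "('v, 'k) mpoly" assume "p \<in> {q. supp q \<subseteq> A}"
  then show "Const c * p \<in> {q. supp q \<subseteq> A}" using supp_Const_times[of c p] by blast
qed simp

lemma kspace_image:
  assumes F: "klinear F" and P: "kspace P"
  shows "kspace (F ` P)"
  unfolding kspace_def
proof (intro conjI ballI allI)
  show "0 \<in> F ` P" using klinear_0[OF F] kspace_0[OF P] by (metis imageI)
next
  fix p q assume "p \<in> F ` P" "q \<in> F ` P"
  then obtain p' q' where "p' \<in> P" "q' \<in> P" "p = F p'" "q = F q'" by blast
  then show "p + q \<in> F ` P" using kspace_add[OF P] klinear_add[OF F, of p' q'] by (metis imageI)
next
  fix c p assume "p \<in> F ` P"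
  then obtain p' where "p' \<in> P" "p = F p'" by blast
  then show "Const c * p \<in> F ` P" using kspace_Const[OF P] klinear_Const[OF F, of c p'] by (metis imageI)
qed

lemma kspace_piece: "kspace (piece M g j)"
  unfolding piece_def by (intro kspace_image klinear_lin_change kspace_supp)

lemma piece_homog: "piece M g j \<subseteq> homog_part j"
proof
  fix p assume "p \<in> piece M g j"
  then obtain q where "q \<in> homog_part j" "p = lin_change g q"
    unfolding piece_def homog_part_iff by blast
  then show "p \<in> homog_part j" by (simp add: lin_change_homog)
qed

lemma card_LM_piece:
  fixes g :: "'k::field ^ 4 ^ 4"
  assumes inj: "inj (lin_change g)"
  shows "card (LM (piece M g j)) = card (M \<inter> mons j)"
proof (rule card_LM)
  let ?X = "M \<inter> mons j"
  have img: "(\<Sum>m\<in>?X. Const (c m) * lin_change g (Monom m)) = lin_change g (\<Sum>m\<in>?X. Const (c m) * Monom m)" for c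
    by (simp only: klinear_sum[OF klinear_lin_change] klinear_Const[OF klinear_lin_change])
  note cfX = cf_sum_Monom[of ?X, OF finite_Int[OF disjI2[OF finite_mons]]]
  show "piece M g j = {\<Sum>m\<in>?X. Const (c m) * lin_change g (Monom m) |c. True}"
  proof (intro equalityI subsetI)
    fix p assume "p \<in> piece M g j"
    then obtain q where q: "supp q \<subseteq> ?X" "p = lin_change g q" unfolding piece_def by blast
    then have "q = (\<Sum>m\<in>?X. Const (cf q m) * Monom m)" by (intro sum_monomials) auto
    then show "p \<in> {\<Sum>m\<in>?X. Const (c m) * lin_change g (Monom m) |c. True}"
      using q(2) unfolding img by (intro CollectI exI[of _ "cf q"]) simp
  next
    fix p assume "p \<in> {\<Sum>m\<in>?X. Const (c m) * lin_change g (Monom m) |c. True}"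
    then obtain c where "p = lin_change g (\<Sum>m\<in>?X. Const (c m) * Monom m)" unfolding img by blast
    moreover have "supp (\<Sum>m\<in>?X. Const (c m) * Monom m) \<subseteq> ?X"
      by (auto simp: in_keys_iff cfX split: if_splits)
    ultimately show "p \<in> piece M g j" unfolding piece_def by blast
  qed
  show "piece M g j \<subseteq> homog_part j" by (rule piece_homog)
  show "finite ?X" by simp
  fix c assume "(\<Sum>m\<in>?X. Const (c m) * lin_change g (Monom m)) = 0"
  then have "lin_change g (\<Sum>m\<in>?X. Const (c m) * Monom m) = lin_change g 0"
    unfolding img by (simp add: klinear_0[OF klinear_lin_change])
  then have "(\<Sum>m\<in>?X. Const (c m) * Monom m) = 0" using inj by (simp add: inj_eq)
  then show "\<forall>m\<in>?X. c m = 0" using cfX[of c] by (metis lookup_zero)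
qed

section \<open>Initial ideals\<close>

definition inexp :: "mon4 set \<Rightarrow> 'k::field ^ 4 ^ 4 \<Rightarrow> mon4 set" where
  "inexp M g = {m. m \<in> LM (piece M g (mdeg m))}"

lemma inexp_mons: "inexp M g \<inter> mons j = LM (piece M g j)"
  using LM_subset[OF piece_homog[of M g j]] by (auto simp: inexp_def mons_def)

lemma mons_diff_inexp: "N \<subseteq> mons j \<Longrightarrow> N - inexp M g = N - LM (piece M g j)"
  using inexp_mons[of M g j] by blast

text \<open>The homogeneous component in the degree of the leading monomial keeps this monomial and
  still comes from the ideal. So homogeneous elements already provide all leading monomials.\<close>

lemma inexp_eq:
  fixes g :: "'k::field ^ 4 ^ 4"
  assumes M: "up_closed M"
  shows "inexp M g = {lead_monom p |p. p \<in> lin_change g ` ideal_span (Monom ` M) \<and> p \<noteq> 0}"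
proof (intro equalityI subsetI)
  fix m assume "m \<in> inexp M g"
  then obtain p where p: "p \<in> piece M g (mdeg m)" "p \<noteq> 0" "m = lead_monom p"
    unfolding inexp_def LM_def by auto
  then obtain q where q: "supp q \<subseteq> M" "p = lin_change g q" unfolding piece_def by auto
  then have "q \<in> ideal_span (Monom ` M)" by (simp add: monomial_ideal_up_closed[OF M])
  then have "p \<in> lin_change g ` ideal_span (Monom ` M)" using q(2) by (rule image_eqI[rotated])
  then show "m \<in> {lead_monom p |p. p \<in> lin_change g ` ideal_span (Monom ` M) \<and> p \<noteq> 0}"
    using p by (intro CollectI exI[of _ p]) simp
next
  fix m assume "m \<in> {lead_monom p |p. p \<in> lin_change g ` ideal_span (Monom ` M) \<and> p \<noteq> 0}"
  then obtain q where "q \<in> ideal_span (Monom ` M)"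
    and q': "lin_change g q \<noteq> 0" "m = lead_monom (lin_change g q)" by auto
  then have q: "supp q \<subseteq> M" "lin_change g q \<noteq> 0" "m = lead_monom (lin_change g q)"
    by (simp_all add: monomial_ideal_up_closed[OF M])
  define p where "p = hcomp (mdeg m) (lin_change g q)"
  have "p = lin_change g (hcomp (mdeg m) q)" unfolding p_def by (rule hcomp_lin_change)
  moreover have "supp (hcomp (mdeg m) q) \<subseteq> M \<inter> mons (mdeg m)" using q(1) by (auto simp: supp_hcomp)
  ultimately have "p \<in> piece M g (mdeg m)" unfolding piece_def by blast
  moreover have m: "m \<in> supp p"
    using lead_monom_in[OF q(2)] q(3) by (simp add: p_def supp_hcomp mons_def)
  moreover have "lead_monom p = m"
    using lead_monom_max[OF q(2)] q(3) m by (intro lead_monom_eqI) (auto simp: p_def supp_hcomp)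
  moreover have "p \<noteq> 0" using m by auto
  ultimately show "m \<in> inexp M g" unfolding inexp_def LM_def by (intro CollectI exI[of _ p]) simp
qed

lemma up_closed_inexp:
  assumes M: "up_closed M" and g: "invertible g"
  shows "up_closed (inexp M g)"
  unfolding up_closed_def
proof (intro ballI allI)
  fix m k assume "m \<in> inexp M g"
  then obtain q where q: "q \<in> ideal_span (Monom ` M)" "lin_change g q \<noteq> 0" "m = lead_monom (lin_change g q)"
    unfolding inexp_eq[OF M] by blast
  from g obtain g' where g': "\<And>p. lin_change g (lin_change g' p) = p" by (metis lin_change_inverse)
  \<comment> \<open>Multiplication by a monomial happens after the change of coordinates, so the
    monomial has to be pulled back to a multiplier of \<open>q\<close>.\<close>
  define r where "r = lin_change g' (Monom k) * q"
  have "r \<in> ideal_span (Monom ` M)" unfolding r_def using q(1) by (rule ideal_span_times)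
  moreover have r: "lin_change g r = Monom k * lin_change g q" by (simp add: r_def lin_change_mult g')
  moreover have "supp (lin_change g r) \<noteq> {}"
    unfolding r supp_Monom_times using lead_monom_in[OF q(2)] by blast
  moreover have "lead_monom (lin_change g r) = m + k"
    unfolding r lead_monom_Monom_times[OF q(2)] q(3) by (rule add.commute)
  ultimately show "m + k \<in> inexp M g" unfolding inexp_eq[OF M] by fastforce
qed

lemma initial_ideal_lin_change:
  fixes g :: "'k::field ^ 4 ^ 4"
  assumes "up_closed M"
  shows "initial_ideal (lin_change g ` ideal_span (Monom ` M)) = ideal_span (Monom ` inexp M g)"
proof -
  have "(Monom :: mon4 \<Rightarrow> 'k poly4) ` inexp M g =
      {Monom (lead_monom p) |p. p \<in> lin_change g ` ideal_span (Monom ` M) \<and> p \<noteq> 0}"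
    unfolding inexp_eq[OF assms] by blast
  then show ?thesis unfolding initial_ideal_def by (simp only:)
qed

section \<open>Genericity\<close>

definition entry_polys :: "('k::comm_ring_1 ^ 4 ^ 4 \<Rightarrow> 'k) set" where
  "entry_polys = {f. \<exists>F. \<forall>g. f g = eval_with id (\<lambda>(i, j). g $ i $ j) F}"

lemma entry_polysI: "(\<And>g. f g = eval_with id (\<lambda>(i, j). g $ i $ j) F) \<Longrightarrow> f \<in> entry_polys"
  unfolding entry_polys_def by auto

lemma entry_polysE:
  assumes "f \<in> entry_polys"
  obtains F where "\<And>g. f g = eval_with id (\<lambda>(i, j). g $ i $ j) F"
  using assms unfolding entry_polys_def by auto

lemma entry_polys_const: "(\<lambda>_. c) \<in> entry_polys"
  by (rule entry_polysI[of _ "Const c"]) (simp add: id.eval_Const)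

lemma entry_polys_entry: "(\<lambda>g. g $ i $ j) \<in> entry_polys"
  by (rule entry_polysI[of _ "Var (i, j)"]) (simp add: id.eval_Var del: One_nat_def)

lemma entry_polys_add:
  assumes "f \<in> entry_polys" "h \<in> entry_polys"
  shows "(\<lambda>g. f g + h g) \<in> entry_polys"
proof -
  from assms obtain F H where "\<And>g. f g = eval_with id (\<lambda>(i, j). g $ i $ j) F"
    "\<And>g. h g = eval_with id (\<lambda>(i, j). g $ i $ j) H" by (elim entry_polysE) (rule that)
  then show ?thesis by (intro entry_polysI[of _ "F + H"]) (simp add: id.eval_add)
qed

lemma entry_polys_mult:
  assumes "f \<in> entry_polys" "h \<in> entry_polys"
  shows "(\<lambda>g. f g * h g) \<in> entry_polys"
proof -
  from assms obtain F H where "\<And>g. f g = eval_with id (\<lambda>(i, j). g $ i $ j) F"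
    "\<And>g. h g = eval_with id (\<lambda>(i, j). g $ i $ j) H" by (elim entry_polysE) (rule that)
  then show ?thesis by (intro entry_polysI[of _ "F * H"]) (simp add: id.eval_mult)
qed

lemma entry_polys_diff:
  assumes "f \<in> entry_polys" "h \<in> entry_polys"
  shows "(\<lambda>g. f g - h g) \<in> entry_polys"
  using entry_polys_add[OF assms(1) entry_polys_mult[OF entry_polys_const[of "-1"] assms(2)]] by simp

lemma entry_polys_sum: "(\<And>x. x \<in> A \<Longrightarrow> f x \<in> entry_polys) \<Longrightarrow> (\<lambda>g. \<Sum>x\<in>A. f x g) \<in> entry_polys"
  by (induction A rule: infinite_finite_induct) (auto intro: entry_polys_const entry_polys_add)

lemma entry_polys_prod: "(\<And>x. x \<in> A \<Longrightarrow> f x \<in> entry_polys) \<Longrightarrow> (\<lambda>g. \<Prod>x\<in>A. f x g) \<in> entry_polys"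
  by (induction A rule: infinite_finite_induct) (auto intro: entry_polys_const entry_polys_mult)

lemma entry_polys_det: "det \<in> entry_polys"
  unfolding det_def[abs_def]
  by (intro entry_polys_sum entry_polys_mult entry_polys_const entry_polys_prod entry_polys_entry)

lemma entry_polys_path:
  fixes f :: "'k::comm_ring_1 ^ 4 ^ 4 \<Rightarrow> 'k"
  assumes f: "f \<in> entry_polys" and \<gamma>: "\<And>i j. \<exists>q. \<forall>t. \<gamma> t $ i $ j = poly q t"
  shows "\<exists>q. \<forall>t. f (\<gamma> t) = poly q t"
proof -
  from f obtain F where F: "\<And>g. f g = eval_with id (\<lambda>(i, j). g $ i $ j) F" by (rule entry_polysE) (rule that)
  have "\<forall>x. \<exists>q. \<forall>t. (\<lambda>(i, j). \<gamma> t $ i $ j) x = poly q t" using \<gamma> by auto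
  from choice[OF this] obtain q where q: "\<And>x t. (\<lambda>(i, j). \<gamma> t $ i $ j) x = poly (q x) t" by blast
  have "f (\<gamma> t) = poly (\<Sum>m\<in>supp F. [:cf F m:] * (\<Prod>x\<in>UNIV. q x ^ cf m x)) t" for t
    unfolding F eval_with_def q by (simp add: poly_sum poly_prod)
  then show ?thesis by blast
qed

lemma finite_zeros_path:
  fixes f :: "'k::field ^ 4 ^ 4 \<Rightarrow> 'k"
  assumes "f \<in> entry_polys" "\<And>i j. \<exists>q. \<forall>t. \<gamma> t $ i $ j = poly q t" "f (\<gamma> t0) \<noteq> 0"
  shows "finite {t. f (\<gamma> t) = 0}"
proof -
  obtain q where q: "\<And>t. f (\<gamma> t) = poly q t" using entry_polys_path[OF assms(1,2)] by auto
  then have "q \<noteq> 0" using assms(3) by auto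
  then show ?thesis unfolding q by (rule poly_roots_finite)
qed

text \<open>Both functions restrict to nonzero univariate polynomials on the line through
  \<open>g0\<close> and \<open>g1\<close>, and the infinite field has a parameter that is a root of
  neither. This is the irreducibility of the space of matrices; \<open>det\<close> can be one of the
  functions, so the line may pass through singular matrices.\<close>

lemma entry_polys_common_nonzero:
  fixes f h :: "'k::field_char_0 ^ 4 ^ 4 \<Rightarrow> 'k"
  assumes "f \<in> entry_polys" "h \<in> entry_polys" "f g0 \<noteq> 0" "h g1 \<noteq> 0"
  shows "\<exists>g. f g \<noteq> 0 \<and> h g \<noteq> 0"
proof -
  define \<gamma> :: "'k \<Rightarrow> 'k ^ 4 ^ 4" where "\<gamma> t = (\<chi> i j. (1 - t) * g0 $ i $ j + t * g1 $ i $ j)" for t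
  have \<gamma>: "\<exists>q. \<forall>t. \<gamma> t $ i $ j = poly q t" for i j
    by (rule exI[of _ "[:g0 $ i $ j, g1 $ i $ j - g0 $ i $ j:]"]) (simp add: \<gamma>_def algebra_simps)
  have "\<gamma> 0 = g0" "\<gamma> 1 = g1" by (simp_all add: \<gamma>_def vec_eq_iff)
  then have "finite {t. f (\<gamma> t) = 0}" "finite {t. h (\<gamma> t) = 0}"
    using finite_zeros_path[OF assms(1) \<gamma>, of 0] finite_zeros_path[OF assms(2) \<gamma>, of 1] assms(3,4) by simp_all
  then have "finite ({t. f (\<gamma> t) = 0} \<union> {t. h (\<gamma> t) = 0})" by simp
  then obtain t where "t \<notin> {t. f (\<gamma> t) = 0} \<union> {t. h (\<gamma> t) = 0}"
    using ex_new_if_finite[OF infinite_UNIV_char_0] by blast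
  then show ?thesis by (intro exI[of _ "\<gamma> t"]) simp
qed

lemma entry_polys_prod_nonzero:
  fixes f :: "'x \<Rightarrow> 'k::field_char_0 ^ 4 ^ 4 \<Rightarrow> 'k"
  assumes "finite A" "\<And>x. x \<in> A \<Longrightarrow> f x \<in> entry_polys" "\<And>x. x \<in> A \<Longrightarrow> \<exists>g. f x g \<noteq> 0"
  shows "\<exists>g. (\<Prod>x\<in>A. f x g) \<noteq> 0"
  using assms
proof (induction A rule: finite_induct)
  case (insert x A)
  have fA: "(\<lambda>g. \<Prod>x\<in>A. f x g) \<in> entry_polys" by (rule entry_polys_prod) (simp add: insert.prems)
  have fx: "f x \<in> entry_polys" by (simp add: insert.prems)
  obtain g0 where g0: "f x g0 \<noteq> 0" using insert.prems(2)[of x] by auto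
  obtain g1 where g1: "(\<Prod>x\<in>A. f x g1) \<noteq> 0" using insert.IH insert.prems by auto
  from entry_polys_common_nonzero[OF fx fA g0 g1] obtain g
    where "f x g \<noteq> 0" "(\<Prod>x\<in>A. f x g) \<noteq> 0" by auto
  then show ?case using insert.hyps by (intro exI[of _ g]) simp
qed auto

lemma invertible_iff_det: "invertible (g :: 'k::field ^ 4 ^ 4) \<longleftrightarrow> det g \<noteq> 0"
  by (rule invertible_det_nz)

text \<open>Any two nonempty open sets meet, so a value that is constant on one of them is the only
  candidate in the definition of \<open>gin\<close>.\<close>

lemma gin_eqI:
  fixes I :: "'k::field_char_0 poly4 set"
  assumes D: "D \<in> entry_polys" "D g0 \<noteq> 0"
    and J: "\<And>g. invertible g \<Longrightarrow> D g \<noteq> 0 \<Longrightarrow> initial_ideal (lin_change g ` I) = J"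
  shows "gin I = J"
  unfolding gin_def
proof (rule the_equality)
  from D(1) obtain F where F: "\<And>g. D g = eval_with id (\<lambda>(i, j). g $ i $ j) F" by (rule entry_polysE) (rule that)
  define U where "U = {g. invertible g \<and> D g \<noteq> 0}"
  have "zariski_open_GL4 U"
    unfolding zariski_open_GL4_def U_def F by (rule exI[of _ "{F}"]) simp
  moreover have "det (mat 1 :: 'k ^ 4 ^ 4) \<noteq> 0" by simp
  from entry_polys_common_nonzero[OF D(1) entry_polys_det D(2) this] have "U \<noteq> {}"
    unfolding U_def invertible_iff_det by auto
  ultimately show "\<exists>U. zariski_open_GL4 U \<and> U \<noteq> {} \<and> (\<forall>g\<in>U. initial_ideal (lin_change g ` I) = J)"
    using J by (intro exI[of _ U]) (simp add: U_def)
next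
  fix J' assume "\<exists>U. zariski_open_GL4 U \<and> U \<noteq> {} \<and> (\<forall>g\<in>U. initial_ideal (lin_change g ` I) = J')"
  then obtain U F where U: "U = {g. invertible g \<and> (\<exists>f\<in>F. eval_with id (\<lambda>(i, j). g $ i $ j) f \<noteq> 0)}"
    "U \<noteq> {}" "\<forall>g\<in>U. initial_ideal (lin_change g ` I) = J'"
    unfolding zariski_open_GL4_def by auto
  then obtain g1 f where f: "invertible g1" "f \<in> F" "eval_with id (\<lambda>(i, j). g1 $ i $ j) f \<noteq> 0" by auto
  \<comment> \<open>The factor \<open>det g\<close> turns a common nonzero point of \<open>D\<close>
    and \<open>D'\<close> into an invertible matrix, hence into a point of \<open>U\<close>.\<close>
  define D' where "D' g = eval_with id (\<lambda>(i, j). g $ i $ j) f * det g" for g :: "'k ^ 4 ^ 4"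
  have D': "D' \<in> entry_polys" unfolding D'_def
    by (intro entry_polys_mult entry_polys_det) (rule entry_polysI[of _ f], rule refl)
  have "D' g1 \<noteq> 0" using f by (simp add: D'_def invertible_iff_det)
  from entry_polys_common_nonzero[OF D(1) D' D(2) this] obtain g where "D g \<noteq> 0" "D' g \<noteq> 0" by auto
  then have "invertible g" "g \<in> U" using f(2) unfolding U(1) D'_def invertible_iff_det by auto
  then show "J' = J" using U(3) J[of g] \<open>D g \<noteq> 0\<close> by auto
qed

section \<open>Semicontinuity of independence modulo the transformed ideal\<close>

definition coeff_polys :: "('k::comm_ring_1 ^ 4 ^ 4 \<Rightarrow> 'k poly4) set" where
  "coeff_polys = {Q. \<forall>n. (\<lambda>g. cf (Q g) n) \<in> entry_polys}"

lemma coeff_polys_1: "(\<lambda>_. 1) \<in> coeff_polys"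
  unfolding coeff_polys_def by (auto intro: entry_polys_const)

lemma coeff_polys_mult:
  assumes "Q \<in> coeff_polys" "R \<in> coeff_polys"
  shows "(\<lambda>g. Q g * R g) \<in> coeff_polys"
  unfolding coeff_polys_def
proof (intro CollectI allI)
  fix n :: mon4
  define A where "A = {(k, l). n = k + l}"
  have "A \<subseteq> (\<Union>i\<le>mdeg n. mons i) \<times> (\<Union>i\<le>mdeg n. mons i)"
    by (auto simp: A_def mons_def)
  then have A: "finite A" by (rule finite_subset) simp
  have "cf (Q g * R g) n = (\<Sum>x\<in>A. cf (Q g) (fst x) * cf (R g) (snd x))" for g
    unfolding cf_times[OF A, of n "Q g" "R g", unfolded A_def, simplified]
    by (rule sum.cong) (auto simp: A_def)
  moreover have "(\<lambda>g. \<Sum>x\<in>A. cf (Q g) (fst x) * cf (R g) (snd x)) \<in> entry_polys"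
    using assms by (intro entry_polys_sum entry_polys_mult) (auto simp: coeff_polys_def)
  ultimately show "(\<lambda>g. cf (Q g * R g) n) \<in> entry_polys" by simp
qed

lemma coeff_polys_power: "Q \<in> coeff_polys \<Longrightarrow> (\<lambda>g. Q g ^ k) \<in> coeff_polys"
  by (induction k) (auto intro: coeff_polys_1 coeff_polys_mult)

lemma coeff_polys_prod:
  "(\<And>x. x \<in> A \<Longrightarrow> Q x \<in> coeff_polys) \<Longrightarrow> (\<lambda>g. \<Prod>x\<in>A. Q x g) \<in> coeff_polys"
  by (induction A rule: infinite_finite_induct) (auto intro: coeff_polys_1 coeff_polys_mult)

lemma coeff_polys_lin_change: "(\<lambda>g. lin_change g (Monom m)) \<in> coeff_polys"
proof -
  have "(\<lambda>g. \<Sum>i\<in>UNIV. Const (g $ i $ j) * Var i) \<in> coeff_polys" for j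
    unfolding coeff_polys_def
    by (auto simp: cf_sum simp del: One_nat_def
        intro!: entry_polys_sum entry_polys_mult entry_polys_entry entry_polys_const)
  then show ?thesis unfolding lin_change_def Const.eval_Monom
    by (intro coeff_polys_prod coeff_polys_power)
qed

text \<open>Independence modulo a moving subspace is rewritten as independence of one family, the
  transformed monomials of the piece (\<open>Inl\<close>) together with the fixed monomials of
  \<open>N\<close> (\<open>Inr\<close>). Injectivity at \<open>g0\<close> makes the first half
  independent by itself, and \<open>independence_is_open\<close> applies to the whole.\<close>

lemma indep_mod_generic:
  fixes g0 :: "'k::field_char_0 ^ 4 ^ 4"
  assumes inj: "inj (lin_change g0)" and N: "finite N" and indep: "indep_mod (piece M g0 j) N"
  shows "\<exists>D\<in>entry_polys. D g0 \<noteq> 0 \<and> (\<forall>g. D g \<noteq> 0 \<longrightarrow> indep_mod (piece M g j) N)"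
proof -
  define X where "X = Inl ` (M \<inter> mons j) \<union> Inr ` N"
  define v where "v x n = (\<lambda>g. case x of Inl m \<Rightarrow> cf (lin_change g (Monom m)) n
      | Inr n' \<Rightarrow> if n = n' then 1 else (0 :: 'k))" for x :: "mon4 + mon4" and n
  have fin: "finite X" using N by (simp add: X_def)
  have sumX: "(\<Sum>x\<in>X. \<alpha> x * v x n g) =
      cf (lin_change g (\<Sum>m\<in>M \<inter> mons j. Const (\<alpha> (Inl m)) * Monom m)) n + (if n \<in> N then \<alpha> (Inr n) else 0)"
    for \<alpha> n g
  proof -
    have "(\<Sum>x\<in>X. \<alpha> x * v x n g) = (\<Sum>x\<in>Inl ` (M \<inter> mons j). \<alpha> x * v x n g) + (\<Sum>x\<in>Inr ` N. \<alpha> x * v x n g)"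
      unfolding X_def by (rule sum.union_disjoint) (use N in auto)
    also have "(\<Sum>x\<in>Inl ` (M \<inter> mons j). \<alpha> x * v x n g) =
        (\<Sum>m\<in>M \<inter> mons j. \<alpha> (Inl m) * cf (lin_change g (Monom m)) n)"
      by (subst sum.reindex) (auto simp: v_def)
    also have "(\<Sum>x\<in>Inr ` N. \<alpha> x * v x n g) = (\<Sum>n'\<in>N. if n = n' then \<alpha> (Inr n') else 0)"
      by (subst sum.reindex) (auto simp: v_def intro!: sum.cong)
    finally show ?thesis using N
      by (simp add: klinear_sum[OF klinear_lin_change] klinear_Const[OF klinear_lin_change] cf_sum)
  qed
  note cfX = cf_sum_Monom[of "M \<inter> mons j", OF finite_Int[OF disjI2[OF finite_mons]]]
  have vA: "v x n \<in> entry_polys" for x n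
  proof (cases x)
    case (Inl m)
    then show ?thesis using coeff_polys_lin_change[of m, where ?'a = 'k] by (simp add: v_def coeff_polys_def)
  next
    case (Inr n')
    then show ?thesis using entry_polys_const[of "if n = n' then 1 else 0"] by (simp add: v_def)
  qed
  have "\<forall>x\<in>X. \<alpha> x = 0" if 0: "\<And>n. (\<Sum>x\<in>X. \<alpha> x * v x n g0) = 0" for \<alpha>
  proof -
    define q where "q = (\<Sum>m\<in>M \<inter> mons j. Const (\<alpha> (Inl m)) * (Monom m :: 'k poly4))"
    have q: "supp q \<subseteq> M \<inter> mons j" by (auto simp: q_def in_keys_iff cfX split: if_splits)
    have mem: "lin_change g0 q \<in> piece M g0 j" using q by (auto simp: piece_def)
    have cfq: "cf (lin_change g0 q) n = - (if n \<in> N then \<alpha> (Inr n) else 0)" for n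
      using 0[of n] unfolding sumX q_def[symmetric] by (simp add: eq_neg_iff_add_eq_0)
    have "supp (lin_change g0 q) \<subseteq> N" by (auto simp: in_keys_iff cfq split: if_splits)
    with mem have q0: "lin_change g0 q = 0" using indep by (simp add: indep_mod_def)
    then have N0: "\<alpha> (Inr n) = 0" if "n \<in> N" for n using cfq[of n] that by simp
    from q0 have "lin_change g0 q = lin_change g0 0" by (simp add: klinear_0[OF klinear_lin_change])
    then have "q = 0" using inj by (simp add: inj_eq)
    then have "\<alpha> (Inl m) = 0" if "m \<in> M \<inter> mons j" for m
      using that cfX[of "\<lambda>m. \<alpha> (Inl m)" m] by (simp add: q_def)
    with N0 show ?thesis by (auto simp: X_def)
  qed
  note ind = this
  have "\<exists>D\<in>entry_polys. D g0 \<noteq> 0 \<and> (\<forall>g \<alpha>. D g \<noteq> 0 \<longrightarrow>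
      (\<forall>n. (\<Sum>x\<in>X. \<alpha> x * v x n g) = 0) \<longrightarrow> (\<forall>x\<in>X. \<alpha> x = 0))"
    by (rule independence_is_open[OF entry_polys_const entry_polys_diff entry_polys_mult fin])
      (assumption+ | rule vA | rule ind, assumption)+
  then obtain D where D: "D \<in> entry_polys" "D g0 \<noteq> 0" and D': "\<forall>g \<alpha>. D g \<noteq> 0 \<longrightarrow>
      (\<forall>n. (\<Sum>x\<in>X. \<alpha> x * v x n g) = 0) \<longrightarrow> (\<forall>x\<in>X. \<alpha> x = 0)"
    by (elim bexE conjE) (rule that)
  have "indep_mod (piece M g j) N" if g: "D g \<noteq> 0" for g
    unfolding indep_mod_def
  proof (intro ballI impI)
    fix p assume p: "p \<in> piece M g j" "supp p \<subseteq> N"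
    then obtain q where q: "supp q \<subseteq> M \<inter> mons j" "p = lin_change g q" unfolding piece_def by auto
    define \<alpha> where "\<alpha> x = (case x of Inl m \<Rightarrow> cf q m | Inr n \<Rightarrow> - cf p n)" for x
    have "q = (\<Sum>m\<in>M \<inter> mons j. Const (\<alpha> (Inl m)) * Monom m)"
      using sum_monomials[of "M \<inter> mons j" q] q(1) by (simp add: \<alpha>_def)
    then have "(\<Sum>x\<in>X. \<alpha> x * v x n g) = cf p n + (if n \<in> N then - cf p n else 0)" for n
      unfolding sumX q(2) by (simp add: \<alpha>_def q(2))
    then have "(\<Sum>x\<in>X. \<alpha> x * v x n g) = 0" for n using p(2) by (auto simp: in_keys_iff)
    with D' g have "\<forall>x\<in>X. \<alpha> x = 0" by simp
    then have "\<alpha> (Inr n) = 0" if "n \<in> N" for n using that by (simp add: X_def)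
    then have "cf p n = 0" for n using p(2) by (cases "n \<in> N") (auto simp: \<alpha>_def in_keys_iff)
    then show "p = 0" by (intro poly_mapping_eqI) simp
  qed
  with D show ?thesis by (intro bexI[of _ D]) simp_all
qed

text \<open>The standard monomials of a lower segment form a maximal subset that is independent modulo the
  transformed ideal, and independence is an open condition on \<open>g\<close>.\<close>

lemma generic_standard_monomials:
  fixes M :: "mon4 set"
  obtains D :: "'k::field_char_0 ^ 4 ^ 4 \<Rightarrow> 'k" and g0 where "D \<in> entry_polys" "D g0 \<noteq> 0"
    "\<And>g (g1 :: 'k ^ 4 ^ 4) j N. D g \<noteq> 0 \<Longrightarrow> inj (lin_change g1) \<Longrightarrow> j \<le> d \<Longrightarrow> lower_segment j N \<Longrightarrow>
       card (N - inexp M g1) \<le> card (N - inexp M g)"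
proof -
  \<comment> \<open>Only finitely many pairs of a degree and a set are considered, so that the
    product of their witnesses is a single polynomial. This is the reason for the bound
    \<open>d\<close>.\<close>
  define \<N> where "\<N> = (SIGMA j:{..d}. Pow (mons j))"
  have fin: "finite \<N>" by (auto simp: \<N>_def)
  define R where "R x N' \<longleftrightarrow> N' \<subseteq> snd x \<and>
      (\<exists>g1 :: 'k ^ 4 ^ 4. inj (lin_change g1) \<and> indep_mod (piece M g1 (fst x)) N')" for x N'
  have "\<exists>D. D \<in> entry_polys \<and> (\<exists>g0 :: 'k ^ 4 ^ 4. D g0 \<noteq> 0) \<and>
      (\<forall>g N'. D g \<noteq> 0 \<longrightarrow> R x N' \<longrightarrow> (\<exists>N''\<subseteq>snd x. indep_mod (piece M g (fst x)) N'' \<and> card N' \<le> card N''))"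
    if x: "x \<in> \<N>" for x
  proof -
    have finx: "finite (snd x)" using x finite_subset[OF _ finite_mons] by (auto simp: \<N>_def)
    have inj1: "inj (lin_change (mat 1 :: 'k ^ 4 ^ 4))" by (rule injI) (simp add: lin_change_1)
    have "R x {}" unfolding R_def indep_mod_def using inj1 by auto
    moreover have "\<forall>N'. R x N' \<longrightarrow> card N' \<le> card (snd x)"
      unfolding R_def using finx by (auto intro: card_mono)
    \<comment> \<open>\<open>N0\<close> has the largest size that any injective change attains
      inside the given set, so one openness witness for \<open>N0\<close> beats every competing
      \<open>g1\<close>.\<close>
    ultimately obtain N0 where N0: "R x N0" "\<And>N'. R x N' \<Longrightarrow> card N' \<le> card N0"
      using ex_has_greatest_nat[of "R x" "{}" card "Suc (card (snd x))"] by (auto simp: less_Suc_eq_le)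
    then obtain g1 :: "'k ^ 4 ^ 4" where g1: "inj (lin_change g1)" "indep_mod (piece M g1 (fst x)) N0"
      and sub: "N0 \<subseteq> snd x" unfolding R_def by auto
    from indep_mod_generic[OF g1(1) finite_subset[OF sub finx] g1(2)] obtain D where
      D: "D \<in> entry_polys" "D g1 \<noteq> 0" "\<forall>g. D g \<noteq> 0 \<longrightarrow> indep_mod (piece M g (fst x)) N0" by auto
    show ?thesis
    proof (rule exI[of _ D], intro conjI allI impI)
      show "\<exists>g0. D g0 \<noteq> 0" using D(2) by auto
      fix g N' assume "D g \<noteq> 0" "R x N'"
      then show "\<exists>N''\<subseteq>snd x. indep_mod (piece M g (fst x)) N'' \<and> card N' \<le> card N''"
        using D(3) N0(2) sub by auto
    qed (rule D(1))
  qed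
  then have "\<forall>x\<in>\<N>. \<exists>D. D \<in> entry_polys \<and> (\<exists>g0 :: 'k ^ 4 ^ 4. D g0 \<noteq> 0) \<and>
      (\<forall>g N'. D g \<noteq> 0 \<longrightarrow> R x N' \<longrightarrow> (\<exists>N''\<subseteq>snd x. indep_mod (piece M g (fst x)) N'' \<and> card N' \<le> card N''))"
    by simp
  from bchoice[OF this] obtain D :: "nat \<times> mon4 set \<Rightarrow> 'k ^ 4 ^ 4 \<Rightarrow> 'k" where
    D: "\<forall>x\<in>\<N>. D x \<in> entry_polys \<and> (\<exists>g0. D x g0 \<noteq> 0) \<and>
      (\<forall>g N'. D x g \<noteq> 0 \<longrightarrow> R x N' \<longrightarrow> (\<exists>N''\<subseteq>snd x. indep_mod (piece M g (fst x)) N'' \<and> card N' \<le> card N''))"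
    by (elim exE) (rule that)
  have poly: "(\<lambda>g. \<Prod>x\<in>\<N>. D x g) \<in> entry_polys" using D by (intro entry_polys_prod) simp
  have "\<exists>g. (\<Prod>x\<in>\<N>. D x g) \<noteq> 0" using D by (intro entry_polys_prod_nonzero fin) simp_all
  then obtain g0 where g0: "(\<Prod>x\<in>\<N>. D x g0) \<noteq> 0" by (elim exE)
  have "card (N - inexp M g1) \<le> card (N - inexp M g)"
    if g: "(\<Prod>x\<in>\<N>. D x g) \<noteq> 0" and g1: "inj (lin_change g1)" and N: "j \<le> d" "lower_segment j N"
    for g g1 :: "'k ^ 4 ^ 4" and j N
  proof -
    have sub: "N \<subseteq> mons j" using N(2) by (simp add: lower_segment_def)
    have mem: "(j, N) \<in> \<N>" using N sub by (simp add: \<N>_def)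
    then have nz: "D (j, N) g \<noteq> 0" using g fin by simp
    have "R (j, N) (N - LM (piece M g1 j))"
      unfolding R_def fst_conv snd_conv by (intro conjI exI[of _ g1] g1 indep_mod_LM Diff_subset)
    from conjunct2[OF conjunct2[OF bspec[OF D mem]], rule_format, OF nz this] obtain N'' where
      N'': "N'' \<subseteq> N" "indep_mod (piece M g j) N''" "card (N - LM (piece M g1 j)) \<le> card N''"
      unfolding fst_conv snd_conv by (elim exE conjE) (rule that)
    note N''(3)
    also have "card N'' \<le> card (N - LM (piece M g j))"
      by (rule indep_card_le[OF kspace_piece piece_homog N(2) N''(1,2)])
    finally show ?thesis by (simp only: mons_diff_inexp[OF sub])
  qed
  from that[OF poly g0 this] show thesis .
qed

text \<open>The segments below \<open>m\<close>, without and with \<open>m\<close> itself, have the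
  same number of standard monomials exactly if \<open>m\<close> is a leading monomial. So the counts
  on lower segments determine the initial exponents.\<close>

lemma inexp_generic_eq:
  fixes g g' :: "'k::field_char_0 ^ 4 ^ 4"
  assumes "\<And>N. lower_segment j N \<Longrightarrow> card (N - inexp M g) = card (N - inexp M g')"
  shows "inexp M g \<inter> mons j = inexp M g' \<inter> mons j"
proof -
  have std: "m \<in> inexp M h \<longleftrightarrow> card ({n\<in>mons j. n = m \<or> revlex_less n m} - inexp M h) =
      card ({n\<in>mons j. revlex_less n m} - inexp M h)" if m: "m \<in> mons j" for m and h :: "'k ^ 4 ^ 4"
  proof -
    have eq: "{n\<in>mons j. n = m \<or> revlex_less n m} = insert m {n\<in>mons j. revlex_less n m}"
      using m by auto
    show ?thesis unfolding eq by (simp add: insert_Diff_if)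
  qed
  have seg: "lower_segment j {n\<in>mons j. n = m \<or> revlex_less n m}" "lower_segment j {n\<in>mons j. revlex_less n m}"
    for m unfolding lower_segment_def using revlex_trans by blast+
  show ?thesis using std[of _ g] std[of _ g'] assms[OF seg(1)] assms[OF seg(2)] by auto
qed

section \<open>The strong Lefschetz property of monomial complete intersections\<close>

definition powers :: "(4 \<Rightarrow> nat) \<Rightarrow> mon4 set" where
  "powers ex = {m. \<exists>i. ex i \<le> cf m i}"

lemma up_closed_powers: "up_closed (powers ex)"
  unfolding up_closed_def powers_def by (auto simp: lookup_add intro: trans_le_add1)

definition lform :: "(4 \<Rightarrow> 'k::comm_ring_1) \<Rightarrow> 'k poly4" where
  "lform \<alpha> = (\<Sum>k\<in>UNIV. Const (\<alpha> k) * Var k)"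

text \<open>The lowering operator of the \<open>sl\<^sub>2\<close>-action on the quotient whose raising operator is
  multiplication by \<open>lform \<alpha>\<close>. The truncated subtraction only matters where the coefficient vanishes.\<close>

definition lower_coeff :: "(4 \<Rightarrow> nat) \<Rightarrow> (4 \<Rightarrow> 'k::field) \<Rightarrow> 4 \<Rightarrow> mon4 \<Rightarrow> 'k" where
  "lower_coeff ex \<alpha> i m = inverse (\<alpha> i) * (of_nat (cf m i) * (of_nat (ex i) - of_nat (cf m i)))"

definition lower :: "(4 \<Rightarrow> nat) \<Rightarrow> (4 \<Rightarrow> 'k::field) \<Rightarrow> 'k poly4 \<Rightarrow> 'k poly4" where
  "lower ex \<alpha> = lincomb (\<lambda>m. \<Sum>i\<in>UNIV. Const (lower_coeff ex \<alpha> i m) * Monom (m - Poly_Mapping.single i 1))"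

lemma klinear_lower: "klinear (lower ex \<alpha>)"
  unfolding lower_def by (rule klinear_lincomb)

lemma lower_Monom:
  "lower ex \<alpha> (Monom m) = (\<Sum>i\<in>UNIV. Const (lower_coeff ex \<alpha> i m) * Monom (m - Poly_Mapping.single i 1))"
  unfolding lower_def by (rule lincomb_Monom)

text \<open>In one variable with exponents m and a the difference is (m + 1)(a - m - 1) - m(a - m) =
  a - 1 - 2m, the weight of an \<open>sl2\<close>-action, while different variables commute. The
  constant 4 collects one -1 from each variable.\<close>

lemma lower_commute_Monom:
  fixes \<alpha> :: "4 \<Rightarrow> 'k::field"
  assumes \<alpha>: "\<And>i. \<alpha> i \<noteq> 0"
  shows "lower ex \<alpha> (lform \<alpha> * Monom m) =
    lform \<alpha> * lower ex \<alpha> (Monom m) + Const (of_nat (\<Sum>i\<in>UNIV. ex i) - 4 - 2 * of_nat (mdeg m)) * Monom m"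
proof -
  let ?e = "\<lambda>i. Poly_Mapping.single i (1::nat)"
  \<comment> \<open>\<open>S i k\<close> raises in \<open>k\<close> and then lowers in
    \<open>i\<close>, \<open>T i k\<close> does so in the opposite order, and \<open>U i\<close> is
    the weight contributed by variable \<open>i\<close>.\<close>
  define S where "S i k = Const (\<alpha> k) * (Const (lower_coeff ex \<alpha> i (?e k + m)) * Monom (?e k + m - ?e i))" for i k
  define T where "T i k = Const (\<alpha> k) * (Const (lower_coeff ex \<alpha> i m) * Monom (?e k + (m - ?e i)))" for i k
  define U where "U i = Const (of_nat (ex i) - 1 - 2 * of_nat (cf m i)) * (Monom m :: 'k poly4)" for i
  have ST: "S i k = T i k + (if i = k then U i else 0)" for i k
  proof (cases "i = k")
    case True
    have c: "\<alpha> i * lower_coeff ex \<alpha> i (?e i + m) =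
        \<alpha> i * lower_coeff ex \<alpha> i m + (of_nat (ex i) - 1 - 2 * of_nat (cf m i))"
      using \<alpha>[of i] by (simp add: lower_coeff_def lookup_add field_simps)
    have S: "S i i = Const (\<alpha> i * lower_coeff ex \<alpha> i (?e i + m)) * Monom m"
      by (simp add: S_def Const_mult mult.assoc)
    have "T i i = Const (\<alpha> i * lower_coeff ex \<alpha> i m) * Monom m"
    proof (cases "cf m i = 0")
      case False
      then have "?e i + (m - ?e i) = m"
        by (intro poly_mapping_eqI) (auto simp: lookup_add lookup_minus lookup_single when_def)
      then show ?thesis by (simp add: T_def Const_mult mult.assoc)
    qed (simp add: T_def lower_coeff_def)
    then have "S i i = T i i + U i"
      unfolding S c U_def by (simp only: Const_add distrib_right)
    with True show ?thesis by simp
  next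
    case False
    have c: "lower_coeff ex \<alpha> i (?e k + m) = lower_coeff ex \<alpha> i m"
      using False by (simp add: lower_coeff_def lookup_add lookup_single when_def)
    show ?thesis
    proof (cases "cf m i = 0")
      case True
      then have "lower_coeff ex \<alpha> i m = 0" by (simp add: lower_coeff_def)
      then show ?thesis using False unfolding S_def T_def c by simp
    next
      case nz: False
      have "?e k + m - ?e i = ?e k + (m - ?e i)"
        using False nz by (intro poly_mapping_eqI) (auto simp: lookup_add lookup_minus lookup_single when_def)
      then show ?thesis using False unfolding S_def T_def c by simp
    qed
  qed
  have "lower ex \<alpha> (lform \<alpha> * Monom m) = (\<Sum>k\<in>UNIV. \<Sum>i\<in>UNIV. S i k)"
    unfolding lform_def S_def sum_distrib_right mult.assoc Monom_add[symmetric]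
      klinear_sum[OF klinear_lower] klinear_Const[OF klinear_lower] lower_Monom sum_distrib_left ..
  also have "\<dots> = (\<Sum>k\<in>UNIV. \<Sum>i\<in>UNIV. T i k) + (\<Sum>k\<in>UNIV. U k)"
    unfolding ST sum.distrib by simp
  also have "(\<Sum>k\<in>UNIV. \<Sum>i\<in>UNIV. T i k) = lform \<alpha> * lower ex \<alpha> (Monom m)"
    unfolding lform_def T_def lower_Monom sum_product Monom_add
    by (intro sum.cong refl) (simp only: mult_ac)
  also have "(\<Sum>k\<in>UNIV. U k) = Const (\<Sum>k\<in>UNIV. of_nat (ex k) - 1 - 2 * of_nat (cf m k)) * Monom m"
    unfolding U_def sum_distrib_right[symmetric] Const_sum ..
  also have "(\<Sum>k\<in>(UNIV::4 set). of_nat (ex k) - 1 - 2 * of_nat (cf m k)) =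
      (of_nat (\<Sum>i\<in>UNIV. ex i) - 4 - 2 * of_nat (mdeg m) :: 'k)"
    by (simp add: mdeg_def sum_subtractf sum_distrib_left)
  finally show ?thesis .
qed

lemma klinear_times: "klinear (\<lambda>p. q * p)"
  by (simp add: klinear_def distrib_left mult.left_commute)

lemma klinear_compose: "klinear F \<Longrightarrow> klinear G \<Longrightarrow> klinear (\<lambda>p. F (G p))"
  by (simp add: klinear_def)

lemma klinear_plus: "klinear F \<Longrightarrow> klinear G \<Longrightarrow> klinear (\<lambda>p. F p + G p)"
  by (simp add: klinear_def algebra_simps)

lemma lower_commute:
  fixes \<alpha> :: "4 \<Rightarrow> 'k::field"
  assumes \<alpha>: "\<And>i. \<alpha> i \<noteq> 0" and v: "v \<in> homog_part j"
  shows "lower ex \<alpha> (lform \<alpha> * v) =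
    lform \<alpha> * lower ex \<alpha> v + Const (of_nat (\<Sum>i\<in>UNIV. ex i) - 4 - 2 * of_nat j) * v"
proof -
  define H where "H = lincomb (\<lambda>m. Const (of_nat (\<Sum>i\<in>UNIV. ex i) - 4 - 2 * of_nat (mdeg m)) * (Monom m :: 'k poly4))"
  have "lower ex \<alpha> (lform \<alpha> * v) = lform \<alpha> * lower ex \<alpha> v + H v"
    by (rule klinear_eq[of "\<lambda>p. lower ex \<alpha> (lform \<alpha> * p)" "\<lambda>p. lform \<alpha> * lower ex \<alpha> p + H p"])
      (simp_all only: klinear_lower klinear_times klinear_compose[of "lower ex \<alpha>"]
        klinear_compose[of "(*) (lform \<alpha>)" "lower ex \<alpha>"] klinear_plus klinear_lincomb H_def lincomb_Monom
        lower_commute_Monom[OF \<alpha>])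
  also have "H v = (\<Sum>m\<in>supp v. Const (of_nat (\<Sum>i\<in>UNIV. ex i) - 4 - 2 * of_nat j) * (Const (cf v m) * Monom m))"
    unfolding H_def lincomb_def using v
    by (intro sum.cong refl) (simp add: homog_part_def mult.left_commute)
  also have "\<dots> = Const (of_nat (\<Sum>i\<in>UNIV. ex i) - 4 - 2 * of_nat j) * v"
    unfolding sum_distrib_left[symmetric] sum_monomials[OF finite_keys order_refl, symmetric] ..
  finally show ?thesis .
qed

lemma lform_homog: "lform \<alpha> \<in> homog_part 1"
  unfolding lform_def by (intro homog_part_sum homog_part_Const homog_part_Var)

lemma lform_power_homog: "v \<in> homog_part j \<Longrightarrow> lform \<alpha> ^ s * v \<in> homog_part (s + j)"
  using homog_part_mult[OF homog_part_power[OF lform_homog]] by force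

text \<open>With h the weight of \<open>v\<close>, commuting past one factor at a time adds up the
  weights h, h - 2, ..., h - 2s, which is (s + 1)(h - s).\<close>

lemma lower_commute_power:
  fixes \<alpha> :: "4 \<Rightarrow> 'k::field"
  assumes \<alpha>: "\<And>i. \<alpha> i \<noteq> 0" and v: "v \<in> homog_part j"
  shows "lower ex \<alpha> (lform \<alpha> ^ Suc s * v) = lform \<alpha> ^ Suc s * lower ex \<alpha> v +
    Const (of_nat (Suc s) * (of_nat (\<Sum>i\<in>UNIV. ex i) - 4 - 2 * of_nat j - of_nat s)) * (lform \<alpha> ^ s * v)"
proof (induction s)
  case 0
  then show ?case using lower_commute[OF \<alpha> v] by simp
next
  case (Suc s)
  let ?c = "of_nat (\<Sum>i\<in>UNIV. ex i) - 4 - 2 * of_nat j :: 'k"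
  let ?l = "lform \<alpha>" and ?F = "lower ex \<alpha>"
  have "?F (?l ^ Suc (Suc s) * v) = ?F (?l * (?l ^ Suc s * v))" by (simp add: mult.assoc)
  also have "\<dots> = ?l * ?F (?l ^ Suc s * v) +
      Const (of_nat (\<Sum>i\<in>UNIV. ex i) - 4 - 2 * of_nat (Suc s + j)) * (?l ^ Suc s * v)"
    by (rule lower_commute[OF \<alpha> lform_power_homog[OF v]])
  also have "\<dots> = ?l ^ Suc (Suc s) * ?F v + (Const (of_nat (Suc s) * (?c - of_nat s)) * (?l ^ Suc s * v) +
      Const (of_nat (\<Sum>i\<in>UNIV. ex i) - 4 - 2 * of_nat (Suc s + j)) * (?l ^ Suc s * v))"
    unfolding Suc.IH by (simp only: distrib_left power_Suc mult_ac add_ac)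
  also have "\<dots> = ?l ^ Suc (Suc s) * ?F v + Const (of_nat (Suc s) * (?c - of_nat s) +
      (of_nat (\<Sum>i\<in>UNIV. ex i) - 4 - 2 * of_nat (Suc s + j))) * (?l ^ Suc s * v)"
    by (simp only: Const_add distrib_right)
  also have "of_nat (Suc s) * (?c - of_nat s) + (of_nat (\<Sum>i\<in>UNIV. ex i) - 4 - 2 * of_nat (Suc s + j)) =
      of_nat (Suc (Suc s)) * (?c - of_nat (Suc s))"
    by (simp add: algebra_simps)
  finally show ?case .
qed

lemma lower_homog:
  assumes "v \<in> homog_part (Suc j)"
  shows "lower ex \<alpha> v \<in> homog_part j"
  unfolding lower_def lincomb_def
proof (rule homog_part_sum, rule homog_part_Const, rule homog_part_sum)
  fix m i assume m: "m \<in> supp v"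
  show "Const (lower_coeff ex \<alpha> i m) * Monom (m - Poly_Mapping.single i 1) \<in> homog_part j"
  proof (cases "cf m i = 0")
    case True
    then show ?thesis by (simp add: lower_coeff_def homog_part_0)
  next
    case False
    then have "mdeg m = 1 + mdeg (m - Poly_Mapping.single i 1)" by (intro mdeg_minus_single) simp
    moreover have "mdeg m = Suc j" using assms m by (simp add: homog_part_def)
    ultimately have "mdeg (m - Poly_Mapping.single i 1) = j" by simp
    then show ?thesis using homog_part_Monom[of "m - Poly_Mapping.single i 1"] by (intro homog_part_Const) simp
  qed
qed

lemma lower_homog_0:
  assumes "v \<in> homog_part 0"
  shows "lower ex \<alpha> v = 0"
  unfolding lower_def lincomb_def
proof (intro sum.neutral ballI)
  fix m assume "m \<in> supp v"
  then have "m = 0" using assms by (simp add: homog_part_def)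
  then show "Const (cf v m) * (\<Sum>i\<in>UNIV. Const (lower_coeff ex \<alpha> i m) * Monom (m - Poly_Mapping.single i 1)) = 0"
    by (simp add: lower_coeff_def)
qed

text \<open>The factor \<open>ex i - cf m i\<close> vanishes at the only exponent from which
  lowering in the variable \<open>i\<close> could leave the ideal.\<close>

lemma lower_ideal:
  fixes v :: "'k::field poly4"
  assumes "v \<in> ideal_span (Monom ` powers ex)"
  shows "lower ex \<alpha> v \<in> ideal_span (Monom ` powers ex)"
  unfolding lower_def lincomb_def
proof (rule ideal_span_sum, rule ideal_span_times, rule ideal_span_sum)
  fix m i assume "m \<in> supp v"
  then have m: "m \<in> powers ex" using assms by (auto simp: monomial_ideal_up_closed[OF up_closed_powers])
  show "Const (lower_coeff ex \<alpha> i m) * Monom (m - Poly_Mapping.single i 1) \<in> ideal_span (Monom ` powers ex)"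
  proof (cases "cf m i = 0 \<or> cf m i = ex i")
    case True
    then show ?thesis by (auto simp: lower_coeff_def ideal_span_0)
  next
    case False
    from m obtain k where "ex k \<le> cf m k" by (auto simp: powers_def)
    then have "ex k \<le> cf (m - Poly_Mapping.single i 1) k"
      using False by (auto simp: lookup_minus lookup_single when_def)
    then have "m - Poly_Mapping.single i 1 \<in> powers ex" by (auto simp: powers_def)
    then show ?thesis by (intro ideal_span_times ideal_span_base imageI)
  qed
qed

lemma ideal_span_Const_cancel:
  assumes "Const (c :: 'k::field) * p \<in> ideal_span S" "c \<noteq> 0"
  shows "p \<in> ideal_span S"
proof -
  have "Const (inverse c) * (Const c * p) = p"
    using assms(2) by (simp add: mult.assoc[symmetric] mult_single)
  then show ?thesis using ideal_span_times[OF assms(1), of "Const (inverse c)"] by simp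
qed

text \<open>The commutator formula shows that the power \<open>s + 1\<close> of the form kills the
  lowered vector, which has smaller degree and so lies in the ideal by induction. The remaining term
  of the formula is then a nonzero multiple of the power \<open>s - 1\<close> applied to
  \<open>v\<close>, and \<open>s\<close> descends to 0.\<close>

theorem strong_lefschetz:
  fixes \<alpha> :: "4 \<Rightarrow> 'k::field_char_0"
  assumes \<alpha>: "\<And>i. \<alpha> i \<noteq> 0" and ex: "\<And>i. 0 < ex i"
    and "v \<in> homog_part j" "2 * j + s \<le> (\<Sum>i\<in>UNIV. ex i - 1)"
    and "lform \<alpha> ^ s * v \<in> ideal_span (Monom ` powers ex)"
  shows "v \<in> ideal_span (Monom ` powers ex)"
  using assms(3-)
proof (induction j arbitrary: s v rule: less_induct)
  case (less j)
  let ?I = "ideal_span (Monom ` powers ex) :: 'k poly4 set"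
  let ?l = "lform \<alpha>" and ?F = "lower ex \<alpha>"
  define c where "c = (\<Sum>i\<in>UNIV. ex i - 1)"
  have "(\<Sum>i\<in>UNIV. ex i) = c + 4"
    unfolding c_def sum_4 using ex[of 0] ex[of 1] ex[of 2] ex[of 3] by linarith
  then have c: "of_nat (\<Sum>i\<in>UNIV. ex i) - 4 - 2 * of_nat j - of_nat t = (of_nat (c - 2 * j - t) :: 'k)"
    if "2 * j + t \<le> c" for t
    using that by (simp add: of_nat_diff)
  have v: "v \<in> homog_part j" by (rule less.prems(1))
  have Fv: "?F v \<in> ?I"
  proof (cases j)
    case 0
    then show ?thesis using lower_homog_0 less.prems(1) ideal_span_0 by metis
  next
    case (Suc i)
    have "?l ^ Suc s * v \<in> ?I"
      using ideal_span_times[OF less.prems(3), of ?l] by (simp add: mult.assoc)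
    then have "?F (?l ^ Suc s * v) \<in> ?I" "?l ^ s * v \<in> ?I" using lower_ideal less.prems(3) by blast+
    then have "?l ^ Suc s * ?F v \<in> ?I"
      unfolding lower_commute_power[OF \<alpha> v] using ideal_span_times ideal_span_diff by (metis add_diff_cancel_right')
    \<comment> \<open>The degree drops by one while the power grows by one, so 2j + s decreases and
      the bound is preserved.\<close>
    then show ?thesis using Suc less.prems lower_homog[of v i]
      by (intro less.IH[of i "?F v" "Suc s"]) simp_all
  qed
  show ?case
    using less.prems(2,3)
  proof (induction s)
    case (Suc t)
    \<comment> \<open>The bound for \<open>Suc t\<close> is exactly what makes the integer
      \<open>c - 2 * j - t\<close> positive, hence invertible in characteristic zero.\<close>
    have tc: "2 * j + t \<le> c" "0 < c - 2 * j - t" using Suc.prems(1) by (auto simp: c_def)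
    have "?F (?l ^ Suc t * v) - ?l ^ Suc t * ?F v \<in> ?I"
      by (intro ideal_span_diff ideal_span_times lower_ideal Suc.prems(2) Fv)
    then have "Const (of_nat (Suc t) * of_nat (c - 2 * j - t)) * (?l ^ t * v) \<in> ?I"
      unfolding lower_commute_power[OF \<alpha> v] c[OF tc(1)] by simp
    then have "?l ^ t * v \<in> ?I"
      by (rule ideal_span_Const_cancel) (use tc(2) in \<open>simp only: mult_eq_0_iff of_nat_eq_0_iff, simp\<close>)
    then show ?case using Suc by simp
  qed simp
qed

section \<open>Orders of vanishing in a linear system of univariate polynomials\<close>

lemma dvd_pderiv:
  assumes "[:- a, 1:] ^ Suc n dvd (p :: 'k::field poly)"
  shows "[:- a, 1:] ^ n dvd pderiv p"
proof -
  obtain u where u: "p = [:- a, 1:] ^ Suc n * u" using assms by (elim dvdE)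
  have "pderiv p = [:- a, 1:] ^ n * (smult (of_nat (Suc n)) (pderiv [:- a, 1:]) * u + [:- a, 1:] * pderiv u)"
    unfolding u pderiv_mult pderiv_power_Suc by (simp add: algebra_simps del: of_nat_Suc)
  then show ?thesis by simp
qed

lemma pderiv_sum: "pderiv (sum f A) = (\<Sum>x\<in>A. pderiv (f x))"
  by (induction A rule: infinite_finite_induct) (simp_all add: pderiv_add)

lemma pcompose_power: "pcompose (p ^ n) q = pcompose p (q :: 'k::comm_ring_1 poly) ^ n"
  by (induction n) (simp_all add: pcompose_mult pcompose_1)

text \<open>At \<open>a\<close> the product \<open>pderiv p * f\<close> vanishes to one order less
  than \<open>p\<close>, since the characteristic is zero and \<open>f\<close> is nonzero there. The
  product \<open>p * pderiv f\<close> vanishes at least to the order of \<open>p\<close>, so the two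
  cannot be equal.\<close>

lemma wronskian_nonzero:
  fixes p f :: "'k::field_char_0 poly"
  assumes p: "p \<noteq> 0" "poly p a = 0" and f: "poly f a \<noteq> 0"
  shows "pderiv p * f - p * pderiv f \<noteq> 0"
proof
  assume "pderiv p * f - p * pderiv f = 0"
  then have eq: "pderiv p * f = p * pderiv f" by simp
  have f0: "f \<noteq> 0" using f by auto
  have p': "pderiv p \<noteq> 0"
  proof
    assume "pderiv p = 0"
    then have "degree p = 0" by (simp add: pderiv_eq_0_iff)
    then obtain c where "p = [:c:]" by (rule degree_eq_zeroE)
    then show False using p by simp
  qed
  then have nz: "pderiv p * f \<noteq> 0" using f0 by simp
  have ord: "order a p = Suc (order a (pderiv p))"
    using p p' by (intro order_pderiv) (simp_all add: order_root)
  have "order a f = 0" using f by (simp add: order_0I)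
  then have "order a (pderiv p * f) = order a (pderiv p)" by (simp add: order_mult[OF nz])
  moreover have "order a (p * pderiv f) = order a p + order a (pderiv f)"
    using nz eq by (intro order_mult) simp
  ultimately show False using eq ord by simp
qed

text \<open>Replacing \<open>f i\<close> by the Wronskian of \<open>f i\<close> and a fixed member \<open>f x\<close> lowers the number of
  generators and, away from the zeros of \<open>f x\<close>, the order of vanishing by one.\<close>

lemma finite_osculation_points:
  fixes f :: "'x \<Rightarrow> 'k::field_char_0 poly"
  assumes "finite A"
  shows "finite {a. \<exists>c. (\<Sum>i\<in>A. smult (c i) (f i)) \<noteq> 0 \<and>
    [:- a, 1:] ^ card A dvd (\<Sum>i\<in>A. smult (c i) (f i))}"
  using assms
proof (induction A arbitrary: f rule: finite_induct)
  case empty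
  then show ?case by simp
next
  case (insert x A)
  let ?bad = "\<lambda>A f. {a :: 'k. \<exists>c. (\<Sum>i\<in>A. smult (c i) (f i)) \<noteq> 0 \<and>
    [:- a, 1:] ^ card A dvd (\<Sum>i\<in>A. smult (c i) (f i))}"
  show ?case
  proof (cases "f x = 0")
    case True
    have "?bad (insert x A) f \<subseteq> ?bad A f"
    proof
      fix a assume "a \<in> ?bad (insert x A) f"
      then obtain c where c: "(\<Sum>i\<in>insert x A. smult (c i) (f i)) \<noteq> 0"
        "[:- a, 1:] ^ card (insert x A) dvd (\<Sum>i\<in>insert x A. smult (c i) (f i))" by auto
      have "[:- a, 1:] ^ card A dvd [:- a, 1:] ^ card (insert x A)"
        using insert.hyps by (intro le_imp_power_dvd) simp
      with c(2) have "[:- a, 1:] ^ card A dvd (\<Sum>i\<in>insert x A. smult (c i) (f i))" by (rule dvd_trans[rotated])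
      with c(1) show "a \<in> ?bad A f" using True insert.hyps by auto
    qed
    then show ?thesis using insert.IH finite_subset by blast
  next
    case False
    define w where "w i = pderiv (f i) * f x - f i * pderiv (f x)" for i
    have "?bad (insert x A) f \<subseteq> {a. poly (f x) a = 0} \<union> ?bad A w"
    proof
      fix a assume "a \<in> ?bad (insert x A) f"
      then obtain c where c: "(\<Sum>i\<in>insert x A. smult (c i) (f i)) \<noteq> 0"
        "[:- a, 1:] ^ card (insert x A) dvd (\<Sum>i\<in>insert x A. smult (c i) (f i))" by auto
      define p where "p = (\<Sum>i\<in>insert x A. smult (c i) (f i))"
      have dvd: "[:- a, 1:] ^ Suc (card A) dvd p" using c(2) insert.hyps by (simp add: p_def)
      have p: "p \<noteq> 0" using c(1) by (simp add: p_def)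
      have w: "pderiv p * f x - p * pderiv (f x) = (\<Sum>i\<in>A. smult (c i) (w i))"
      proof -
        have "pderiv p * f x - p * pderiv (f x) = (\<Sum>i\<in>insert x A. smult (c i) (w i))"
          unfolding p_def pderiv_sum pderiv_smult sum_distrib_right w_def smult_diff_right
            sum_subtractf by simp
        then show ?thesis using insert.hyps by (simp add: w_def)
      qed
      show "a \<in> {a. poly (f x) a = 0} \<union> ?bad A w"
      proof (cases "poly (f x) a = 0")
        case nz: False
        have "[:- a, 1:] dvd p" using dvd by (auto intro: dvd_mult_left)
        then have "poly p a = 0" by (simp add: poly_eq_0_iff_dvd)
        then have "(\<Sum>i\<in>A. smult (c i) (w i)) \<noteq> 0"
          using wronskian_nonzero[OF p _ nz] w by simp
        moreover have "[:- a, 1:] ^ card A dvd pderiv p * f x - p * pderiv (f x)"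
          using dvd_pderiv[OF dvd] dvd_trans[OF le_imp_power_dvd dvd, of "card A"]
          by (intro dvd_diff dvd_mult2) simp_all
        ultimately show ?thesis unfolding w by auto
      qed simp
    qed
    then show ?thesis using insert.IH[of w] poly_roots_finite[OF False] finite_subset by blast
  qed
qed

section \<open>Generic initial ideals are closed under the Borel move \<open>x\<^sub>2 \<rightarrow> x\<^sub>1\<close>\<close>

text \<open>The one-parameter unipotent group that sends x2 to x2 + t x1 and fixes the other
  variables.\<close>

definition shear :: "'k::comm_ring_1 \<Rightarrow> 'k ^ 4 ^ 4" where
  "shear t = (\<chi> i j. if i = j then 1 else if i = 0 \<and> j = 1 then t else 0)"

lemma shear_mult: "shear s ** shear t = shear (s + t)"
  unfolding vec_eq_iff all_4 by (simp add: shear_def matrix_matrix_mult_def sum_4)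

lemma shear_0: "shear 0 = mat 1"
  by (simp add: shear_def mat_def vec_eq_iff)

lemma invertible_shear: "invertible (shear t)"
  unfolding invertible_def by (rule exI[of _ "shear (- t)"]) (simp add: shear_mult shear_0)

lemma lin_change_shear_Monom:
  fixes t :: "'k::field"
  shows "lin_change (shear t) (Monom n) = (\<Sum>k\<le>cf n 1. Const (of_nat (cf n 1 choose k) * t ^ (cf n 1 - k)) *
    Monom (Poly_Mapping.single 0 (cf n 0 + (cf n 1 - k)) + Poly_Mapping.single 1 k +
      Poly_Mapping.single 2 (cf n 2) + Poly_Mapping.single 3 (cf n 3)))"
proof -
  have Cpower: "Const t ^ e = (Const (t ^ e) :: 'k poly4)" for e
    by (induction e) (simp_all add: mult_single)
  have "lin_change (shear t) (Monom n) =
      Var 0 ^ cf n 0 * (Var 1 + Const t * Var 0) ^ cf n 1 * Var 2 ^ cf n 2 * Var 3 ^ cf n 3"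
    unfolding lin_change_def Const.eval_Monom prod_4 sum_4 by (simp add: shear_def add.commute)
  also have "(Var 1 + Const t * Var 0) ^ cf n 1 =
      (\<Sum>k\<le>cf n 1. of_nat (cf n 1 choose k) * Var 1 ^ k * (Const t * Var 0 :: 'k poly4) ^ (cf n 1 - k))"
    by (rule binomial_ring)
  also have "Var 0 ^ cf n 0 * \<dots> * Var 2 ^ cf n 2 * Var 3 ^ cf n 3 =
      (\<Sum>k\<le>cf n 1. Const (of_nat (cf n 1 choose k) * t ^ (cf n 1 - k)) *
        (Var 0 ^ (cf n 0 + (cf n 1 - k)) * Var 1 ^ k * Var 2 ^ cf n 2 * Var 3 ^ cf n 3))"
    unfolding sum_distrib_left sum_distrib_right
  proof (rule sum.cong[OF refl])
    fix k
    have c: "(of_nat (cf n 1 choose k) :: 'k poly4) = Const (of_nat (cf n 1 choose k))" by simp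
    show "Var 0 ^ cf n 0 * (of_nat (cf n 1 choose k) * Var 1 ^ k * (Const t * Var 0 :: 'k poly4) ^ (cf n 1 - k)) *
        Var 2 ^ cf n 2 * Var 3 ^ cf n 3 = Const (of_nat (cf n 1 choose k) * t ^ (cf n 1 - k)) *
        (Var 0 ^ (cf n 0 + (cf n 1 - k)) * Var 1 ^ k * Var 2 ^ cf n 2 * Var 3 ^ cf n 3)"
      unfolding c power_mult_distrib power_add Const_mult Cpower by (simp only: mult_ac)
  qed
  finally show ?thesis unfolding Var_power Monom_add[symmetric] .
qed

section \<open>Rows of monomials as univariate polynomials\<close>

definition bmon :: "nat \<Rightarrow> nat \<Rightarrow> nat \<Rightarrow> mon4" where
  "bmon i r q = Poly_Mapping.single 0 (i - q) + Poly_Mapping.single 1 q + Poly_Mapping.single 2 r"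

lemma cf_bmon: "cf (bmon i r q) 0 = i - q" "cf (bmon i r q) 1 = q" "cf (bmon i r q) 2 = r" "cf (bmon i r q) 3 = 0"
  by (simp_all add: bmon_def lookup_add lookup_single when_def)

lemma bmon_eq:
  assumes "cf n 3 = 0" "cf n 2 = r" "mdeg n = i + r"
  shows "n = bmon i r (cf n 1)"
  by (rule mon_eqI) (use assms in \<open>simp_all add: cf_bmon mdeg_eq\<close>)

lemma bmon_inj: "bmon i r q = bmon i r q' \<longleftrightarrow> q = q'"
  using cf_bmon(2) by metis

text \<open>From a form of degree i + r this takes the part free of x4 and of degree exactly r in
  x3, and sets x1 = x3 = 1. The remaining variable is x2.\<close>

definition dehom :: "nat \<Rightarrow> nat \<Rightarrow> 'k::field poly4 \<Rightarrow> 'k poly" where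
  "dehom i r p = (\<Sum>q\<le>i. monom (cf p (bmon i r q)) q)"

lemma coeff_dehom: "coeff (dehom i r p) q = (if q \<le> i then cf p (bmon i r q) else 0)"
  by (simp add: dehom_def coeff_sum)

lemma dehom_add: "dehom i r (p + q) = dehom i r p + dehom i r q"
  by (rule poly_eqI) (simp add: coeff_dehom lookup_add)

lemma dehom_Const: "dehom i r (Const c * p) = smult c (dehom i r p)"
  by (rule poly_eqI) (simp add: coeff_dehom)

lemma dehom_diff: "dehom i r (p - q) = dehom i r p - dehom i r q"
  by (rule poly_eqI) (simp add: coeff_dehom lookup_minus)

lemma dehom_Monom:
  assumes "mdeg n = i + r"
  shows "dehom i r (Monom n) = (if cf n 3 = 0 \<and> cf n 2 = r then monom 1 (cf n 1) else 0)"
proof (rule poly_eqI)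
  fix q
  show "coeff (dehom i r (Monom n)) q = coeff (if cf n 3 = 0 \<and> cf n 2 = r then monom 1 (cf n 1) else 0) q"
  proof (cases "cf n 3 = 0 \<and> cf n 2 = r")
    case True
    then have n: "n = bmon i r (cf n 1)" using assms by (intro bmon_eq) auto
    have "cf n 1 \<le> i" using True assms by (simp add: mdeg_eq)
    then show ?thesis using True n bmon_inj[of i r q "cf n 1"] by (auto simp: coeff_dehom cf_Monom)
  next
    case False
    then have "bmon i r q \<noteq> n" using cf_bmon[of i r q] by auto
    then show ?thesis using False by (simp add: coeff_dehom cf_Monom)
  qed
qed

text \<open>After x1 = 1 the shear becomes the translation of x2 by t, by the binomial theorem; it
  does not touch the exponents of x3 and x4.\<close>

lemma dehom_shear_Monom:
  fixes t :: "'k::field"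
  assumes n: "mdeg n = i + r"
  shows "dehom i r (lin_change (shear t) (Monom n)) = pcompose (dehom i r (Monom n)) [:t, 1:]"
proof -
  define n' where "n' k = Poly_Mapping.single 0 (cf n 0 + (cf n 1 - k)) + Poly_Mapping.single 1 k +
      Poly_Mapping.single 2 (cf n 2) + Poly_Mapping.single (3::4) (cf n 3)" for k
  have sum: "dehom i r (\<Sum>k\<in>A. Const (c k) * Monom (n' k)) = (\<Sum>k\<in>A. smult (c k) (dehom i r (Monom (n' k))))"
    for A and c :: "nat \<Rightarrow> 'k"
    by (induction A rule: infinite_finite_induct)
      (simp_all add: dehom_add dehom_Const, simp_all add: dehom_def)
  have "dehom i r (lin_change (shear t) (Monom n)) =
      (\<Sum>k\<le>cf n 1. smult (of_nat (cf n 1 choose k) * t ^ (cf n 1 - k)) (dehom i r (Monom (n' k))))"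
    unfolding lin_change_shear_Monom n'_def[symmetric] sum ..
  also have "\<dots> = (\<Sum>k\<le>cf n 1. smult (of_nat (cf n 1 choose k) * t ^ (cf n 1 - k))
      (if cf n 3 = 0 \<and> cf n 2 = r then monom 1 k else 0))"
  proof (rule sum.cong[OF refl])
    fix k assume k: "k \<in> {..cf n 1}"
    then have "mdeg (n' k) = i + r" using n by (simp add: n'_def mdeg_eq[of n])
    moreover have "cf (n' k) 3 = cf n 3" "cf (n' k) 2 = cf n 2" "cf (n' k) 1 = k"
      by (simp_all add: n'_def lookup_add lookup_single when_def)
    ultimately show "smult (of_nat (cf n 1 choose k) * t ^ (cf n 1 - k)) (dehom i r (Monom (n' k))) =
        smult (of_nat (cf n 1 choose k) * t ^ (cf n 1 - k)) (if cf n 3 = 0 \<and> cf n 2 = r then monom 1 k else 0)"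
      by (simp only: dehom_Monom)
  qed
  also have "\<dots> = pcompose (dehom i r (Monom n)) [:t, 1:]"
  proof (cases "cf n 3 = 0 \<and> cf n 2 = r")
    case True
    have "(monom 1 1 + [:t:]) ^ cf n 1 = (\<Sum>k\<le>cf n 1. of_nat (cf n 1 choose k) * monom 1 1 ^ k * [:t:] ^ (cf n 1 - k))"
      by (rule binomial_ring)
    also have "\<dots> = (\<Sum>k\<le>cf n 1. smult (of_nat (cf n 1 choose k) * t ^ (cf n 1 - k)) (monom 1 k))"
      by (intro sum.cong refl) (simp add: monom_power poly_const_pow of_nat_poly mult.commute smult_smult)
    also have "monom 1 1 + [:t:] = [:t, 1:]" by (simp add: monom_altdef)
    finally have "[:t, 1:] ^ cf n 1 = (\<Sum>k\<le>cf n 1. smult (of_nat (cf n 1 choose k) * t ^ (cf n 1 - k)) (monom 1 k))" .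
    moreover have "pcompose (monom 1 (cf n 1)) [:t, 1:] = [:t, 1:] ^ cf n 1"
      by (simp add: monom_altdef pcompose_power pcompose_pCons)
    ultimately show ?thesis using True unfolding dehom_Monom[OF n] by simp
  next
    case False
    then show ?thesis unfolding dehom_Monom[OF n] by auto
  qed
  finally show ?thesis .
qed

lemma dehom_shear:
  fixes t :: "'k::field"
  assumes p: "p \<in> homog_part (i + r)"
  shows "dehom i r (lin_change (shear t) p) = pcompose (dehom i r p) [:t, 1:]"
proof -
  have "dehom i r (lin_change (shear t) (\<Sum>m\<in>A. Const (c m) * Monom m)) =
      pcompose (dehom i r (\<Sum>m\<in>A. Const (c m) * Monom m)) [:t, 1:]"
    if "finite A" "A \<subseteq> mons (i + r)" for A and c :: "mon4 \<Rightarrow> 'k"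
    using that
  proof (induction A rule: finite_induct)
    case empty
    have "dehom i r (0 :: 'k poly4) = 0" by (simp add: dehom_def)
    then show ?case by (simp add: klinear_0[OF klinear_lin_change])
  next
    case (insert m A)
    have m: "mdeg m = i + r" using insert.prems by (simp add: mons_def)
    show ?case using insert
      by (simp add: klinear_add[OF klinear_lin_change] klinear_Const[OF klinear_lin_change] dehom_add
          dehom_Const dehom_shear_Monom[OF m] pcompose_add pcompose_smult)
  qed
  from this[OF finite_keys, of p "cf p"] p show ?thesis
    unfolding sum_monomials[OF finite_keys order_refl, symmetric] by (simp add: homog_part_iff)
qed

text \<open>The forms supported here are those whose monomials all lie in the row of x3-degree
  \<open>r\<close> or below it, since larger exponents of x4 or x3 mean smaller monomials. Its
  complement in degree j consists of the monomials free of x4 with x3-exponent below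
  \<open>r\<close>.\<close>

definition bsupp :: "nat \<Rightarrow> nat \<Rightarrow> mon4 set" where
  "bsupp j r = {n\<in>mons j. 0 < cf n 3 \<or> r \<le> cf n 2}"

lemma supp_shear:
  fixes t :: "'k::field"
  assumes p: "supp p \<subseteq> bsupp j r"
  shows "supp (lin_change (shear t) p) \<subseteq> bsupp j r"
proof
  fix n' assume n': "n' \<in> supp (lin_change (shear t) p)"
  have "lin_change (shear t) p = (\<Sum>n\<in>supp p. Const (cf p n) * lin_change (shear t) (Monom n))"
    using arg_cong[OF sum_monomials[OF finite_keys order_refl, of p], of "lin_change (shear t)"]
    by (simp only: klinear_sum[OF klinear_lin_change] klinear_Const[OF klinear_lin_change])
  with n' have "(\<Sum>n\<in>supp p. cf p n * cf (lin_change (shear t) (Monom n)) n') \<noteq> 0"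
    by (simp add: in_keys_iff cf_sum)
  then obtain n where n: "n \<in> supp p" "cf (lin_change (shear t) (Monom n)) n' \<noteq> 0"
    by (metis (no_types, lifting) mult_zero_right sum.neutral)
  from n(2) obtain k where k: "k \<le> cf n 1" "n' = Poly_Mapping.single 0 (cf n 0 + (cf n 1 - k)) +
      Poly_Mapping.single 1 k + Poly_Mapping.single 2 (cf n 2) + Poly_Mapping.single 3 (cf n 3)"
    unfolding lin_change_shear_Monom cf_sum cf_Const_times cf_Monom
    by (elim sum.not_neutral_contains_not_neutral) (auto split: if_splits)
  have "mdeg n' = mdeg n" using k by (simp add: mdeg_eq[of n])
  moreover have "cf n' 3 = cf n 3" "cf n' 2 = cf n 2"
    using k by (simp_all add: lookup_add lookup_single when_def)
  ultimately show "n' \<in> bsupp j r" using p n(1) by (auto simp: bsupp_def mons_def)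
qed

text \<open>Inside a row the order prefers small exponents of x2, so the leading monomial of a form
  corresponds to the lowest nonzero coefficient of its row polynomial.\<close>

lemma lead_dehom:
  fixes p :: "'k::field poly4"
  assumes p: "supp p \<subseteq> bsupp (i + r) r" and q: "coeff (dehom i r p) q \<noteq> 0"
    and low: "\<And>k. k < q \<Longrightarrow> coeff (dehom i r p) k = 0"
  shows "lead_monom p = bmon i r q"
proof (rule lead_monom_eqI)
  have qi: "q \<le> i" using q by (auto simp: coeff_dehom split: if_splits)
  show mem: "bmon i r q \<in> supp p" using q by (auto simp: coeff_dehom in_keys_iff split: if_splits)
  fix n assume n: "n \<in> supp p" "n \<noteq> bmon i r q"
  have nb: "n \<in> bsupp (i + r) r" using n p by blast
  have deg: "mdeg n = i + r" "mdeg (bmon i r q) = i + r"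
    using nb p mem by (auto simp: bsupp_def mons_def)
  have "cf n 3 = 0 \<and> cf n 2 = r \<Longrightarrow> q < cf n 1"
  proof -
    assume z: "cf n 3 = 0 \<and> cf n 2 = r"
    then have nn: "n = bmon i r (cf n 1)" using deg by (intro bmon_eq) auto
    have "cf n 1 \<le> i" using z deg by (simp add: mdeg_eq)
    then have "coeff (dehom i r p) (cf n 1) \<noteq> 0" using n(1) nn by (simp add: coeff_dehom in_keys_iff)
    then have "\<not> cf n 1 < q" using low by blast
    then show ?thesis using n(2) nn by (metis linorder_neqE_nat)
  qed
  then show "revlex_less n (bmon i r q)"
    using nb deg by (auto simp: revlex_less_iff cf_bmon bsupp_def)
qed

lemma dehom_lead:
  fixes p :: "'k::field poly4"
  assumes p: "p \<in> homog_part (i + r)" "p \<noteq> 0" and lead: "lead_monom p = bmon i r q" and q: "q \<le> i"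
  shows "supp p \<subseteq> bsupp (i + r) r" "coeff (dehom i r p) q \<noteq> 0" "\<And>k. k < q \<Longrightarrow> coeff (dehom i r p) k = 0"
proof -
  have deg: "\<And>n. n \<in> supp p \<Longrightarrow> mdeg n = i + r" using p(1) by (simp add: homog_part_def)
  have le: "\<And>n. n \<in> supp p \<Longrightarrow> n = bmon i r q \<or> revlex_less n (bmon i r q)"
    using lead_monom_max[OF p(2)] lead by auto
  have mem: "bmon i r q \<in> supp p" using lead_monom_in[OF p(2)] lead by simp
  show "supp p \<subseteq> bsupp (i + r) r"
  proof
    fix n assume n: "n \<in> supp p"
    show "n \<in> bsupp (i + r) r"
      using le[OF n] deg[OF n] deg[OF mem] by (auto simp: bsupp_def mons_def revlex_less_iff cf_bmon)
  qed
  show "coeff (dehom i r p) q \<noteq> 0" using mem q by (simp add: coeff_dehom in_keys_iff)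
  fix k assume k: "k < q"
  have "bmon i r k \<notin> supp p"
  proof
    assume "bmon i r k \<in> supp p"
    from le[OF this] deg[OF this] deg[OF mem] k show False
      by (auto simp: revlex_less_iff cf_bmon bmon_inj)
  qed
  then show "coeff (dehom i r p) k = 0" by (simp add: coeff_dehom in_keys_iff)
qed

lemma kspace_Int: "kspace P \<Longrightarrow> kspace Q \<Longrightarrow> kspace (P \<inter> Q)"
  unfolding kspace_def by blast

lemma X_power_dvd:
  assumes "\<And>k. k < q \<Longrightarrow> coeff (p :: 'k::field poly) k = 0"
  shows "[:0, 1:] ^ q dvd p"
proof -
  have "monom 1 q dvd p" using assms by (simp add: monom_1_dvd_iff')
  then show ?thesis by (simp add: monom_altdef)
qed

text \<open>The row polynomials at \<open>g0\<close> form a linear system whose lowest exponents are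
  the set \<open>Q\<close>. A gap in \<open>Q\<close> below its maximum \<open>q0\<close> makes its
  dimension at most \<open>q0\<close>. For almost all t the matrix \<open>shear t ** g0\<close> has
  the same initial exponents, and undoing the shear turns lowest exponent \<open>q0\<close> into a
  zero of order \<open>q0\<close> at t of a nonzero member of the system at \<open>g0\<close>. By
  \<open>finite_osculation_points\<close> this can happen for finitely many t only.\<close>

theorem borel_move:
  fixes g0 :: "'k::field_char_0 ^ 4 ^ 4"
  assumes D: "D \<in> entry_polys" "D g0 \<noteq> 0" "invertible g0"
    and E: "\<And>g. invertible g \<Longrightarrow> D g \<noteq> 0 \<Longrightarrow> inexp M g = E"
    and m: "m \<in> E" "cf m 3 = 0" "cf m' 3 = 0" "cf m' 2 = cf m 2" "mdeg m' = mdeg m" "cf m' 1 < cf m 1"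
  shows "m' \<in> E"
proof (rule ccontr)
  assume m'E: "m' \<notin> E"
  define r where "r = cf m 2"
  define i where "i = mdeg m - r"
  have ir: "mdeg m = i + r" unfolding i_def r_def by (simp add: mdeg_eq)
  have mb: "m = bmon i r (cf m 1)" "m' = bmon i r (cf m' 1)"
    using m ir by (auto intro!: bmon_eq simp: r_def)
  have mi: "cf m 1 \<le> i" using ir m(2) by (simp add: mdeg_eq r_def)
  define Q where "Q = {q. q \<le> i \<and> bmon i r q \<in> E}"
  have finQ: "finite Q" by (simp add: Q_def)
  define q0 where "q0 = Max Q"
  have mQ: "cf m 1 \<in> Q" using m(1) mb(1) mi by (simp add: Q_def)
  have q0: "q0 \<in> Q" unfolding q0_def using finQ mQ by (intro Max_in) auto
  \<comment> \<open>The missing monomial \<open>m'\<close> is the gap, and it lies below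
    \<open>q0\<close> because \<open>m\<close> is in the row.\<close>
  have "Q \<subseteq> {..q0} - {cf m' 1}"
    using finQ m'E mb(2) by (auto simp: q0_def Q_def)
  then have "card Q \<le> card ({..q0} - {cf m' 1})" by (intro card_mono) auto
  also have "cf m' 1 \<le> q0" using m(6) Max_ge[OF finQ mQ] by (simp add: q0_def del: Max_ge)
  then have "card ({..q0} - {cf m' 1}) = q0" by simp
  finally have cardQ: "card Q \<le> q0" .
  define V where "V = piece M g0 (i + r) \<inter> {p. supp p \<subseteq> bsupp (i + r) r}"
  have V: "kspace V" unfolding V_def by (intro kspace_Int kspace_piece kspace_supp)
  have E0: "E \<inter> mons (i + r) = LM (piece M g0 (i + r))"
    unfolding E[OF D(3,2), symmetric] by (rule inexp_mons)
  have bmons: "bmon i r q \<in> mons (i + r)" if "q \<le> i" for q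
    using that by (simp add: mons_def mdeg_eq cf_bmon)
  have "\<forall>q\<in>Q. \<exists>p. p \<in> V \<and> coeff (dehom i r p) q \<noteq> 0 \<and> (\<forall>k<q. coeff (dehom i r p) k = 0)"
  proof
    fix q assume q: "q \<in> Q"
    then have "bmon i r q \<in> LM (piece M g0 (i + r))" using E0 bmons[of q] by (auto simp: Q_def)
    then obtain p where p: "p \<in> piece M g0 (i + r)" "p \<noteq> 0" "lead_monom p = bmon i r q"
      unfolding LM_def by auto
    have "p \<in> homog_part (i + r)" using p(1) piece_homog by auto
    from dehom_lead[OF this p(2,3)] q p(1)
    show "\<exists>p. p \<in> V \<and> coeff (dehom i r p) q \<noteq> 0 \<and> (\<forall>k<q. coeff (dehom i r p) k = 0)"
      by (intro exI[of _ p]) (simp add: V_def Q_def)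
  qed
  from bchoice[OF this] obtain b where b: "\<And>q. q \<in> Q \<Longrightarrow> b q \<in> V"
    "\<And>q. q \<in> Q \<Longrightarrow> coeff (dehom i r (b q)) q \<noteq> 0"
    "\<And>q k. q \<in> Q \<Longrightarrow> k < q \<Longrightarrow> coeff (dehom i r (b q)) k = 0" by blast
  \<comment> \<open>Elimination from the lowest coefficient upwards: the lowest exponent of a row
    polynomial of \<open>V\<close> always belongs to \<open>Q\<close>, and subtracting a multiple of
    \<open>b q\<close> raises it.\<close>
  have span: "\<exists>c. dehom i r p = (\<Sum>k\<in>Q. smult (c k) (dehom i r (b k)))"
    if "p \<in> V" "\<forall>k<q. coeff (dehom i r p) k = 0" for p q
    using that
  proof (induction "Suc i - q" arbitrary: p q)
    case 0
    then have "i < q" by simp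
    then have "coeff (dehom i r p) k = 0" for k
      using "0.prems"(2) by (cases "k \<le> i") (simp, simp add: coeff_dehom)
    then have "dehom i r p = 0" by (intro poly_eqI) simp
    then show ?case by (intro exI[of _ "\<lambda>_. 0"]) simp
  next
    case (Suc d)
    have dq: "d = Suc i - Suc q" using Suc.hyps(2) by simp
    show ?case
    proof (cases "coeff (dehom i r p) q = 0")
      case True
      then have "\<forall>k<Suc q. coeff (dehom i r p) k = 0" using Suc.prems(2) by (auto simp: less_Suc_eq)
      then show ?thesis by (rule Suc.hyps(1)[OF dq Suc.prems(1)])
    next
      case False
      then have qi: "q \<le> i" by (auto simp: coeff_dehom split: if_splits)
      have pV: "p \<in> piece M g0 (i + r)" "supp p \<subseteq> bsupp (i + r) r" using Suc.prems(1) by (auto simp: V_def)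
      have "lead_monom p = bmon i r q"
        using lead_dehom[OF pV(2) False] Suc.prems(2) by simp
      moreover have "p \<noteq> 0" using False by (auto simp: dehom_def)
      ultimately have "bmon i r q \<in> LM (piece M g0 (i + r))"
        using pV(1) unfolding LM_def by (intro CollectI exI[of _ p]) simp
      then have qQ: "q \<in> Q" using E0 qi by (auto simp: Q_def)
      define c where "c = coeff (dehom i r p) q / coeff (dehom i r (b q)) q"
      define p' where "p' = p - Const c * b q"
      have dp': "dehom i r p' = dehom i r p - smult c (dehom i r (b q))"
        by (simp add: p'_def dehom_diff dehom_Const)
      have "p' \<in> V" unfolding p'_def by (intro kspace_diff[OF V] kspace_Const[OF V] Suc.prems(1) b(1)[OF qQ])
      moreover have "\<forall>k<Suc q. coeff (dehom i r p') k = 0"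
        using Suc.prems(2) b(2,3)[OF qQ] by (auto simp: dp' c_def less_Suc_eq)
      ultimately have "\<exists>c. dehom i r p' = (\<Sum>k\<in>Q. smult (c k) (dehom i r (b k)))"
        by (rule Suc.hyps(1)[OF dq])
      then obtain c' where c': "dehom i r p' = (\<Sum>k\<in>Q. smult (c' k) (dehom i r (b k)))" by auto
      have "dehom i r p = (\<Sum>k\<in>Q. smult (c' k) (dehom i r (b k))) + smult c (dehom i r (b q))"
        using dp' c' by (simp add: algebra_simps)
      also have "\<dots> = (\<Sum>k\<in>Q. smult (c' k + (if k = q then c else 0)) (dehom i r (b k)))"
      proof -
        have "(\<Sum>k\<in>Q. smult (if k = q then c else 0) (dehom i r (b k))) =
            (\<Sum>k\<in>Q. if k = q then smult c (dehom i r (b q)) else 0)"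
          by (intro sum.cong) auto
        then show ?thesis using finQ qQ by (simp add: smult_add_left sum.distrib)
      qed
      finally show ?thesis by (intro exI)
    qed
  qed
  define bad where "bad = {a. \<exists>c. (\<Sum>k\<in>Q. smult (c k) (dehom i r (b k))) \<noteq> 0 \<and>
    [:- a, 1:] ^ card Q dvd (\<Sum>k\<in>Q. smult (c k) (dehom i r (b k)))}"
  have bad: "finite bad" unfolding bad_def by (rule finite_osculation_points[OF finQ])
  have path: "\<exists>f. \<forall>t. (shear t ** g0) $ a $ c = poly f t" for a c
  proof (rule exI[of _ "[:g0 $ a $ c, if a = 0 then g0 $ 1 $ c else 0:]"], rule allI)
    fix t
    show "(shear t ** g0) $ a $ c = poly [:g0 $ a $ c, if a = 0 then g0 $ 1 $ c else 0:] t"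
      using all_4[of "\<lambda>a. (shear t ** g0) $ a $ c = poly [:g0 $ a $ c, if a = 0 then g0 $ 1 $ c else 0:] t"]
      by (simp add: shear_def matrix_matrix_mult_def sum_4)
  qed
  have "finite {t. D (shear t ** g0) = 0}"
    using D(2) by (intro finite_zeros_path[OF D(1) path, of 0]) (simp add: shear_0)
  with bad have "finite (bad \<union> {t. D (shear t ** g0) = 0})" by simp
  then obtain t where t: "t \<notin> bad \<union> {t. D (shear t ** g0) = 0}"
    using ex_new_if_finite[OF infinite_UNIV_char_0] by blast
  have "invertible (shear t ** g0)" using invertible_shear D(3) by (rule invertible_mult)
  then have "inexp M (shear t ** g0) = E" using t by (intro E) auto
  then have "E \<inter> mons (i + r) = LM (piece M (shear t ** g0) (i + r))" using inexp_mons by metis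
  then have "bmon i r q0 \<in> LM (piece M (shear t ** g0) (i + r))" using q0 bmons[of q0] by (auto simp: Q_def)
  then obtain p where p: "p \<in> piece M (shear t ** g0) (i + r)" "p \<noteq> 0" "lead_monom p = bmon i r q0"
    unfolding LM_def by auto
  from p(1) obtain s where s: "supp s \<subseteq> M \<inter> mons (i + r)" "p = lin_change (shear t ** g0) s"
    unfolding piece_def by auto
  define p0 where "p0 = lin_change g0 s"
  have pp0: "p = lin_change (shear t) p0" unfolding s(2) p0_def lin_change_lin_change ..
  have p0p: "p0 = lin_change (shear (- t)) p"
    unfolding pp0 lin_change_lin_change shear_mult by (simp add: shear_0 lin_change_1)
  have ph: "p \<in> homog_part (i + r)" using p(1) piece_homog by auto
  have p0h: "p0 \<in> homog_part (i + r)" unfolding p0p by (rule lin_change_homog[OF ph])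
  have "q0 \<le> i" using q0 by (simp add: Q_def)
  note lead = dehom_lead[OF ph p(2,3) this]
  \<comment> \<open>The shear preserves the exponents of x3 and x4, hence also
    \<open>bsupp\<close>.\<close>
  have "p0 \<in> V"
    using s(1) supp_shear[OF lead(1), of "- t"] by (auto simp: V_def p0p[symmetric] p0_def piece_def)
  then obtain c where c: "dehom i r p0 = (\<Sum>k\<in>Q. smult (c k) (dehom i r (b k)))"
    using span[of p0 0] by auto
  have "dehom i r p0 \<noteq> 0"
  proof
    assume "dehom i r p0 = 0"
    then have "dehom i r p = 0" using dehom_shear[OF p0h, of t] pp0 by simp
    then show False using lead(2) by simp
  qed
  moreover have "[:- t, 1:] ^ card Q dvd dehom i r p0"
  proof -
    have "[:0, 1:] ^ q0 dvd dehom i r p" using lead(3) by (rule X_power_dvd)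
    then obtain u where u: "dehom i r p = [:0, 1:] ^ q0 * u" by (elim dvdE)
    have "dehom i r p0 = pcompose (dehom i r p) [:- t, 1:]"
      unfolding p0p by (rule dehom_shear[OF ph])
    also have "\<dots> = [:- t, 1:] ^ q0 * pcompose u [:- t, 1:]"
      unfolding u by (simp add: pcompose_mult pcompose_power pcompose_pCons)
    finally have "[:- t, 1:] ^ q0 dvd dehom i r p0" by simp
    then show ?thesis by (rule dvd_trans[OF le_imp_power_dvd[OF cardQ]])
  qed
  ultimately have "t \<in> bad" unfolding bad_def c by auto
  then show False using t by blast
qed

section \<open>Functionals vanishing on powers of linear forms\<close>

definition kfunctional :: "('k::comm_ring_1 poly4 \<Rightarrow> 'k) \<Rightarrow> bool" where
  "kfunctional \<phi> \<longleftrightarrow> (\<forall>p q. \<phi> (p + q) = \<phi> p + \<phi> q) \<and> (\<forall>c p. \<phi> (Const c * p) = c * \<phi> p)"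

lemma kfunctional_add: "kfunctional \<phi> \<Longrightarrow> \<phi> (p + q) = \<phi> p + \<phi> q"
  and kfunctional_Const: "kfunctional \<phi> \<Longrightarrow> \<phi> (Const c * p) = c * \<phi> p"
  by (simp_all add: kfunctional_def)

lemma kfunctional_0: "kfunctional \<phi> \<Longrightarrow> \<phi> 0 = 0"
  using kfunctional_Const[of \<phi> 0 0] by simp

lemma kfunctional_diff: "kfunctional \<phi> \<Longrightarrow> \<phi> (p - q) = \<phi> p - \<phi> q"
  using kfunctional_add[of \<phi> "p - q" q] by simp

text \<open>The polynomial \<open>t \<mapsto> \<phi> ((X + t Y)\<^sup>n W)\<close>.\<close>

definition gen_poly :: "('k poly4 \<Rightarrow> 'k) \<Rightarrow> 'k poly4 \<Rightarrow> 'k poly4 \<Rightarrow> 'k poly4 \<Rightarrow> nat \<Rightarrow> 'k::comm_ring_1 poly" where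
  "gen_poly \<phi> X Y W n = map_poly \<phi> ([:X, Y:] ^ n * [:W:])"

lemma coeff_gen_poly:
  assumes "kfunctional \<phi>"
  shows "coeff (gen_poly \<phi> X Y W n) k = of_nat (n choose k) * \<phi> (X ^ (n - k) * Y ^ k * W)"
proof -
  have lin: "coeff ([:X, Y:] ^ n) k = of_nat (n choose k) * Y ^ k * X ^ (n - k)"
  proof (cases "k \<le> n")
    case True
    then show ?thesis by (rule coeff_linear_poly_power)
  next
    case False
    have "degree ([:X, Y:] ^ n) \<le> degree [:X, Y:] * n" by (rule degree_power_le)
    also have "\<dots> \<le> n" by simp
    finally show ?thesis using False by (simp add: coeff_eq_0 binomial_eq_0)
  qed
  have "coeff (gen_poly \<phi> X Y W n) k = \<phi> (of_nat (n choose k) * Y ^ k * X ^ (n - k) * W)"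
    unfolding gen_poly_def by (simp add: coeff_map_poly kfunctional_0[OF assms] lin mult.commute[of _ W])
  also have "of_nat (n choose k) * Y ^ k * X ^ (n - k) * W = Const (of_nat (n choose k)) * (X ^ (n - k) * Y ^ k * W)"
    by (simp add: mult_ac)
  finally show ?thesis by (simp only: kfunctional_Const[OF assms])
qed

lemma degree_gen_poly:
  assumes "kfunctional \<phi>"
  shows "degree (gen_poly \<phi> X Y W n) \<le> n"
  by (rule degree_le) (simp add: coeff_gen_poly[OF assms] binomial_eq_0)

lemma map_poly_shift:
  fixes \<phi> :: "'k::comm_ring_1 poly4 \<Rightarrow> 'k"
  assumes \<phi>: "kfunctional \<phi>"
  shows "map_poly \<phi> (pcompose q [:Const t, 1:]) = pcompose (map_poly \<phi> q) [:t, 1:]"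
proof -
  have map_add: "map_poly \<phi> (p + q) = map_poly \<phi> p + map_poly \<phi> q" for p q
    by (rule poly_eqI) (simp add: coeff_map_poly kfunctional_0[OF \<phi>] kfunctional_add[OF \<phi>])
  have map_smult: "map_poly \<phi> (smult (Const c) q) = smult c (map_poly \<phi> q)" for c q
    by (rule poly_eqI) (simp add: coeff_map_poly kfunctional_0[OF \<phi>] kfunctional_Const[OF \<phi>])
  have map_pCons: "map_poly \<phi> (pCons a q) = pCons (\<phi> a) (map_poly \<phi> q)" for a q
    by (rule poly_eqI) (simp add: coeff_map_poly kfunctional_0[OF \<phi>] coeff_pCons split: nat.split)
  show ?thesis
  proof (induction q)
    case 0
    then show ?case by simp
  next
    case (pCons a q)
    have "map_poly \<phi> (pcompose (pCons a q) [:Const t, 1:]) =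
        map_poly \<phi> ([:a:] + (smult (Const t) (pcompose q [:Const t, 1:]) + pCons 0 (pcompose q [:Const t, 1:])))"
      by (simp add: pcompose_pCons)
    also have "\<dots> = [:\<phi> a:] + [:t, 1:] * map_poly \<phi> (pcompose q [:Const t, 1:])"
      unfolding map_add map_smult map_pCons by (simp add: kfunctional_0[OF \<phi>])
    finally show ?case unfolding pCons.IH map_pCons pcompose_pCons .
  qed
qed

text \<open>Translating the parameter by t amounts to replacing X by X + tY. So the order of
  vanishing at t is read off from the first coefficients for the shifted form.\<close>

lemma gen_poly_shift:
  assumes "kfunctional \<phi>"
  shows "pcompose (gen_poly \<phi> X Y W n) [:t, 1:] = gen_poly \<phi> (X + Const t * Y) Y W n"
proof -
  have "pcompose ([:X, Y:] ^ n * [:W:]) [:Const t, 1:] = [:X + Const t * Y, Y:] ^ n * [:W:]"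
    unfolding pcompose_mult pcompose_power by (simp add: pcompose_pCons mult.commute[of Y])
  then show ?thesis unfolding gen_poly_def map_poly_shift[OF assms, symmetric] by simp
qed

lemma diff_power_mod_square:
  fixes A B :: "'r::comm_ring_1"
  shows "\<exists>u. (A - B) ^ n = A ^ n - of_nat n * A ^ (n - 1) * B + B ^ 2 * u"
proof (induction n)
  case 0
  then show ?case by (intro exI[of _ 0]) simp
next
  case (Suc n)
  then obtain u where u: "(A - B) ^ n = A ^ n - of_nat n * A ^ (n - 1) * B + B ^ 2 * u" by auto
  have A: "of_nat n * (A * A ^ (n - 1)) = of_nat n * A ^ n" by (cases n) simp_all
  have "(A - B) ^ Suc n = (A - B) * (A ^ n - of_nat n * A ^ (n - 1) * B + B ^ 2 * u)" by (simp add: u)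
  also have "\<dots> = A ^ Suc n - (of_nat n * (A * A ^ (n - 1)) + A ^ n) * B +
      B ^ 2 * ((A - B) * u + of_nat n * A ^ (n - 1))"
    by (simp add: algebra_simps power2_eq_square)
  also have "\<dots> = A ^ Suc n - of_nat (Suc n) * A ^ (Suc n - 1) * B +
      B ^ 2 * ((A - B) * u + of_nat n * A ^ (n - 1))"
    unfolding A by (simp add: algebra_simps)
  finally show ?case by (intro exI)
qed

lemma shift_dvd:
  fixes p :: "'k::field poly"
  assumes "\<And>k. k < n \<Longrightarrow> coeff (pcompose p [:t, 1:]) k = 0"
  shows "[:- t, 1:] ^ n dvd p"
proof -
  have "monom 1 n dvd pcompose p [:t, 1:]" using assms by (simp add: monom_1_dvd_iff')
  then obtain u where u: "pcompose p [:t, 1:] = [:0, 1:] ^ n * u" by (auto simp: monom_altdef elim: dvdE)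
  have "p = pcompose (pcompose p [:t, 1:]) [:- t, 1:]"
    by (simp add: pcompose_assoc[symmetric] pcompose_pCons)
  also have "\<dots> = [:- t, 1:] ^ n * pcompose u [:- t, 1:]"
    unfolding u by (simp add: pcompose_mult pcompose_power pcompose_pCons)
  finally show ?thesis by (metis dvd_triv_left)
qed

lemma linear_power_dvd_cancel:
  fixes r q :: "'k::field poly"
  assumes "poly r a \<noteq> 0" "[:- a, 1:] ^ m dvd r * q"
  shows "[:- a, 1:] ^ m dvd q"
  using assms(2)
proof (induction m)
  case (Suc m)
  have "[:- a, 1:] ^ m dvd r * q" by (rule dvd_trans[OF _ Suc.prems]) (rule le_imp_power_dvd, simp)
  then obtain u where u: "q = [:- a, 1:] ^ m * u" using Suc.IH by (auto elim: dvdE)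
  have "[:- a, 1:] ^ m * [:- a, 1:] dvd [:- a, 1:] ^ m * (r * u)"
    using Suc.prems unfolding u by (simp only: power_Suc2 mult.left_commute)
  then have "[:- a, 1:] dvd r * u" by (subst (asm) dvd_mult_cancel_left) simp
  then have "poly (r * u) a = 0" by (simp only: poly_eq_0_iff_dvd)
  then have "[:- a, 1:] dvd u" using assms(1) by (simp add: poly_eq_0_iff_dvd[symmetric])
  then show ?case unfolding u power_Suc2 by (intro mult_dvd_mono) simp_all
qed simp

text \<open>Modulo Z^2 the powers of L0 = X + tY and L1 = L0 + cZ differ only in the first-order
  term. After multiplication by Z they agree, so high powers of L0 are killed, which is the first
  claim. Without Z the leftover is -n c times the value with one L0 replaced by Z. Adding the
  multiple \<open>j * c\<close> of the second generating polynomial cancels it and gains one more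
  order of vanishing.\<close>

lemma vanishing_order:
  fixes \<phi> :: "'k::field poly4 \<Rightarrow> 'k"
  assumes \<phi>: "kfunctional \<phi>" and Z: "\<And>r. \<phi> (Z ^ 2 * r) = 0"
    and L: "\<And>r. \<phi> ((X + Const t * Y + Const c * Z) ^ a * r) = 0" and a: "0 < a"
  shows "[:- t, 1:] ^ (j - a) dvd gen_poly \<phi> X Y Z (j - 1)"
    and "a \<le> j \<Longrightarrow> [:- t, 1:] ^ Suc (j - a) dvd
      gen_poly \<phi> X Y 1 j + smult (of_nat j * c) (gen_poly \<phi> X Y Z (j - 1))"
proof -
  define L0 where "L0 = X + Const t * Y"
  define L1 where "L1 = X + Const t * Y + Const c * Z"
  have L01: "L0 = L1 - Const c * Z" by (simp add: L0_def L1_def)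
  have kill: "\<phi> (L1 ^ n * r) = 0" if "a \<le> n" for n r
  proof -
    have "L1 ^ n * r = L1 ^ a * (L1 ^ (n - a) * r)"
      using that by (simp add: mult.assoc[symmetric] flip: power_add)
    then have "\<phi> (L1 ^ n * r) = \<phi> (L1 ^ a * (L1 ^ (n - a) * r))" by (rule arg_cong)
    then show ?thesis unfolding L1_def L .
  qed
  have kZ: "\<phi> (r * L0 ^ n * Z) = \<phi> (r * L1 ^ n * Z)" for r n
  proof -
    obtain u where u: "L0 ^ n = L1 ^ n - of_nat n * L1 ^ (n - 1) * (Const c * Z) + (Const c * Z) ^ 2 * u"
      unfolding L01 using diff_power_mod_square by metis
    have "r * L0 ^ n * Z = r * L1 ^ n * Z +
        Z ^ 2 * (r * (Const c ^ 2 * u * Z - of_nat n * L1 ^ (n - 1) * Const c))"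
      unfolding u by (simp add: algebra_simps power2_eq_square)
    then show ?thesis by (simp add: kfunctional_add[OF \<phi>] Z)
  qed
  have k1: "\<phi> (r * L0 ^ n) = - of_nat n * c * \<phi> (r * L0 ^ (n - 1) * Z)" if "a \<le> n" for r n
  proof -
    obtain u where u: "L0 ^ n = L1 ^ n - of_nat n * L1 ^ (n - 1) * (Const c * Z) + (Const c * Z) ^ 2 * u"
      unfolding L01 using diff_power_mod_square by metis
    have "r * L0 ^ n = L1 ^ n * r - Const (of_nat n * c) * (r * L1 ^ (n - 1) * Z) + Z ^ 2 * (Const c ^ 2 * u * r)"
      unfolding u Const_mult by (simp add: algebra_simps power2_eq_square)
    then have "\<phi> (r * L0 ^ n) = \<phi> (L1 ^ n * r) - of_nat n * c * \<phi> (r * L1 ^ (n - 1) * Z) + 0"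
      by (simp only: kfunctional_add[OF \<phi>] kfunctional_diff[OF \<phi>] kfunctional_Const[OF \<phi>] Z)
    then show ?thesis by (simp add: kill[OF that] kZ)
  qed
  show "[:- t, 1:] ^ (j - a) dvd gen_poly \<phi> X Y Z (j - 1)"
  proof (rule shift_dvd)
    fix k assume k: "k < j - a"
    then have "a \<le> j - 1 - k" by simp
    then have "\<phi> (L1 ^ (j - 1 - k) * (Y ^ k * Z)) = 0" by (rule kill)
    then have "\<phi> (L0 ^ (j - 1 - k) * Y ^ k * Z) = 0"
      using kZ[of "Y ^ k" "j - 1 - k"] by (simp add: mult_ac)
    then show "coeff (pcompose (gen_poly \<phi> X Y Z (j - 1)) [:t, 1:]) k = 0"
      unfolding gen_poly_shift[OF \<phi>] coeff_gen_poly[OF \<phi>] L0_def by simp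
  qed
  assume aj: "a \<le> j"
  show "[:- t, 1:] ^ Suc (j - a) dvd
      gen_poly \<phi> X Y 1 j + smult (of_nat j * c) (gen_poly \<phi> X Y Z (j - 1))"
  proof (rule shift_dvd)
    fix k assume k: "k < Suc (j - a)"
    then have ak: "a \<le> j - k" using aj by linarith
    \<comment> \<open>This identity matches the binomial weights in degree \<open>j\<close> and
      degree \<open>j - 1\<close>, and it is why the multiplier is \<open>j * c\<close> for all
      coefficients at once.\<close>
    have bin: "of_nat (j choose k) * of_nat (j - k) = (of_nat j * of_nat (j - 1 choose k) :: 'k)"
      using binomial_absorb_comp[of j k] by (metis mult.commute of_nat_mult)
    have "\<phi> (L0 ^ (j - k) * Y ^ k) = - of_nat (j - k) * c * \<phi> (L0 ^ (j - 1 - k) * Y ^ k * Z)"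
      using k1[OF ak, of "Y ^ k"] by (simp add: mult_ac)
    then have "of_nat (j choose k) * \<phi> (L0 ^ (j - k) * Y ^ k * 1) =
        - ((of_nat (j choose k) * of_nat (j - k)) * c * \<phi> (L0 ^ (j - 1 - k) * Y ^ k * Z))" by simp
    then have "of_nat (j choose k) * \<phi> (L0 ^ (j - k) * Y ^ k * 1) +
        of_nat j * c * (of_nat (j - 1 choose k) * \<phi> (L0 ^ (j - 1 - k) * Y ^ k * Z)) = 0"
      unfolding bin by simp
    then show "coeff (pcompose (gen_poly \<phi> X Y 1 j + smult (of_nat j * c) (gen_poly \<phi> X Y Z (j - 1))) [:t, 1:]) k = 0"
      unfolding pcompose_add pcompose_smult gen_poly_shift[OF \<phi>] coeff_add coeff_smult
        coeff_gen_poly[OF \<phi>] L0_def .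
  qed
qed

text \<open>The four forms are X + kY + c_k Z with this c_k. The values 0, 0, 1, 1 make the four
  point conditions independent on pairs of linear polynomials, and every three of them independent
  when the second polynomial is constant.\<close>

definition point_c :: "nat \<Rightarrow> 'k::field_char_0" where
  "point_c k = (if k < 2 then 0 else 1)"

text \<open>What remains of the extra order of vanishing at the point \<open>k\<close> once the
  common factor of the two generating polynomials has been divided out.\<close>

definition point_cond :: "nat \<Rightarrow> 'k::field_char_0 poly \<Rightarrow> 'k poly \<Rightarrow> nat \<Rightarrow> 'k" where
  "point_cond j G0 G1 k = poly G0 (of_nat k) + of_nat j * point_c k * poly G1 (of_nat k)"

lemma degree_le_1_form:
  assumes "\<And>k. 2 \<le> k \<Longrightarrow> coeff (p :: 'k::field poly) k = 0"
  shows "p = [:coeff p 0, coeff p 1:]"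
proof (rule poly_eqI)
  fix n
  show "coeff p n = coeff [:coeff p 0, coeff p 1:] n"
    using assms[of n] by (cases "n = 0 \<or> n = 1") (auto simp: coeff_pCons split: nat.split)
qed

text \<open>The two points with c_k = 0 see only \<open>G0\<close> and force it to vanish; the two
  points with c_k = 1 then see only \<open>G1\<close>.\<close>

lemma unisolvent_linear:
  fixes G0 G1 :: "'k::field_char_0 poly"
  assumes G: "\<And>k. 2 \<le> k \<Longrightarrow> coeff G0 k = 0" "\<And>k. 2 \<le> k \<Longrightarrow> coeff G1 k = 0" and j: "0 < j"
    and cond: "\<And>k. k < 4 \<Longrightarrow> point_cond j G0 G1 k = 0"
  shows "G0 = 0 \<and> G1 = 0"
proof -
  obtain a0 a1 where G0: "G0 = [:a0, a1:]" using degree_le_1_form G(1) by blast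
  obtain b0 b1 where G1: "G1 = [:b0, b1:]" using degree_le_1_form G(2) by blast
  have c: "a0 = 0" "a0 + a1 = 0" "a0 + 2 * a1 + of_nat j * (b0 + 2 * b1) = 0"
    "a0 + 3 * a1 + of_nat j * (b0 + 3 * b1) = 0"
    using cond[of 0] cond[of 1] cond[of 2] cond[of 3] by (simp_all add: point_cond_def point_c_def G0 G1)
  then have a: "a0 = 0" "a1 = 0" by simp_all
  then have "b0 + 2 * b1 = 0" "b0 + 3 * b1 = 0" using c j by simp_all
  then have "b1 = 0" "b0 = 0" by algebra+
  then show ?thesis using a by (simp add: G0 G1)
qed

text \<open>Three unknowns are left, and every three of the four conditions determine them, so any
  one point may be given up.\<close>

lemma unisolvent_constant:
  fixes G0 G1 :: "'k::field_char_0 poly"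
  assumes G: "\<And>k. 2 \<le> k \<Longrightarrow> coeff G0 k = 0" "\<And>k. 1 \<le> k \<Longrightarrow> coeff G1 k = 0" and j: "0 < j"
    and cond: "\<And>k. k < 4 \<Longrightarrow> k \<noteq> k0 \<Longrightarrow> point_cond j G0 G1 k = 0"
  shows "G0 = 0 \<and> G1 = 0"
proof -
  obtain a0 a1 where G0: "G0 = [:a0, a1:]" using degree_le_1_form G(1) by blast
  have "G1 = [:coeff G1 0, coeff G1 1:]" using G(2) by (intro degree_le_1_form) simp
  then obtain b0 where G1: "G1 = [:b0:]" using G(2)[of 1] by simp
  define e where "e = of_nat j * b0"
  have c: "k0 \<noteq> 0 \<Longrightarrow> a0 = 0" "k0 \<noteq> 1 \<Longrightarrow> a0 + a1 = 0" "k0 \<noteq> 2 \<Longrightarrow> a0 + 2 * a1 + e = 0"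
    "k0 \<noteq> 3 \<Longrightarrow> a0 + 3 * a1 + e = 0"
    using cond[of 0] cond[of 1] cond[of 2] cond[of 3]
    by (simp_all add: point_cond_def point_c_def G0 G1 e_def)
  have "a0 = 0 \<and> a1 = 0 \<and> e = 0"
  proof -
    consider "k0 = 0" | "k0 = 1" | "k0 \<noteq> 0" "k0 \<noteq> 1" by blast
    then show ?thesis
    proof cases
      case 1
      then have "a0 + a1 = 0" "a0 + 2 * a1 + e = 0" "a0 + 3 * a1 + e = 0" using c by simp_all
      then have "a1 = 0" "a0 = 0" "e = 0" by algebra+
      then show ?thesis by simp
    next
      case 2
      then have "a0 = 0" "a0 + 2 * a1 + e = 0" "a0 + 3 * a1 + e = 0" using c by simp_all
      then have "a1 = 0" "a0 = 0" "e = 0" by algebra+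
      then show ?thesis by simp
    next
      case 3
      then have "a0 = 0" "a1 = 0" using c by simp_all
      then show ?thesis using c(3,4) by (cases "k0 = 2") simp_all
    qed
  qed
  then show ?thesis using j by (simp add: G0 G1 e_def)
qed

text \<open>The generating polynomials of such a functional are divisible by
  \<open>\<Prod>k<4. (t - k)\<^bsup>j - a k\<^esup>\<close>, and the quotients satisfy one linear condition for each \<open>k\<close> with
  \<open>a k \<le> j\<close>; these conditions are independent as long as there is room for them.\<close>

lemma card_functionals_le:
  fixes \<phi> :: "'x \<Rightarrow> 'k::field_char_0 poly4 \<Rightarrow> 'k" and a :: "nat \<Rightarrow> nat"
  assumes T: "finite T" and \<phi>: "\<And>n. n \<in> T \<Longrightarrow> kfunctional (\<phi> n)"
    and Z: "\<And>n r. n \<in> T \<Longrightarrow> \<phi> n (Z ^ 2 * r) = 0"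
    and L: "\<And>n r k. n \<in> T \<Longrightarrow> k < 4 \<Longrightarrow> \<phi> n ((X + Const (of_nat k) * Y + Const (point_c k) * Z) ^ a k * r) = 0"
    and a: "\<And>k. k < 4 \<Longrightarrow> 0 < a k" and a3: "a 3 \<le> j"
    and indep: "\<And>\<alpha>. (\<And>k. (\<Sum>n\<in>T. \<alpha> n * \<phi> n (X ^ (j - k) * Y ^ k)) = 0 \<or> j < k) \<Longrightarrow>
      (\<And>k. (\<Sum>n\<in>T. \<alpha> n * \<phi> n (X ^ (j - 1 - k) * Y ^ k * Z)) = 0 \<or> j - 1 < k) \<Longrightarrow> \<forall>n\<in>T. \<alpha> n = 0"
  shows "int (card T) \<le> max 0 (2 * (int j - (\<Sum>k<4. int (j - a k))) + 1 - int (card {k. k < 4 \<and> a k \<le> j}))"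
proof (rule ccontr)
  define act where "act = {k. k < 4 \<and> a k \<le> j}"
  define inact where "inact = {k. k < 4 \<and> j < a k}"
  define d where "d = (\<Sum>k<4. j - a k)"
  assume "\<not> ?thesis"
  then have less: "max 0 (2 * (int j - int d) + 1 - int (card act)) < int (card T)"
    unfolding act_def d_def by (simp only: of_nat_sum not_le)
  have j: "0 < j" using a[of 3] a3 by simp
  have "act \<union> inact = {..<4}" "act \<inter> inact = {}" by (auto simp: act_def inact_def)
  then have card4: "card act + card inact = 4"
    using card_Un_disjoint[of act inact] by (simp add: act_def inact_def)
  have Tne: "T \<noteq> {}" using less by auto
  define F0 where "F0 n = gen_poly (\<phi> n) X Y 1 j" for n
  define F1 where "F1 n = gen_poly (\<phi> n) X Y Z (j - 1)" for n
  have indepF: "\<forall>n\<in>T. \<alpha> n = 0" if 0: "(\<Sum>n\<in>T. smult (\<alpha> n) (F0 n)) = 0" "(\<Sum>n\<in>T. smult (\<alpha> n) (F1 n)) = 0" for \<alpha>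
  proof (rule indep)
    fix k
    have "of_nat (j choose k) * (\<Sum>n\<in>T. \<alpha> n * \<phi> n (X ^ (j - k) * Y ^ k)) = coeff (\<Sum>n\<in>T. smult (\<alpha> n) (F0 n)) k"
      by (simp add: coeff_sum F0_def coeff_gen_poly[OF \<phi>] sum_distrib_left mult_ac)
    then show "(\<Sum>n\<in>T. \<alpha> n * \<phi> n (X ^ (j - k) * Y ^ k)) = 0 \<or> j < k"
      unfolding 0 by (auto simp: not_less)
  next
    fix k
    have "of_nat (j - 1 choose k) * (\<Sum>n\<in>T. \<alpha> n * \<phi> n (X ^ (j - 1 - k) * Y ^ k * Z)) =
        coeff (\<Sum>n\<in>T. smult (\<alpha> n) (F1 n)) k"
      by (simp add: coeff_sum F1_def coeff_gen_poly[OF \<phi>] sum_distrib_left mult_ac)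
    then show "(\<Sum>n\<in>T. \<alpha> n * \<phi> n (X ^ (j - 1 - k) * Y ^ k * Z)) = 0 \<or> j - 1 < k"
      unfolding 0 by (auto simp: not_less)
  qed
  define l where "l k = [:- of_nat k, 1 :: 'k:]" for k
  define M where "M = (\<Prod>k<4. l k ^ (j - a k))"
  have l0: "l k \<noteq> 0" for k by (simp add: l_def)
  have M0: "M \<noteq> 0" by (simp add: M_def l0)
  have degM: "degree M = d"
    unfolding M_def d_def using l0
    by (subst degree_prod_eq_sum_degree) (simp_all add: degree_power_eq l_def)
  have lk: "poly (l k) (of_nat k') = 0 \<longleftrightarrow> k = k'" for k k'
    by (auto simp: l_def)
  have dvdM: "M dvd p" if dvd: "\<And>k. k < 4 \<Longrightarrow> l k ^ (j - a k) dvd p" for p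
  proof -
    have "(\<Prod>k\<in>A. l k ^ (j - a k)) dvd p" if A: "finite A" "A \<subseteq> {..<4}" for A
      using A
    proof (induction A rule: finite_induct)
      case (insert x A)
      then have "(\<Prod>k\<in>A. l k ^ (j - a k)) dvd p" by simp
      then obtain q where q: "p = (\<Prod>k\<in>A. l k ^ (j - a k)) * q" by (auto elim: dvdE)
      have "poly (\<Prod>k\<in>A. l k ^ (j - a k)) (of_nat x) \<noteq> 0"
        unfolding poly_prod poly_power using insert.hyps lk by (auto simp: prod_zero_iff)
      moreover have "l x ^ (j - a x) dvd p" using insert.prems by (intro dvd) simp
      ultimately have "l x ^ (j - a x) dvd q" unfolding q l_def by (rule linear_power_dvd_cancel)
      then have "l x ^ (j - a x) * (\<Prod>k\<in>A. l k ^ (j - a k)) dvd p"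
        unfolding q mult.commute[of "l x ^ (j - a x)"] by (intro mult_dvd_mono) simp_all
      then show ?case using insert.hyps by simp
    qed simp
    then show ?thesis by (simp add: M_def)
  qed
  have van: "l k ^ (j - a k) dvd F1 n"
    "a k \<le> j \<Longrightarrow> l k ^ Suc (j - a k) dvd F0 n + smult (of_nat j * point_c k) (F1 n)"
    if "n \<in> T" "k < 4" for n k
    unfolding l_def F0_def F1_def
    by (rule vanishing_order(1)[OF \<phi>[OF that(1)] Z[OF that(1)] L[OF that] a[OF that(2)]],
        rule vanishing_order(2)[OF \<phi>[OF that(1)] Z[OF that(1)] L[OF that] a[OF that(2)]])
  have MF1: "M dvd F1 n" if "n \<in> T" for n using van(1)[OF that] by (rule dvdM)
  have MF0: "M dvd F0 n" if n: "n \<in> T" for n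
  proof (rule dvdM)
    fix k :: nat assume k: "k < 4"
    show "l k ^ (j - a k) dvd F0 n"
    proof (cases "a k \<le> j")
      case True
      have "l k ^ (j - a k) dvd F0 n + smult (of_nat j * point_c k) (F1 n)"
        by (rule dvd_trans[OF _ van(2)[OF n k True]]) (rule le_imp_power_dvd, simp)
      moreover have "l k ^ (j - a k) dvd smult (of_nat j * point_c k) (F1 n)"
        using van(1)[OF n k] by (rule dvd_smult)
      ultimately show ?thesis by (metis dvd_add_left_iff)
    qed simp
  qed
  from MF0 have "\<forall>n\<in>T. \<exists>g. F0 n = M * g" by (auto elim: dvdE)
  from bchoice[OF this] obtain G0 where G0: "\<And>n. n \<in> T \<Longrightarrow> F0 n = M * G0 n" by blast
  from MF1 have "\<forall>n\<in>T. \<exists>g. F1 n = M * g" by (auto elim: dvdE)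
  from bchoice[OF this] obtain G1 where G1: "\<And>n. n \<in> T \<Longrightarrow> F1 n = M * G1 n" by blast
  \<comment> \<open>The generating polynomials have degrees at most \<open>j\<close> and
    \<open>j - 1\<close>, and \<open>M\<close> has degree \<open>d\<close>. For \<open>d < j\<close>
    the quotients thus have 2(j - d) + 1 coefficients in all, the main term of the bound.\<close>
  have zeroG0: "coeff (G0 n) k = 0" if "n \<in> T" "j < d + k" for n k
  proof (cases "G0 n = 0")
    case False
    then have "degree (F0 n) = d + degree (G0 n)"
      unfolding G0[OF that(1)] using M0 degM by (simp add: degree_mult_eq)
    moreover have "degree (F0 n) \<le> j" unfolding F0_def by (rule degree_gen_poly[OF \<phi>[OF that(1)]])
    ultimately show ?thesis using that(2) by (intro coeff_eq_0) linarith
  qed simp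
  have zeroG1: "coeff (G1 n) k = 0" if "n \<in> T" "j \<le> d + k" for n k
  proof (cases "G1 n = 0")
    case False
    then have "degree (F1 n) = d + degree (G1 n)"
      unfolding G1[OF that(1)] using M0 degM by (simp add: degree_mult_eq)
    moreover have "degree (F1 n) \<le> j - 1" unfolding F1_def by (rule degree_gen_poly[OF \<phi>[OF that(1)]])
    ultimately show ?thesis using that(2) j by (intro coeff_eq_0) linarith
  qed simp
  \<comment> \<open>\<open>M\<close> contains the factor of the point \<open>k\<close> only to the
    power \<open>j - a k\<close>, so the order \<open>Suc (j - a k)\<close> leaves a zero at
    \<open>k\<close> after division.\<close>
  have active: "point_cond j (G0 n) (G1 n) k = 0" if n: "n \<in> T" and k: "k \<in> act" for n k
  proof -
    have k': "k < 4" "a k \<le> j" using k by (auto simp: act_def)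
    define M' where "M' = (\<Prod>i\<in>{..<4} - {k}. l i ^ (j - a i))"
    have M: "M = l k ^ (j - a k) * M'" unfolding M_def M'_def using k'(1) by (intro prod.remove) auto
    have "l k ^ (j - a k) * l k dvd l k ^ (j - a k) * (M' * (G0 n + smult (of_nat j * point_c k) (G1 n)))"
      using van(2)[OF n k'] unfolding G0[OF n] G1[OF n] M
      by (simp add: distrib_left mult_ac mult_smult_right)
    then have "l k dvd M' * (G0 n + smult (of_nat j * point_c k) (G1 n))" using l0 by simp
    then have "l k ^ 1 dvd M' * (G0 n + smult (of_nat j * point_c k) (G1 n))" by simp
    moreover have "poly M' (of_nat k) \<noteq> 0"
      unfolding M'_def poly_prod poly_power using lk by (auto simp: prod_zero_iff)
    ultimately have "l k ^ 1 dvd G0 n + smult (of_nat j * point_c k) (G1 n)"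
      unfolding l_def by (rule linear_power_dvd_cancel[rotated])
    then have "poly (G0 n + smult (of_nat j * point_c k) (G1 n)) (of_nat k) = 0"
      unfolding poly_eq_0_iff_dvd l_def by simp
    then show ?thesis by (simp add: point_cond_def)
  qed
  define S0 where "S0 \<alpha> = (\<Sum>n\<in>T. smult (\<alpha> n) (G0 n))" for \<alpha>
  define S1 where "S1 \<alpha> = (\<Sum>n\<in>T. smult (\<alpha> n) (G1 n))" for \<alpha>
  have contra: "\<forall>n\<in>T. \<alpha> n = 0" if "S0 \<alpha> = 0 \<and> S1 \<alpha> = 0" for \<alpha>
  proof (rule indepF)
    have "(\<Sum>n\<in>T. smult (\<alpha> n) (F0 n)) = M * S0 \<alpha>"
      unfolding S0_def sum_distrib_left by (intro sum.cong refl) (simp add: G0)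
    then show "(\<Sum>n\<in>T. smult (\<alpha> n) (F0 n)) = 0" using that by simp
    have "(\<Sum>n\<in>T. smult (\<alpha> n) (F1 n)) = M * S1 \<alpha>"
      unfolding S1_def sum_distrib_left by (intro sum.cong refl) (simp add: G1)
    then show "(\<Sum>n\<in>T. smult (\<alpha> n) (F1 n)) = 0" using that by simp
  qed
  have S0c: "coeff (S0 \<alpha>) k = (\<Sum>n\<in>T. \<alpha> n * coeff (G0 n) k)"
    and S1c: "coeff (S1 \<alpha>) k = (\<Sum>n\<in>T. \<alpha> n * coeff (G1 n) k)"
    and Sp: "point_cond j (S0 \<alpha>) (S1 \<alpha>) k = (\<Sum>n\<in>T. \<alpha> n * point_cond j (G0 n) (G1 n) k)" for \<alpha> k
    by (simp_all add: S0_def S1_def coeff_sum point_cond_def poly_sum distrib_left sum.distrib sum_distrib_left mult_ac)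
  have Sact: "point_cond j (S0 \<alpha>) (S1 \<alpha>) k = 0" if "k \<in> act" for \<alpha> k
    unfolding Sp using active[OF _ that] by simp
  have S0z: "coeff (S0 \<alpha>) k = 0" if "j < d + k" for \<alpha> k unfolding S0c using zeroG0 that by simp
  have S1z: "coeff (S1 \<alpha>) k = 0" if "j \<le> d + k" for \<alpha> k unfolding S1c using zeroG1 that by simp
  \<comment> \<open>The first component of \<open>y\<close> tells the kind of condition: a
    coefficient of \<open>G0\<close>, a coefficient of \<open>G1\<close>, or the value at a point.
    Fewer conditions than functionals leave a nontrivial combination that satisfies all of
    them.\<close>
  define w where "w n y = (case y of (i :: nat, k) \<Rightarrow>
      if i = 0 then coeff (G0 n) k else if i = 1 then coeff (G1 n) k else point_cond j (G0 n) (G1 n) k)" for n y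
  have solve: "\<exists>\<alpha>. (\<exists>n\<in>T. \<alpha> n \<noteq> 0) \<and> (\<forall>k\<in>A. coeff (S0 \<alpha>) k = 0) \<and> (\<forall>k\<in>B. coeff (S1 \<alpha>) k = 0) \<and>
      (\<forall>k\<in>C. point_cond j (S0 \<alpha>) (S1 \<alpha>) k = 0)"
    if fin: "finite A" "finite B" "finite C" and card: "card A + card B + card C < card T" for A B C
  proof -
    define W where "W = Pair 0 ` A \<union> Pair (1::nat) ` B \<union> Pair 2 ` C"
    have "card W \<le> card A + card B + card C"
      unfolding W_def using card_Un_le[of "Pair 0 ` A \<union> Pair (1::nat) ` B" "Pair 2 ` C"]
        card_Un_le[of "Pair 0 ` A" "Pair (1::nat) ` B"] card_image_le[OF fin(1), of "Pair (0::nat)"]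
        card_image_le[OF fin(2), of "Pair (1::nat)"] card_image_le[OF fin(3), of "Pair (2::nat)"] by linarith
    with card have "card W < card T" by simp
    moreover have "finite W" using fin by (simp add: W_def)
    ultimately obtain \<alpha> where \<alpha>: "\<exists>n\<in>T. \<alpha> n \<noteq> 0" "\<forall>y\<in>W. (\<Sum>n\<in>T. \<alpha> n * w n y) = 0"
      using homogeneous_system[OF _ T, of W w] by blast
    have "(\<Sum>n\<in>T. \<alpha> n * coeff (G0 n) k) = 0" if "k \<in> A" for k
      using \<alpha>(2)[rule_format, of "(0, k)"] that by (simp add: W_def w_def)
    moreover have "(\<Sum>n\<in>T. \<alpha> n * coeff (G1 n) k) = 0" if "k \<in> B" for k
      using \<alpha>(2)[rule_format, of "(1, k)"] that by (simp add: W_def w_def)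
    moreover have "(\<Sum>n\<in>T. \<alpha> n * point_cond j (G0 n) (G1 n) k) = 0" if "k \<in> C" for k
      using \<alpha>(2)[rule_format, of "(2, k)"] that by (simp add: W_def w_def)
    ultimately show ?thesis using \<alpha>(1) unfolding S0c S1c Sp by blast
  qed
  have fininact: "finite inact" by (simp add: inact_def)
  have cases4: "k \<in> act \<or> k \<in> inact" if "k < 4" for k using that by (auto simp: act_def inact_def)
  consider "j \<le> d" | "j = Suc d" | "Suc d < j" by linarith
  then show False
  proof cases
    case 1
    \<comment> \<open>There is no room here: \<open>S1\<close> vanishes, \<open>S0\<close> is
      constant, and the condition at point 3, active by \<open>a3\<close>, kills the constant. So
      already a single functional is too many.\<close>
    obtain n0 where n0: "n0 \<in> T" using Tne by blast
    define \<alpha> where "\<alpha> n = (if n = n0 then 1 else 0 :: 'k)" for n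
    have S1: "S1 \<alpha> = 0" using S1z 1 by (intro poly_eqI) simp
    define x where "x = coeff (S0 \<alpha>) 0"
    have S0: "S0 \<alpha> = [:x:]"
      unfolding x_def using S0z 1 by (intro poly_eqI) (simp add: coeff_pCons split: nat.split)
    have "(3::nat) \<in> act" using a3 by (simp add: act_def)
    from Sact[OF this, of \<alpha>] have "x = 0" by (simp add: S0 S1 point_cond_def)
    then have "S0 \<alpha> = 0" by (simp add: S0)
    with S1 have "\<forall>n\<in>T. \<alpha> n = 0" by (intro contra) simp
    then have "\<alpha> n0 = 0" using n0 by simp
    then show False by (simp add: \<alpha>_def)
  next
    case 2
    \<comment> \<open>Three unknowns need three conditions only. One inactive point
      \<open>k0\<close> is given up, if there is one, and the other inactive conditions are imposed;
      \<open>k0\<close> is a dummy if all points are active.\<close>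
    obtain C k0 where C: "C \<subseteq> inact" "inact \<subseteq> insert k0 C" "card C < card T"
    proof (cases "inact = {}")
      case True
      show thesis using that[of "{}" 0] True Tne T by (simp add: card_gt_0_iff)
    next
      case False
      then obtain k0 where k0: "k0 \<in> inact" by blast
      have "Suc (card (inact - {k0})) = card inact" using fininact k0 by (rule card_Suc_Diff1)
      then have "card (inact - {k0}) < card T" using less card4 2 by simp
      then show thesis using that[of "inact - {k0}" k0] by auto
    qed
    have "finite C" using C(1) fininact finite_subset by blast
    with solve[of "{}" "{}" C] C(3) obtain \<alpha> where
      \<alpha>: "\<exists>n\<in>T. \<alpha> n \<noteq> 0" "\<forall>k\<in>C. point_cond j (S0 \<alpha>) (S1 \<alpha>) k = 0" by auto
    have "S0 \<alpha> = 0 \<and> S1 \<alpha> = 0"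
    proof (rule unisolvent_constant[OF _ _ j])
      show "coeff (S0 \<alpha>) k = 0" if "2 \<le> k" for k using that 2 by (intro S0z) simp
      show "coeff (S1 \<alpha>) k = 0" if "1 \<le> k" for k using that 2 by (intro S1z) simp
      fix k assume k: "k < 4" "k \<noteq> k0"
      have "k \<in> act \<or> k \<in> C" using cases4[OF k(1)] C(2) k(2) by auto
      then show "point_cond j (S0 \<alpha>) (S1 \<alpha>) k = 0" using Sact \<alpha>(2) by auto
    qed
    then have "\<forall>n\<in>T. \<alpha> n = 0" by (rule contra)
    with \<alpha>(1) show False by simp
  next
    case 3
    define e where "e = j - d"
    have e: "2 \<le> e" "j = d + e" using 3 by (simp_all add: e_def)
    \<comment> \<open>Imposing the vanishing of all coefficients beyond the linear ones and of the
      inactive conditions costs 2e - 3 plus 4 minus the number of active points, which is exactly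
      the bound. What survives is a pair of linear polynomials with four conditions.\<close>
    have "card {2..e} + card {2..<e} + card inact < card T" using less card4 e by simp
    from solve[OF _ _ fininact this] obtain \<alpha> where \<alpha>: "\<exists>n\<in>T. \<alpha> n \<noteq> 0"
      "\<forall>k\<in>{2..e}. coeff (S0 \<alpha>) k = 0" "\<forall>k\<in>{2..<e}. coeff (S1 \<alpha>) k = 0"
      "\<forall>k\<in>inact. point_cond j (S0 \<alpha>) (S1 \<alpha>) k = 0" by auto
    have "S0 \<alpha> = 0 \<and> S1 \<alpha> = 0"
    proof (rule unisolvent_linear[OF _ _ j])
      fix k :: nat assume k: "2 \<le> k"
      show "coeff (S0 \<alpha>) k = 0" using \<alpha>(2) S0z[of k] k e(2) by (cases "k \<le> e") auto
      show "coeff (S1 \<alpha>) k = 0" using \<alpha>(3) S1z[of k] k e(2) by (cases "k < e") auto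
    next
      fix k :: nat assume "k < 4"
      then show "point_cond j (S0 \<alpha>) (S1 \<alpha>) k = 0" using cases4 Sact \<alpha>(4) by blast
    qed
    then have "\<forall>n\<in>T. \<alpha> n = 0" by (rule contra)
    with \<alpha>(1) show False by simp
  qed
qed

section \<open>The Hilbert function of a complete intersection with a quadric generator\<close>

definition std :: "(4 \<Rightarrow> nat) \<Rightarrow> nat \<Rightarrow> mon4 set" where
  "std ex j = mons j - powers ex"

lemma finite_std [simp]: "finite (std ex j)"
  by (simp add: std_def)

lemma std_iff: "m \<in> std ex j \<longleftrightarrow> mdeg m = j \<and> (\<forall>i. cf m i < ex i)"
  by (auto simp: std_def mons_def powers_def not_le)

definition mon_of :: "(4 \<Rightarrow> nat) \<Rightarrow> mon4" where
  "mon_of f = (\<Sum>i\<in>UNIV. Poly_Mapping.single i (f i))"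

lemma cf_mon_of [simp]: "cf (mon_of f) i = f i"
  by (simp add: mon_of_def cf_sum lookup_single when_def)

lemma mdeg_mon_of: "mdeg (mon_of f) = (\<Sum>i\<in>UNIV. f i)"
  by (simp add: mdeg_def)

text \<open>Taking complements in the socle monomial, whose exponents are \<open>ex i - 1\<close>,
  is a bijection.\<close>

lemma card_std_symmetric:
  assumes ex: "\<And>i. 0 < ex i" and c: "c = (\<Sum>i\<in>UNIV. ex i - 1)" and j: "j \<le> c"
  shows "card (std ex (c - j)) = card (std ex j)"
proof -
  define \<sigma> where "\<sigma> m = mon_of (\<lambda>i. ex i - 1 - cf m i)" for m
  have deg: "mdeg (\<sigma> m) + mdeg m = c" if "\<forall>i. cf m i < ex i" for m
  proof -
    have "mdeg (\<sigma> m) + mdeg m = (\<Sum>i\<in>UNIV. ex i - 1 - cf m i + cf m i)"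
      unfolding \<sigma>_def mdeg_mon_of by (simp add: mdeg_def sum.distrib)
    also have "\<dots> = c"
      unfolding c
    proof (rule sum.cong[OF refl])
      fix i show "ex i - 1 - cf m i + cf m i = ex i - 1" using that[rule_format, of i] by linarith
    qed
    finally show ?thesis .
  qed
  have inv: "\<sigma> (\<sigma> m) = m" if "\<forall>i. cf m i < ex i" for m
  proof (rule poly_mapping_eqI)
    fix i show "cf (\<sigma> (\<sigma> m)) i = cf m i" using that[rule_format, of i] by (simp add: \<sigma>_def)
  qed
  have small: "\<forall>i. cf (\<sigma> m) i < ex i" for m
  proof
    fix i show "cf (\<sigma> m) i < ex i" using ex[of i] by (simp add: \<sigma>_def)
  qed
  have "bij_betw \<sigma> (std ex j) (std ex (c - j))"
  proof (rule bij_betw_byWitness[where f' = \<sigma>])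
    show "\<forall>m\<in>std ex j. \<sigma> (\<sigma> m) = m" "\<forall>m\<in>std ex (c - j). \<sigma> (\<sigma> m) = m"
      using inv by (simp_all add: std_iff)
    show "\<sigma> ` std ex j \<subseteq> std ex (c - j)"
    proof (rule image_subsetI)
      fix m assume "m \<in> std ex j"
      then show "\<sigma> m \<in> std ex (c - j)" using deg[of m] small[of m] by (simp add: std_iff)
    qed
    show "\<sigma> ` std ex (c - j) \<subseteq> std ex j"
    proof (rule image_subsetI)
      fix m assume "m \<in> std ex (c - j)"
      then show "\<sigma> m \<in> std ex j" using deg[of m] small[of m] j by (simp add: std_iff)
    qed
  qed
  then show ?thesis by (simp add: bij_betw_same_card)
qed

lemma std_empty:
  assumes "(\<Sum>i\<in>UNIV. ex i - 1) < j"
  shows "std ex j = {}"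
proof -
  have "mdeg m \<le> (\<Sum>i\<in>UNIV. ex i - 1)" if "\<forall>i. cf m i < ex i" for m
    unfolding mdeg_def
  proof (rule sum_mono)
    fix i show "cf m i \<le> ex i - 1" using that[rule_format, of i] by linarith
  qed
  then show ?thesis using assms by (fastforce simp: std_iff)
qed

text \<open>The Hilbert function of K[x, y, z]/(z^2) in degree \<open>j - a\<close>. It is the
  expected number of degree \<open>j\<close> relations that an \<open>a\<close>-th power contributes
  in this ring.\<close>

definition excess :: "nat \<Rightarrow> nat \<Rightarrow> int" where
  "excess a j = (if a \<le> j then 2 * int (j - a) + 1 else 0)"

text \<open>The indices are permuted so that the quadric generator belongs to \<open>k4\<close>. The
  other three play interchangeable roles in the hypotheses.\<close>

locale quadric_ci =
  fixes ex :: "4 \<Rightarrow> nat" and k1 k2 k3 k4 :: 4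
  assumes ex_pos: "\<And>i. 0 < ex i" and ex_k4: "ex k4 = 2"
    and indices: "UNIV = {k1, k2, k3, k4}"
    and distinct_indices: "k1 \<noteq> k2" "k1 \<noteq> k3" "k1 \<noteq> k4" "k2 \<noteq> k3" "k2 \<noteq> k4" "k3 \<noteq> k4"
begin

lemma all_indices: "(\<forall>i. P i) \<longleftrightarrow> P k1 \<and> P k2 \<and> P k3 \<and> P k4"
proof -
  have "(\<forall>i. P i) \<longleftrightarrow> (\<forall>i\<in>{k1, k2, k3, k4}. P i)" using indices by blast
  then show ?thesis by simp
qed

lemma sum_indices: "(\<Sum>i\<in>UNIV. f i) = f k1 + f k2 + f k3 + f k4"
  unfolding indices using distinct_indices by (simp add: add.assoc)

lemma mdeg_indices: "mdeg m = cf m k1 + cf m k2 + cf m k3 + cf m k4"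
  unfolding mdeg_def sum_indices ..

text \<open>A monomial basis of the polynomial ring modulo the variable \<open>k1\<close> and the
  square of the variable \<open>k4\<close>. Standard monomials that are not multiples of the
  variable \<open>k1\<close> all lie here.\<close>

definition slice :: "nat \<Rightarrow> mon4 set" where
  "slice j = {m\<in>mons j. cf m k1 = 0 \<and> cf m k4 < 2}"

lemma finite_slice [simp]: "finite (slice j)"
  by (simp add: slice_def)

lemma card_slice: "card (slice j) = 2 * j + 1"
proof -
  \<comment> \<open>The pairs are the exponents of \<open>k2\<close> and \<open>k4\<close>, and
    \<open>k3\<close> takes the rest of the degree. This gives j + 1 pairs for exponent 0 of
    \<open>k4\<close> and j pairs for exponent 1.\<close>
  define S where "S = {..j} \<times> {0 :: nat} \<union> {..<j} \<times> {1}"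
  define f where "f x = mon_of (\<lambda>i. if i = k2 then fst x else if i = k3 then j - fst x - snd x
    else if i = k4 then snd x else 0)" for x
  have cff: "cf (f x) k1 = 0" "cf (f x) k2 = fst x" "cf (f x) k3 = j - fst x - snd x" "cf (f x) k4 = snd x" for x
    using distinct_indices by (auto simp: f_def)
  have "inj_on f S"
  proof (rule inj_onI)
    fix x y assume "f x = f y"
    then show "x = y" using cff[of x] cff[of y] by (metis prod_eqI)
  qed
  then have "card (f ` S) = card S" by (rule card_image)
  moreover have "f ` S = slice j"
  proof (intro equalityI subsetI)
    fix m assume "m \<in> f ` S"
    then show "m \<in> slice j" by (auto simp: S_def slice_def mons_def mdeg_indices cff)
  next
    fix m assume m: "m \<in> slice j"
    then have d: "cf m k1 = 0" "cf m k4 < 2" "cf m k2 + cf m k3 + cf m k4 = j"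
      by (auto simp: slice_def mons_def mdeg_indices)
    have "\<forall>i. cf m i = cf (f (cf m k2, cf m k4)) i"
      unfolding all_indices cff using d by simp
    then have "m = f (cf m k2, cf m k4)" by (intro poly_mapping_eqI) (rule spec)
    moreover have "(cf m k2, cf m k4) \<in> S" using d by (auto simp: S_def)
    ultimately show "m \<in> f ` S" by (rule image_eqI)
  qed
  moreover have "card S = 2 * j + 1"
    unfolding S_def by (subst card_Un_disjoint) auto
  ultimately show ?thesis by simp
qed

lemma card_std_0: "card (std ex 0) = 1"
proof -
  have "std ex 0 = {0}" using ex_pos by (auto simp: std_iff)
  then show ?thesis by simp
qed

text \<open>Division by the variable \<open>k1\<close> is injective on its multiples and stays
  standard; the remaining standard monomials are in the slice.\<close>

lemma card_std_le: "card (std ex (Suc j)) \<le> card (std ex j) + 2 * Suc j + 1"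
proof -
  define A where "A = {m\<in>std ex (Suc j). 0 < cf m k1}"
  define e where "e = Poly_Mapping.single k1 (1::nat)"
  have "card A \<le> card (std ex j)"
  proof (rule card_inj_on_le[of "\<lambda>m. m - e"])
    show "inj_on (\<lambda>m. m - e) A" unfolding e_def by (rule inj_on_minus_single) (auto simp: A_def)
    show "(\<lambda>m. m - e) ` A \<subseteq> std ex j"
    proof (rule image_subsetI)
      fix m assume m: "m \<in> A"
      then have "mdeg m = 1 + mdeg (m - e)" unfolding e_def by (intro mdeg_minus_single) (auto simp: A_def)
      then have "mdeg (m - e) = j" using m by (simp add: A_def std_iff)
      moreover have "cf (m - e) i < ex i" for i
        using m by (auto simp: A_def std_iff lookup_minus intro: le_less_trans[OF diff_le_self])
      ultimately show "m - e \<in> std ex j" by (simp add: std_iff)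
    qed
  qed simp
  moreover have "std ex (Suc j) \<subseteq> A \<union> slice (Suc j)"
  proof
    fix m assume m: "m \<in> std ex (Suc j)"
    then have "cf m k4 < 2" using ex_k4 by (metis std_iff)
    then show "m \<in> A \<union> slice (Suc j)" using m by (auto simp: A_def slice_def std_def)
  qed
  then have "card (std ex (Suc j)) \<le> card (A \<union> slice (Suc j))" by (intro card_mono) (simp_all add: A_def)
  moreover have "card (A \<union> slice (Suc j)) \<le> card A + card (slice (Suc j))" by (rule card_Un_le)
  ultimately show ?thesis by (simp add: card_slice)
qed

lemma card_slice_excess:
  assumes a: "0 < a" and k: "k \<noteq> k1" "k \<noteq> k4"
  shows "int (card {m\<in>slice j. a \<le> cf m k}) \<le> excess a j"
proof (cases "a \<le> j")
  case True
  define e where "e = Poly_Mapping.single k a"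
  have "card {m\<in>slice j. a \<le> cf m k} \<le> card (slice (j - a))"
  proof (rule card_inj_on_le[of "\<lambda>m. m - e"])
    show "inj_on (\<lambda>m. m - e) {m\<in>slice j. a \<le> cf m k}" unfolding e_def by (rule inj_on_minus_single) blast
    show "(\<lambda>m. m - e) ` {m\<in>slice j. a \<le> cf m k} \<subseteq> slice (j - a)"
    proof (rule image_subsetI)
      fix m assume m: "m \<in> {m\<in>slice j. a \<le> cf m k}"
      then have "mdeg m = a + mdeg (m - e)" unfolding e_def by (intro mdeg_minus_single) simp
      moreover have "mdeg m = j" using m by (simp add: slice_def mons_def)
      ultimately have "mdeg (m - e) = j - a" by linarith
      then show "m - e \<in> slice (j - a)" using m k by (auto simp: slice_def mons_def e_def lookup_minus lookup_single when_def)
    qed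
  qed simp
  then show ?thesis using True by (simp add: card_slice excess_def)
next
  case False
  have "{m\<in>slice j. a \<le> cf m k} = {}"
  proof -
    have "cf m k \<le> j" if "m \<in> slice j" for m
    proof -
      have "\<forall>i. cf m i \<le> mdeg m" unfolding all_indices by (simp add: mdeg_indices)
      then show ?thesis using that by (auto simp: slice_def mons_def)
    qed
    then show ?thesis using False by fastforce
  qed
  then show ?thesis by (simp only: card.empty) (simp add: excess_def)
qed

text \<open>These are the monomials lost under multiplication by the variable \<open>k1\<close>.
  Removing its power \<open>ex k1 - 1\<close> leaves degree \<open>Suc j - ex k1\<close>, which
  explains the argument \<open>Suc j\<close>.\<close>

lemma card_std_top_excess: "int (card {m\<in>std ex j. cf m k1 = ex k1 - 1}) \<le> excess (ex k1) (Suc j)"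
proof (cases "ex k1 \<le> Suc j")
  case True
  define b where "b = ex k1 - 1"
  define e where "e = Poly_Mapping.single k1 b"
  have bj: "Suc j - ex k1 = j - b" using ex_pos[of k1] by (simp add: b_def)
  have "card {m\<in>std ex j. cf m k1 = b} \<le> card (slice (j - b))"
  proof (rule card_inj_on_le[of "\<lambda>m. m - e"])
    show "inj_on (\<lambda>m. m - e) {m\<in>std ex j. cf m k1 = b}" unfolding e_def by (rule inj_on_minus_single) auto
    show "(\<lambda>m. m - e) ` {m\<in>std ex j. cf m k1 = b} \<subseteq> slice (j - b)"
    proof (rule image_subsetI)
      fix m assume m: "m \<in> {m\<in>std ex j. cf m k1 = b}"
      then have "mdeg m = b + mdeg (m - e)" unfolding e_def by (intro mdeg_minus_single) simp
      moreover have "mdeg m = j" using m by (simp add: std_iff)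
      ultimately have "mdeg (m - e) = j - b" by linarith
      moreover have "cf m k4 < 2" using m ex_k4 by (metis std_iff mem_Collect_eq)
      ultimately show "m - e \<in> slice (j - b)"
        using m distinct_indices by (auto simp: slice_def mons_def e_def lookup_minus lookup_single when_def)
    qed
  qed simp
  then have "int (card {m\<in>std ex j. cf m k1 = b}) \<le> 2 * int (Suc j - ex k1) + 1"
    unfolding card_slice bj by linarith
  then show ?thesis using True unfolding b_def by (simp only: excess_def if_True)
next
  case False
  have "{m\<in>std ex j. cf m k1 = ex k1 - 1} = {}"
  proof -
    have "cf m k1 \<le> j" if "m \<in> std ex j" for m using that by (simp add: std_iff mdeg_indices)
    then show ?thesis using False by fastforce
  qed
  then show ?thesis by (simp only: card.empty) (simp add: excess_def)
qed

text \<open>Two disjoint families are standard in degree \<open>Suc j\<close>: the multiples by the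
  variable \<open>k1\<close> of those standard monomials where its exponent can still grow, and the
  slice without the monomials divisible by the powers belonging to \<open>k2\<close> or
  \<open>k3\<close>. The losses are bounded by the three excess terms.\<close>

lemma card_std_ge:
  "int (card (std ex j)) + 2 * int (Suc j) + 1 - excess (ex k1) (Suc j) - excess (ex k2) (Suc j) - excess (ex k3) (Suc j)
    \<le> int (card (std ex (Suc j)))"
proof -
  define e where "e = Poly_Mapping.single k1 (1::nat)"
  define A where "A = {m\<in>std ex j. cf m k1 = ex k1 - 1}"
  define S where "S = slice (Suc j)"
  define B2 where "B2 = {m\<in>S. ex k2 \<le> cf m k2}"
  define B3 where "B3 = {m\<in>S. ex k3 \<le> cf m k3}"
  have fin: "finite S" "finite A" "finite B2" "finite B3" by (simp_all add: S_def A_def B2_def B3_def)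
  have 1: "card ((+) e ` (std ex j - A)) = card (std ex j) - card A"
    using fin by (subst card_image) (auto simp: inj_on_def A_def intro!: card_Diff_subset)
  have 2: "card S - card (B2 \<union> B3) \<le> card (S - (B2 \<union> B3))"
    by (rule diff_card_le_card_Diff) (simp add: fin)
  have "(+) e ` (std ex j - A) \<union> (S - (B2 \<union> B3)) \<subseteq> std ex (Suc j)"
  proof (intro Un_least image_subsetI subsetI)
    fix m assume m: "m \<in> std ex j - A"
    then have lt: "cf m k1 < ex k1 - 1" "\<forall>i. cf m i < ex i"
      by (auto simp: A_def std_iff) (metis One_nat_def Suc_pred ex_pos less_SucE)
    have "\<forall>i. cf (e + m) i < ex i"
      unfolding all_indices using lt distinct_indices by (auto simp: e_def lookup_add lookup_single when_def)
    then show "e + m \<in> std ex (Suc j)" using m by (simp add: std_iff e_def)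
  next
    fix m assume m: "m \<in> S - (B2 \<union> B3)"
    have "\<forall>i. cf m i < ex i"
      unfolding all_indices using m ex_pos[of k1] ex_k4 by (auto simp: B2_def B3_def S_def slice_def)
    then show "m \<in> std ex (Suc j)" using m by (simp add: std_iff S_def slice_def mons_def)
  qed
  then have "card ((+) e ` (std ex j - A) \<union> (S - (B2 \<union> B3))) \<le> card (std ex (Suc j))"
    by (intro card_mono) simp_all
  moreover have "card ((+) e ` (std ex j - A) \<union> (S - (B2 \<union> B3))) =
      card ((+) e ` (std ex j - A)) + card (S - (B2 \<union> B3))"
    by (rule card_Un_disjoint) (auto simp: fin S_def slice_def e_def lookup_add)
  moreover have "card A \<le> card (std ex j)" by (rule card_mono) (auto simp: A_def)
  moreover have "int (card A) \<le> excess (ex k1) (Suc j)" unfolding A_def by (rule card_std_top_excess)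
  moreover have "int (card B2) \<le> excess (ex k2) (Suc j)"
    unfolding B2_def S_def using distinct_indices ex_pos by (intro card_slice_excess) auto
  moreover have "int (card B3) \<le> excess (ex k3) (Suc j)"
    unfolding B3_def S_def using distinct_indices ex_pos by (intro card_slice_excess) auto
  moreover have "card (B2 \<union> B3) \<le> card B2 + card B3" by (rule card_Un_le)
  moreover have "card S = 2 * Suc j + 1" unfolding S_def by (rule card_slice)
  ultimately show ?thesis using 1 2 by linarith
qed

end

section \<open>Existence of functionals\<close>

lemma vector_space_mpoly: "vector_space (\<lambda>c (p :: ('v, 'k::field) mpoly). Const c * p)"
  by unfold_locales (simp_all add: distrib_left distrib_right Const_add Const_mult mult.assoc del: single_zero)

text \<open>A basis of \<open>W\<close> stays independent when the monomials of \<open>T\<close> are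
  adjoined, so the values 0 on the first and the dual basis values on the second extend to linear
  functionals.\<close>

lemma dual_functionals:
  fixes W :: "'k::field poly4 set"
  assumes W: "kspace W" and T: "finite T"
    and indep: "\<And>\<beta>. (\<Sum>n\<in>T. Const (\<beta> n) * Monom n) \<in> W \<Longrightarrow> \<forall>n\<in>T. \<beta> n = 0"
  shows "\<exists>\<phi>. \<forall>n\<in>T. kfunctional (\<phi> n) \<and> (\<forall>w\<in>W. \<phi> n w = 0) \<and> (\<forall>m\<in>T. \<phi> n (Monom m) = (if m = n then 1 else 0))"
proof -
  interpret vs: vector_space "\<lambda>c (p :: 'k poly4). Const c * p" by (rule vector_space_mpoly)
  interpret vk: vector_space "(*) :: 'k \<Rightarrow> 'k \<Rightarrow> 'k" by unfold_locales (simp_all add: algebra_simps)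
  interpret vp: vector_space_pair "\<lambda>c (p :: 'k poly4). Const c * p" "(*) :: 'k \<Rightarrow> 'k \<Rightarrow> 'k" by unfold_locales
  have subW: "vs.subspace W" using W by (auto simp: vs.subspace_def kspace_def)
  obtain B where B: "B \<subseteq> W" "vs.independent B" "W \<subseteq> vs.span B"
    using vs.maximal_independent_subset[of W] by auto
  have spanB: "vs.span B = W" using B subW by (simp add: vs.span_subspace)
  have inj: "inj (Monom :: mon4 \<Rightarrow> 'k poly4)" by (rule injI) (metis cf_Monom zero_neq_one)
  have ind: "vs.independent (B \<union> Monom ` S)" if S: "S \<subseteq> T" for S
    using finite_subset[OF S T] S
  proof (induction S rule: finite_induct)
    case empty
    then show ?case using B by simp
  next
    case (insert n S)
    have "Monom n \<notin> vs.span (B \<union> Monom ` S)"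
    proof
      assume "Monom n \<in> vs.span (B \<union> Monom ` S)"
      then obtain x y where xy: "x \<in> W" "y \<in> vs.span (Monom ` S)" "Monom n = x + y"
        unfolding vs.span_Un spanB by auto
      then obtain u where "y = (\<Sum>v\<in>Monom ` S. Const (u v) * v)"
        using vs.span_finite[of "Monom ` S"] insert.hyps(1) by auto
      then have y: "y = (\<Sum>m\<in>S. Const (u (Monom m)) * Monom m)"
        using inj by (simp add: sum.reindex inj_on_def)
      define \<beta> where "\<beta> m = (if m = n then 1 else if m \<in> S then - u (Monom m) else 0)" for m
      have "(\<Sum>m\<in>T. Const (\<beta> m) * Monom m) = (\<Sum>m\<in>insert n S. Const (\<beta> m) * (Monom m :: 'k poly4))"
        using insert.prems T by (intro sum.mono_neutral_right) (auto simp: \<beta>_def)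
      also have "\<dots> = Monom n + (\<Sum>m\<in>S. Const (\<beta> m) * Monom m)"
        using insert.hyps by (simp add: \<beta>_def)
      also have "(\<Sum>m\<in>S. Const (\<beta> m) * Monom m) = - y"
        unfolding y sum_negf[symmetric] using insert.hyps
        by (intro sum.cong) (auto simp: \<beta>_def single_uminus)
      also have "Monom n + - y = x" using xy(3) by simp
      finally have "(\<Sum>m\<in>T. Const (\<beta> m) * Monom m) \<in> W" using xy(1) by simp
      from indep[OF this] have "\<beta> n = 0" using insert.prems by simp
      then show False by (simp add: \<beta>_def)
    qed
    then show ?case using insert.IH insert.prems by (simp add: vs.independent_insertI)
  qed
  have "\<forall>n\<in>T. \<exists>\<phi>. kfunctional \<phi> \<and> (\<forall>w\<in>W. \<phi> w = 0) \<and> (\<forall>m\<in>T. \<phi> (Monom m) = (if m = n then 1 else 0))"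
  proof
    fix n assume n: "n \<in> T"
    have nB: "Monom m \<notin> B" if m: "m \<in> T" for m
    proof
      assume "Monom m \<in> B"
      then have "(\<Sum>k\<in>T. Const (if k = m then 1 else 0) * Monom k) \<in> W"
        using B(1) m T by (simp add: if_distrib[of Const] if_distrib[of "\<lambda>x. x * _"] cong: if_cong) auto
      from indep[OF this] show False using m by auto
    qed
    obtain f where f: "Vector_Spaces.linear (\<lambda>c (p :: 'k poly4). Const c * p) ((*) :: 'k \<Rightarrow> 'k \<Rightarrow> 'k) f"
      "\<forall>x\<in>B \<union> Monom ` T. f x = (if x = Monom n then 1 else 0)"
      using vp.linear_independent_extend[OF ind[OF order_refl], of "\<lambda>x. if x = Monom n then 1 else 0"] by auto
    interpret f: Vector_Spaces.linear "\<lambda>c (p :: 'k poly4). Const c * p" "(*) :: 'k \<Rightarrow> 'k \<Rightarrow> 'k" f by (rule f(1))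
    have "kfunctional f" by (simp add: kfunctional_def f.add f.scale)
    moreover have "f w = 0" if "w \<in> W" for w
    proof (rule f.eq_0_on_span[of B])
      show "w \<in> vs.span B" using that spanB by simp
      fix x assume "x \<in> B"
      then show "f x = 0" using f(2) nB[OF n] by auto
    qed
    moreover have "f (Monom m) = (if m = n then 1 else 0)" if "m \<in> T" for m
      using f(2) that injD[OF inj, of m n] by auto
    ultimately show "\<exists>\<phi>. kfunctional \<phi> \<and> (\<forall>w\<in>W. \<phi> w = 0) \<and> (\<forall>m\<in>T. \<phi> (Monom m) = (if m = n then 1 else 0))"
      by blast
  qed
  then show ?thesis by (rule bchoice)
qed

section \<open>A change of coordinates with large rank\<close>

context quadric_ci
begin

abbreviation socle :: nat where
  "socle \<equiv> (\<Sum>i\<in>UNIV. ex i - 1)"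

text \<open>In the images, \<open>k1\<close> becomes x1, \<open>k2\<close> becomes x2,
  \<open>k3\<close> becomes x1 - x2 + x3 + x4 and \<open>k4\<close> becomes Z = 2 x1 - 3 x2 + x3.
  With X = x1 and Y = x2 - x1, the images of \<open>k1\<close> and \<open>k2\<close>, the image of
  \<open>k3\<close> modulo x4, and x3 itself are X, X + Y, X + 2Y + Z and X + 3Y + Z.\<close>

definition special :: "'k::field_char_0 ^ 4 ^ 4" where
  "special = (\<chi> i j. if j = k1 then (if i = 0 then 1 else 0) else if j = k2 then (if i = 1 then 1 else 0)
     else if j = k3 then (if i = 1 then - 1 else 1)
     else (if i = 0 then 2 else if i = 1 then - 3 else if i = 2 then 1 else 0))"

text \<open>The coefficients of the linear form that \<open>special\<close> maps to x4. None of them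
  is zero, so \<open>strong_lefschetz\<close> applies to it.\<close>

definition special_form :: "4 \<Rightarrow> 'k::field_char_0" where
  "special_form k = (if k = k2 then - 2 else if k = k4 then - 1 else 1)"

definition special_inv :: "4 \<Rightarrow> 'k::field_char_0 poly4" where
  "special_inv i = (if i = 0 then Var k1 else if i = 1 then Var k2
     else if i = 2 then Var k4 - Const 2 * Var k1 + Const 3 * Var k2 else lform special_form)"

lemma lform_special: "lform special_form = Var k1 - Const 2 * Var k2 + Var k3 - (Var k4 :: 'k::field_char_0 poly4)"
proof -
  have "lform special_form = (\<Sum>k\<in>UNIV. Const (special_form k) * (Var k :: 'k poly4))" by (rule lform_def)
  also have "\<dots> = Const 1 * Var k1 + Const (- 2) * Var k2 + Const 1 * Var k3 + Const (- 1) * Var k4"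
    unfolding sum_indices special_form_def using distinct_indices by simp
  also have "\<dots> = Var k1 - Const 2 * Var k2 + Var k3 - Var k4" by (simp add: single_uminus)
  finally show ?thesis .
qed

lemma special_Var:
  "lin_change special (Var k1) = (Var 0 :: 'k::field_char_0 poly4)"
  "lin_change special (Var k2) = (Var 1 :: 'k poly4)"
  "lin_change special (Var k3) = (Var 0 - Var 1 + Var 2 + Var 3 :: 'k poly4)"
  "lin_change special (Var k4) = (Const 2 * Var 0 - Const 3 * Var 1 + Var 2 :: 'k poly4)"
  unfolding lin_change_Var sum_4 special_def using distinct_indices by (simp_all add: single_uminus)

lemma special_inv_left: "eval_with Const special_inv (lin_change special p) = (p :: 'k::field_char_0 poly4)"
proof -
  have "\<forall>j. eval_with Const special_inv (lin_change special (Var j)) = (Var j :: 'k poly4)"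
    unfolding all_indices special_Var Const.eval_add Const.eval_diff Const.eval_Const_times Const.eval_Var
      special_inv_def lform_special by (simp add: algebra_simps)
  then have "(\<lambda>j. eval_with Const special_inv (lin_change special (Var j))) = (Var :: 4 \<Rightarrow> 'k poly4)" by auto
  then have "(\<lambda>j. eval_with Const special_inv (\<Sum>i\<in>UNIV. Const (special $ i $ j) * Var i)) = (Var :: 4 \<Rightarrow> 'k poly4)"
    unfolding lin_change_Var .
  then show ?thesis unfolding lin_change_def eval_eval by (simp only: eval_Var_self)
qed

lemma special_inv_right: "lin_change special (eval_with Const special_inv p) = (p :: 'k::field_char_0 poly4)"
proof -
  have klin: "lin_change special (a + b) = lin_change special a + lin_change special b"
    "lin_change special (a - b) = lin_change special a - lin_change special b"
    "lin_change special (Const c * a) = Const c * lin_change special a" for a b :: "'k poly4" and c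
    by (simp_all only: klinear_add[OF klinear_lin_change] klinear_diff[OF klinear_lin_change]
        klinear_Const[OF klinear_lin_change])
  have "\<forall>i. lin_change special (special_inv i) = (Var i :: 'k poly4)"
    unfolding all_4 special_inv_def lform_special
    by (simp only: if_True if_False refl index_neq klin special_Var) (simp add: algebra_simps)
  then have "(\<lambda>i. lin_change special (special_inv i)) = (Var :: 4 \<Rightarrow> 'k poly4)" by auto
  then show ?thesis unfolding lin_change_def eval_eval by (simp only: eval_Var_self)
qed

lemma inj_special: "inj (lin_change special :: 'k::field_char_0 poly4 \<Rightarrow> _)"
  by (rule inj_on_inverseI[of _ "eval_with Const special_inv"]) (rule special_inv_left)

lemma special_inv_homog: "v \<in> homog_part j \<Longrightarrow> eval_with Const special_inv v \<in> (homog_part j :: 'k::field_char_0 poly4 set)"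
proof (rule eval_homog)
  fix i
  show "special_inv i \<in> (homog_part 1 :: 'k poly4 set)"
    unfolding special_inv_def
    by (auto intro!: lform_homog homog_part_add homog_part_diff homog_part_Const homog_part_Var simp del: One_nat_def single_numeral)
qed

lemma special_lefschetz:
  fixes v :: "'k::field_char_0 poly4"
  assumes "v \<in> homog_part j" "2 * j + s \<le> socle" "Var 3 ^ s * v \<in> lin_change special ` ideal_span (Monom ` powers ex)"
  shows "v \<in> lin_change special ` ideal_span (Monom ` powers ex)"
proof -
  let ?\<psi> = "eval_with Const special_inv :: 'k poly4 \<Rightarrow> 'k poly4"
  obtain q where q: "q \<in> ideal_span (Monom ` powers ex)" "Var 3 ^ s * v = lin_change special q"
    using assms(3) by auto
  have "lform special_form ^ s * ?\<psi> v = ?\<psi> (Var 3 ^ s * v)"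
    unfolding Const.eval_mult Const.eval_power Const.eval_Var by (simp add: special_inv_def)
  also have "\<dots> = q" unfolding q(2) by (rule special_inv_left)
  finally have mem: "lform special_form ^ s * ?\<psi> v \<in> ideal_span (Monom ` powers ex)" using q(1) by simp
  have "?\<psi> v \<in> ideal_span (Monom ` powers ex)"
    by (rule strong_lefschetz[OF _ ex_pos special_inv_homog[OF assms(1)] assms(2) mem])
      (simp add: special_form_def)
  then have "lin_change special (?\<psi> v) \<in> lin_change special ` ideal_span (Monom ` powers ex)" by (rule imageI)
  then show ?thesis by (simp only: special_inv_right)
qed

section \<open>Rank estimates in the special coordinates\<close>

lemma piece_iff:
  "p \<in> piece (powers ex) g j \<longleftrightarrow> p \<in> homog_part j \<and> p \<in> lin_change g ` ideal_span (Monom ` powers ex)"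
proof
  assume "p \<in> piece (powers ex) g j"
  then obtain q where q: "supp q \<subseteq> powers ex" "p = lin_change g q" and "p \<in> homog_part j"
    using piece_homog[of "powers ex" g j] unfolding piece_def by auto
  moreover have "q \<in> ideal_span (Monom ` powers ex)"
    using q(1) by (simp add: monomial_ideal_up_closed[OF up_closed_powers])
  ultimately show "p \<in> homog_part j \<and> p \<in> lin_change g ` ideal_span (Monom ` powers ex)" by simp
next
  assume p: "p \<in> homog_part j \<and> p \<in> lin_change g ` ideal_span (Monom ` powers ex)"
  then obtain q where q: "supp q \<subseteq> powers ex" "p = lin_change g q"
    by (auto simp: monomial_ideal_up_closed[OF up_closed_powers])
  have "p = hcomp j p" using p by (simp add: hcomp_homog[of p j j])
  also have "\<dots> = lin_change g (hcomp j q)" unfolding q(2) by (rule hcomp_lin_change)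
  finally show "p \<in> piece (powers ex) g j" unfolding piece_def using q(1) by (intro image_eqI) (auto simp: supp_hcomp)
qed

lemma card_mons_inexp:
  assumes "inj (lin_change g)"
  shows "card (mons j - inexp (powers ex) g) = card (std ex j)"
proof -
  have "LM (piece (powers ex) g j) \<subseteq> mons j" by (rule LM_subset[OF piece_homog])
  then have "card (mons j - LM (piece (powers ex) g j)) = card (mons j) - card (powers ex \<inter> mons j)"
    by (simp add: card_Diff_subset finite_subset card_LM_piece[OF assms])
  also have "\<dots> = card (std ex j)"
    unfolding std_def by (simp add: card_Diff_subset_Int Int_commute)
  finally show ?thesis by (simp only: mons_diff_inexp[OF order_refl])
qed

text \<open>Here s = \<open>socle - 2 * i\<close> leads from degree \<open>i\<close> to the dual
  degree \<open>socle - i\<close>, the extreme case of the Lefschetz property. So the standard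
  monomials of degree \<open>i\<close>, multiplied by x4^s, stay independent modulo the transformed
  ideal, and \<open>indep_card_le\<close> counts them in the segment of multiples of x4^s.\<close>

lemma special_rank_1:
  assumes i: "2 * i \<le> socle"
  shows "card (std ex i) \<le> card ({n\<in>mons (socle - i). socle - 2 * i \<le> cf n 3} - inexp (powers ex) (special :: 'k::field_char_0 ^ 4 ^ 4))"
proof -
  let ?g = "special :: 'k ^ 4 ^ 4"
  let ?M = "powers ex"
  define s where "s = socle - 2 * i"
  define e where "e = Poly_Mapping.single (3::4) s"
  define T where "T = mons i - LM (piece ?M ?g i)"
  have deg_s: "i + s = socle - i" using i by (simp add: s_def)
  have seg: "lower_segment (socle - i) {n\<in>mons (socle - i). s \<le> cf n 3}"
    unfolding lower_segment_def by (auto simp: revlex_less_iff mons_def)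
  have sub: "(+) e ` T \<subseteq> {n\<in>mons (socle - i). s \<le> cf n 3}"
    using deg_s by (auto simp: T_def mons_def e_def lookup_add)
  have power: "Var 3 ^ s = (Monom e :: 'k poly4)" unfolding e_def by (rule Var_power)
  have "indep_mod (piece ?M ?g (socle - i)) ((+) e ` T)"
    unfolding indep_mod_def
  proof (intro ballI impI)
    fix p assume p: "p \<in> piece ?M ?g (socle - i)" "supp p \<subseteq> (+) e ` T"
    define v where "v = (\<Sum>n\<in>T. Const (cf p (e + n)) * Monom n)"
    have finT: "finite T" by (simp add: T_def)
    have cfv: "cf v n = (if n \<in> T then cf p (e + n) else 0)" for n
      unfolding v_def by (rule cf_sum_Monom[OF finT])
    have pv: "p = Var 3 ^ s * v"
      unfolding power
    proof (rule poly_mapping_eqI)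
      fix n
      show "cf p n = cf (Monom e * v) n"
      proof (cases "\<exists>k. n = e + k")
        case True
        then obtain k where k: "n = e + k" by auto
        have "cf p (e + k) = 0" if "k \<notin> T"
          using that p(2) by (auto simp: in_keys_iff)
        then show ?thesis by (simp add: k cfv)
      next
        case False
        then have "cf p n = 0" using p(2) by (auto simp: in_keys_iff)
        then show ?thesis using cf_Monom_times_0[of n e v] False by simp
      qed
    qed
    have "supp v \<subseteq> T" by (auto simp: in_keys_iff cfv split: if_splits)
    moreover have vh: "v \<in> homog_part i"
      using \<open>supp v \<subseteq> T\<close> by (auto simp: homog_part_iff T_def)
    moreover have "Var 3 ^ s * v \<in> lin_change ?g ` ideal_span (Monom ` ?M)"
      using p(1) pv by (simp add: piece_iff)
    then have "v \<in> piece ?M ?g i"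
      unfolding piece_iff using special_lefschetz[OF vh, of s] i vh by (simp add: s_def)
    ultimately have "v = 0" using indep_mod_LM[of "piece ?M ?g i" "mons i"] by (simp add: indep_mod_def T_def)
    then show "p = 0" by (simp add: pv)
  qed
  from indep_card_le[OF kspace_piece piece_homog seg sub this]
  have "card T \<le> card ({n\<in>mons (socle - i). s \<le> cf n 3} - LM (piece ?M ?g (socle - i)))"
    by (subst (asm) card_image) (simp_all add: inj_on_def)
  moreover have "card T = card (std ex i)"
    using card_mons_inexp[of ?g i, OF inj_special] mons_diff_inexp[OF order_refl, of i ?M ?g] by (simp add: T_def)
  moreover have "{n\<in>mons (socle - i). s \<le> cf n 3} \<subseteq> mons (socle - i)" by auto
  ultimately show ?thesis by (simp only: mons_diff_inexp s_def)
qed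

text \<open>The powers that vanish at the points 0 to 3: three generators and, as the fourth,
  x3^s.\<close>

definition point_exp :: "nat \<Rightarrow> nat \<Rightarrow> nat" where
  "point_exp s k = (if k = 0 then ex k1 else if k = 1 then ex k2 else if k = 2 then ex k3 else s)"

text \<open>The counted monomials are independent modulo the transformed ideal enlarged by x4 and
  x3^s. Functionals dual to them kill Z^2 and the prescribed powers of the four forms X + kY + c_k
  Z, so \<open>card_functionals_le\<close> bounds their number.\<close>

lemma special_rank_2:
  assumes s: "0 < s" "s \<le> j"
  shows "int (card ((mons j - bsupp j s) - inexp (powers ex) (special :: 'k::field_char_0 ^ 4 ^ 4)))
    \<le> max 0 (2 * int j + 1 - excess (ex k1) j - excess (ex k2) j - excess (ex k3) j - excess s j)"
proof -
  let ?g = "special :: 'k ^ 4 ^ 4"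
  let ?M = "powers ex"
  let ?I = "ideal_span (Monom ` ?M) :: 'k poly4 set"
  define low where "low = {n :: mon4. 0 < cf n 3 \<or> s \<le> cf n 2}"
  define W where "W = {lin_change ?g q + r |q r. q \<in> ?I \<and> supp r \<subseteq> low}"
  define T where "T = (mons j - bsupp j s) - inexp ?M ?g"
  have finT: "finite T" by (simp add: T_def)
  have WI: "\<And>q r. q \<in> ?I \<Longrightarrow> supp r \<subseteq> low \<Longrightarrow> lin_change ?g q + r \<in> W" unfolding W_def by blast
  have W: "kspace W"
    unfolding kspace_def
  proof (intro conjI ballI allI)
    show "0 \<in> W" using WI[of 0 0] by (simp add: ideal_span_0 klinear_0[OF klinear_lin_change])
  next
    fix x y assume "x \<in> W" "y \<in> W"
    then obtain q r q' r' where x: "x = lin_change ?g q + r" "q \<in> ?I" "supp r \<subseteq> low"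
      and y: "y = lin_change ?g q' + r'" "q' \<in> ?I" "supp r' \<subseteq> low" unfolding W_def by auto
    have "lin_change ?g (q + q') + (r + r') \<in> W"
      using x y Poly_Mapping.keys_add[of r r'] by (intro WI ideal_span_add) auto
    moreover have "x + y = lin_change ?g (q + q') + (r + r')"
      unfolding x y by (simp add: klinear_add[OF klinear_lin_change])
    ultimately show "x + y \<in> W" by simp
  next
    fix c x assume "x \<in> W"
    then obtain q r where x: "x = lin_change ?g q + r" "q \<in> ?I" "supp r \<subseteq> low" unfolding W_def by auto
    have "lin_change ?g (Const c * q) + Const c * r \<in> W"
      using x supp_Const_times[of c r] by (intro WI ideal_span_times) auto
    then show "Const c * x \<in> W"
      unfolding x(1) by (simp add: klinear_Const[OF klinear_lin_change] distrib_left)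
  qed
  have indep: "\<forall>n\<in>T. \<beta> n = 0" if mem: "(\<Sum>n\<in>T. Const (\<beta> n) * Monom n) \<in> W" for \<beta>
  proof -
    define f where "f = (\<Sum>n\<in>T. Const (\<beta> n) * (Monom n :: 'k poly4))"
    have cff: "cf f n = (if n \<in> T then \<beta> n else 0)" for n
      unfolding f_def by (rule cf_sum_Monom[OF finT])
    obtain q r where qr: "f = lin_change ?g q + r" "q \<in> ?I" "supp r \<subseteq> low"
      using mem unfolding f_def[symmetric] W_def by (elim CollectE exE conjE) (rule that)
    define p where "p = hcomp j (lin_change ?g q)"
    have fh: "hcomp j f = f"
      by (rule poly_mapping_eqI) (auto simp: cf_hcomp cff T_def mons_def)
    have p: "p = f - hcomp j r"
      using arg_cong[OF qr(1), of "hcomp j"] by (simp add: fh p_def klinear_add[OF klinear_hcomp])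
    have "p = lin_change ?g (hcomp j q)" unfolding p_def by (rule hcomp_lin_change)
    moreover have "supp q \<subseteq> ?M" using qr(2) by (simp add: monomial_ideal_up_closed[OF up_closed_powers])
    then have "supp (hcomp j q) \<subseteq> ?M \<inter> mons j" by (auto simp: supp_hcomp)
    ultimately have pp: "p \<in> piece ?M ?g j" unfolding piece_def by blast
    have supr: "supp (hcomp j r) \<subseteq> bsupp j s" using qr(3) by (auto simp: supp_hcomp bsupp_def low_def)
    have "f = 0"
    proof (rule ccontr)
      assume "f \<noteq> 0"
      have fT: "supp f \<subseteq> T" by (auto simp: in_keys_iff cff split: if_splits)
      have lf: "lead_monom f \<in> supp f" by (rule lead_monom_in[OF \<open>f \<noteq> 0\<close>])
      then have lT: "lead_monom f \<in> T" using fT by blast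
      have rz: "cf (hcomp j r) n = 0" if "n \<in> T" for n
        using that supr by (auto simp: T_def in_keys_iff)
      \<comment> \<open>Every monomial of \<open>bsupp j s\<close> is smaller than every monomial
        outside it, so subtracting the part in x4 and x3^s cannot change the leading
        monomial.\<close>
      have "lead_monom p = lead_monom f"
      proof (rule lead_monom_eqI)
        show "lead_monom f \<in> supp p" using lf rz[OF lT] by (simp add: p in_keys_iff lookup_minus)
        fix n assume n: "n \<in> supp p" "n \<noteq> lead_monom f"
        then have "n \<in> supp f \<or> n \<in> bsupp j s" using supp_diff[of f "hcomp j r"] supr p by auto
        then show "revlex_less n (lead_monom f)"
        proof
          assume "n \<in> supp f"
          then show ?thesis using lead_monom_max[OF \<open>f \<noteq> 0\<close>] n(2) by simp
        next
          assume "n \<in> bsupp j s"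
          then show ?thesis using lT by (auto simp: T_def bsupp_def mons_def revlex_less_iff)
        qed
      qed
      moreover have "p \<noteq> 0" using lf rz[OF lT] by (auto simp: p in_keys_iff lookup_minus)
      ultimately have "lead_monom f \<in> LM (piece ?M ?g j)" using pp unfolding LM_def by (intro CollectI exI[of _ p]) simp
      then have "lead_monom f \<in> inexp ?M ?g" using inexp_mons[of ?M ?g j] by blast
      then show False using lT by (simp add: T_def)
    qed
    then show ?thesis using cff by (metis lookup_zero)
  qed
  from dual_functionals[OF W finT indep] obtain \<phi> where
    \<phi>: "\<And>n. n \<in> T \<Longrightarrow> kfunctional (\<phi> n)" "\<And>n w. n \<in> T \<Longrightarrow> w \<in> W \<Longrightarrow> \<phi> n w = 0"
      "\<And>n m. n \<in> T \<Longrightarrow> m \<in> T \<Longrightarrow> \<phi> n (Monom m) = (if m = n then 1 else 0)" by auto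
  define X where "X = (Var 0 :: 'k poly4)"
  define Y where "Y = (Var 1 - Var 0 :: 'k poly4)"
  define Z where "Z = lin_change ?g (Var k4)"
  have killI: "lin_change ?g (Var k) ^ ex k * r \<in> W" for k r
  proof -
    have "Var k ^ ex k \<in> ?I"
      unfolding Var_power by (intro ideal_span_base imageI) (auto simp: powers_def intro!: exI[of _ k])
    then have "eval_with Const special_inv r * Var k ^ ex k \<in> ?I" by (rule ideal_span_times)
    from WI[OF this, of 0] have "lin_change ?g (eval_with Const special_inv r * Var k ^ ex k) \<in> W" by simp
    moreover have "lin_change ?g (Var k ^ ex k) = lin_change ?g (Var k) ^ ex k"
      unfolding lin_change_def by (rule Const.eval_power)
    ultimately show ?thesis by (simp add: lin_change_mult special_inv_right mult.commute)
  qed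
  have killlow: "Monom m * r \<in> W" if "0 < cf m 3 \<or> s \<le> cf m 2" for m r
  proof -
    have "supp (Monom m * r) \<subseteq> low" using that by (auto simp: supp_Monom_times low_def lookup_add)
    from WI[OF ideal_span_0 this] show ?thesis by (simp add: klinear_0[OF klinear_lin_change])
  qed
  have L2: "X + Const 1 * Y = lin_change ?g (Var k2)" unfolding special_Var X_def Y_def by simp
  have Zeq: "Z = Const 2 * Var 0 - Const 3 * Var 1 + Var 2" unfolding Z_def by (rule special_Var(4))
  have L3: "X + Const 2 * Y + Const 1 * Z = lin_change ?g (Var k3) - Var 3"
    unfolding special_Var(3) X_def Y_def Zeq by (simp add: algebra_simps)
  have L4: "X + Const 3 * Y + Const 1 * Z = Var 2"
    unfolding X_def Y_def Zeq by (simp add: algebra_simps)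
  have killL: "(X + Const (of_nat k) * Y + Const (point_c k) * Z) ^ point_exp s k * r \<in> W" if k: "k < 4" for k r
  proof -
    from k have "k = 0 \<or> k = 1 \<or> k = 2 \<or> k = 3" by linarith
    then consider "k = 0" | "k = 1" | "k = 2" | "k = 3" by blast
    then show ?thesis
    proof cases
      case 1
      have "X + Const (of_nat k) * Y + Const (point_c k) * Z = lin_change ?g (Var k1)" "point_exp s k = ex k1"
        unfolding special_Var using 1 by (simp_all add: X_def point_c_def point_exp_def)
      then show ?thesis using killI[of k1 r] by (simp only:)
    next
      case 2
      have "X + Const (of_nat k) * Y + Const (point_c k) * Z = lin_change ?g (Var k2)" "point_exp s k = ex k2"
        unfolding L2[symmetric] using 2 by (simp_all add: point_c_def point_exp_def)
      then show ?thesis using killI[of k2 r] by (simp only:)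
    next
      case 3
      \<comment> \<open>The image of \<open>k3\<close> is the third form only up to x4. The powers
        differ by a multiple of x4, which lies in \<open>W\<close>.\<close>
      obtain u where u: "(lin_change ?g (Var k3) - Var 3) ^ ex k3 = lin_change ?g (Var k3) ^ ex k3 -
          of_nat (ex k3) * lin_change ?g (Var k3) ^ (ex k3 - 1) * Var 3 + Var 3 ^ 2 * u"
        using diff_power_mod_square by metis
      have "(lin_change ?g (Var k3) - Var 3) ^ ex k3 * r = lin_change ?g (Var k3) ^ ex k3 * r +
          Var 3 * (Var 3 * u * r - of_nat (ex k3) * lin_change ?g (Var k3) ^ (ex k3 - 1) * r)"
        unfolding u by (simp add: algebra_simps power2_eq_square)
      also have "\<dots> \<in> W" by (intro kspace_add[OF W] killI killlow) simp
      finally have mem: "(lin_change ?g (Var k3) - Var 3) ^ ex k3 * r \<in> W" .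
      have "X + Const (of_nat k) * Y + Const (point_c k) * Z = lin_change ?g (Var k3) - Var 3" "point_exp s k = ex k3"
        unfolding L3[symmetric] using 3 by (simp_all add: point_c_def point_exp_def)
      then show ?thesis using mem by (simp only:)
    next
      case 4
      have mem: "Var 2 ^ s * r \<in> W" unfolding Var_power by (intro killlow) simp
      have "X + Const (of_nat k) * Y + Const (point_c k) * Z = Var 2" "point_exp s k = s"
        unfolding L4[symmetric] using 4 by (simp_all add: point_c_def point_exp_def)
      then show ?thesis using mem by (simp only:)
    qed
  qed
  have Z2: "Z ^ 2 * r \<in> W" for r using killI[of k4 r] ex_k4 by (simp add: Z_def)
  \<comment> \<open>The forms X, Y, Z span x1, x2, x3, and multiples of Z^2 are killed. So the
    values on products of X and Y with at most one Z determine a functional on all monomials of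
    \<open>T\<close>, where the functionals are dual.\<close>
  have final: "\<forall>n\<in>T. \<alpha> n = 0"
    if \<alpha>: "\<And>k. (\<Sum>n\<in>T. \<alpha> n * \<phi> n (X ^ (j - k) * Y ^ k)) = 0 \<or> j < k"
      "\<And>k. (\<Sum>n\<in>T. \<alpha> n * \<phi> n (X ^ (j - 1 - k) * Y ^ k * Z)) = 0 \<or> j - 1 < k" for \<alpha>
  proof -
    define \<Phi> where "\<Phi> p = (\<Sum>n\<in>T. \<alpha> n * \<phi> n p)" for p
    have \<Phi>: "kfunctional \<Phi>"
      unfolding kfunctional_def \<Phi>_def
      by (simp add: kfunctional_add[OF \<phi>(1)] kfunctional_Const[OF \<phi>(1)] distrib_left sum.distrib
          sum_distrib_left mult.left_commute)
    have \<Phi>W: "\<Phi> w = 0" if "w \<in> W" for w unfolding \<Phi>_def using \<phi>(2) that by simp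
    have mono: "\<Phi> (X ^ a * Y ^ b * Z ^ c) = 0" if abc: "a + b + c = j" for a b c
    proof -
      have "c = 0 \<or> c = 1 \<or> c = (c - 2) + 2" by linarith
      then consider "c = 0" | "c = 1" | d where "c = d + 2" by blast
      then show ?thesis
      proof cases
        case 1
        then show ?thesis using \<alpha>(1)[of b] abc by (auto simp: \<Phi>_def)
      next
        case 2
        then show ?thesis using \<alpha>(2)[of b] abc by (auto simp: \<Phi>_def)
      next
        case 3
        have eq: "X ^ a * Y ^ b * Z ^ c = Z ^ 2 * (X ^ a * Y ^ b * Z ^ d)"
          by (simp add: 3 power_add mult_ac power2_eq_square)
        show ?thesis unfolding eq by (rule \<Phi>W[OF Z2])
      qed
    qed
    \<comment> \<open>A degree by degree substitute for expanding: one factor of the test monomial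
      is moved into \<open>p\<close> at a time, until \<open>p\<close> is a monomial in x1, x2, x3
      of full degree \<open>j\<close>.\<close>
    define Kill where "Kill d = {p. \<forall>a b c. a + b + c + d = j \<longrightarrow> \<Phi> (p * (X ^ a * Y ^ b * Z ^ c)) = 0}" for d
    have K0: "1 \<in> Kill 0" using mono by (simp add: Kill_def)
    have Kadd: "p + q \<in> Kill d" if "p \<in> Kill d" "q \<in> Kill d" for p q d
      using that by (simp add: Kill_def distrib_right kfunctional_add[OF \<Phi>])
    have Kc: "Const c * p \<in> Kill d" if "p \<in> Kill d" for p c d
      using that by (simp add: Kill_def mult.assoc kfunctional_Const[OF \<Phi>])
    have KX: "p * X \<in> Kill (Suc d)" if "p \<in> Kill d" for p d
      unfolding Kill_def
    proof (intro CollectI allI impI)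
      fix a b c assume abc: "a + b + c + Suc d = j"
      from that have "\<forall>a b c. a + b + c + d = j \<longrightarrow> \<Phi> (p * (X ^ a * Y ^ b * Z ^ c)) = 0" by (simp add: Kill_def)
      from this[rule_format, of "Suc a" b c] abc have 0: "\<Phi> (p * (X ^ Suc a * Y ^ b * Z ^ c)) = 0" by simp
      have "p * X * (X ^ a * Y ^ b * Z ^ c) = p * (X ^ Suc a * Y ^ b * Z ^ c)" by (simp only: power_Suc mult_ac)
      with 0 show "\<Phi> (p * X * (X ^ a * Y ^ b * Z ^ c)) = 0" by (simp only:)
    qed
    have KY: "p * Y \<in> Kill (Suc d)" if "p \<in> Kill d" for p d
      unfolding Kill_def
    proof (intro CollectI allI impI)
      fix a b c assume abc: "a + b + c + Suc d = j"
      from that have "\<forall>a b c. a + b + c + d = j \<longrightarrow> \<Phi> (p * (X ^ a * Y ^ b * Z ^ c)) = 0" by (simp add: Kill_def)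
      from this[rule_format, of a "Suc b" c] abc have 0: "\<Phi> (p * (X ^ a * Y ^ Suc b * Z ^ c)) = 0" by simp
      have "p * Y * (X ^ a * Y ^ b * Z ^ c) = p * (X ^ a * Y ^ Suc b * Z ^ c)" by (simp only: power_Suc mult_ac)
      with 0 show "\<Phi> (p * Y * (X ^ a * Y ^ b * Z ^ c)) = 0" by (simp only:)
    qed
    have KZ: "p * Z \<in> Kill (Suc d)" if "p \<in> Kill d" for p d
      unfolding Kill_def
    proof (intro CollectI allI impI)
      fix a b c assume abc: "a + b + c + Suc d = j"
      from that have "\<forall>a b c. a + b + c + d = j \<longrightarrow> \<Phi> (p * (X ^ a * Y ^ b * Z ^ c)) = 0" by (simp add: Kill_def)
      from this[rule_format, of a b "Suc c"] abc have 0: "\<Phi> (p * (X ^ a * Y ^ b * Z ^ Suc c)) = 0" by simp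
      have "p * Z * (X ^ a * Y ^ b * Z ^ c) = p * (X ^ a * Y ^ b * Z ^ Suc c)" by (simp only: power_Suc mult_ac)
      with 0 show "\<Phi> (p * Z * (X ^ a * Y ^ b * Z ^ c)) = 0" by (simp only:)
    qed
    have v0: "(Var 0 :: 'k poly4) = X" by (simp add: X_def)
    have v1: "(Var 1 :: 'k poly4) = X + Y" unfolding X_def Y_def by simp
    have v2: "(Var 2 :: 'k poly4) = X + Const 3 * Y + Z" using L4 by simp
    have K0n: "p * Var 0 ^ n \<in> Kill (d + n)" if "p \<in> Kill d" for p d n
    proof (induction n)
      case (Suc n)
      have "p * Var 0 ^ n * X \<in> Kill (Suc (d + n))" by (rule KX[OF Suc])
      then show ?case unfolding v0 by (simp add: mult_ac)
    qed (simp add: that)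
    have K1n: "p * Var 1 ^ n \<in> Kill (d + n)" if "p \<in> Kill d" for p d n
    proof (induction n)
      case (Suc n)
      have "p * Var 1 ^ n * X + p * Var 1 ^ n * Y \<in> Kill (Suc (d + n))"
        by (intro Kadd KX KY Suc)
      then show ?case unfolding v1 by (simp add: algebra_simps)
    qed (simp add: that)
    have K2n: "p * Var 2 ^ n \<in> Kill (d + n)" if "p \<in> Kill d" for p d n
    proof (induction n)
      case (Suc n)
      have "p * Var 2 ^ n * X + Const 3 * (p * Var 2 ^ n * Y) + p * Var 2 ^ n * Z \<in> Kill (Suc (d + n))"
        by (intro Kadd Kc KX KY KZ Suc)
      moreover have "p * Var 2 ^ n * X + Const 3 * (p * Var 2 ^ n * Y) + p * Var 2 ^ n * Z = p * Var 2 ^ Suc n"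
      proof -
        have "q * X + Const 3 * (q * Y) + q * Z = q * (X + Const 3 * Y + Z)" for q
          by (simp only: distrib_left mult.left_commute)
        from this[of "p * Var 2 ^ n"] show ?thesis unfolding v2[symmetric] power_Suc2 mult.assoc .
      qed
      ultimately show ?case by simp
    qed (simp add: that)
    show ?thesis
    proof
      fix m assume m: "m \<in> T"
      then have mj: "cf m 3 = 0" "cf m 0 + cf m 1 + cf m 2 = j"
        by (auto simp: T_def bsupp_def mons_def mdeg_eq)
      have "1 * Var 0 ^ cf m 0 * Var 1 ^ cf m 1 * Var 2 ^ cf m 2 \<in> Kill (0 + cf m 0 + cf m 1 + cf m 2)"
        by (intro K0n K1n K2n K0)
      moreover have "1 * Var 0 ^ cf m 0 * Var 1 ^ cf m 1 * Var 2 ^ cf m 2 = (Monom m :: 'k poly4)"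
        unfolding Monom_eq_prod[of m] prod_4 mj(1) by simp
      ultimately have "Monom m \<in> Kill j" using mj(2) by simp
      then have "\<forall>a b c. a + b + c + j = j \<longrightarrow> \<Phi> (Monom m * (X ^ a * Y ^ b * Z ^ c)) = 0" by (simp add: Kill_def)
      from this[rule_format, of 0 0 0] have "\<Phi> (Monom m) = 0" by simp
      moreover have "\<Phi> (Monom m) = (\<Sum>n\<in>T. if m = n then \<alpha> n else 0)"
        unfolding \<Phi>_def using m by (intro sum.cong) (auto simp: \<phi>(3))
      ultimately show "\<alpha> m = 0" using finT m by simp
    qed
  qed
  have "int (card T) \<le> max 0 (2 * (int j - (\<Sum>k<4. int (j - point_exp s k))) + 1 -
      int (card {k. k < 4 \<and> point_exp s k \<le> j}))"
  proof (rule card_functionals_le[OF finT \<phi>(1)])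
    show "\<phi> n (Z ^ 2 * r) = 0" if "n \<in> T" for n r using \<phi>(2)[OF that Z2] .
    show "\<phi> n ((X + Const (of_nat k) * Y + Const (point_c k) * Z) ^ point_exp s k * r) = 0"
      if "n \<in> T" "k < 4" for n r k using \<phi>(2)[OF that(1) killL[OF that(2)]] .
    show "0 < point_exp s k" if "k < 4" for k using s ex_pos by (simp add: point_exp_def)
    show "point_exp s 3 \<le> j" using s by (simp add: point_exp_def)
    show "\<forall>n\<in>T. \<alpha> n = 0"
      if "\<And>k. (\<Sum>n\<in>T. \<alpha> n * \<phi> n (X ^ (j - k) * Y ^ k)) = 0 \<or> j < k"
        "\<And>k. (\<Sum>n\<in>T. \<alpha> n * \<phi> n (X ^ (j - 1 - k) * Y ^ k * Z)) = 0 \<or> j - 1 < k" for \<alpha>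
      using that by (rule final)
  qed
  also have "2 * (int j - (\<Sum>k<4. int (j - point_exp s k))) + 1 - int (card {k. k < 4 \<and> point_exp s k \<le> j}) =
      2 * int j + 1 - (\<Sum>k<4. excess (point_exp s k) j)"
  proof -
    have "int (card {k. k < 4 \<and> point_exp s k \<le> j}) = (\<Sum>k<4. if point_exp s k \<le> j then 1 else 0)"
    proof -
      have "{k. k < 4 \<and> point_exp s k \<le> j} = {k\<in>{..<4}. point_exp s k \<le> j}" by auto
      then show ?thesis by (simp add: sum.If_cases Int_def)
    qed
    moreover have "(\<Sum>k<4. excess (point_exp s k) j) =
        (\<Sum>k<4. 2 * int (j - point_exp s k) + (if point_exp s k \<le> j then 1 else 0))"
      by (intro sum.cong) (auto simp: excess_def)
    ultimately show ?thesis by (simp add: sum.distrib sum_distrib_left)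
  qed
  also have "(\<Sum>k<4. excess (point_exp s k) j) = excess (ex k1) j + excess (ex k2) j + excess (ex k3) j + excess s j"
    by (simp add: numeral_eq_Suc point_exp_def)
  finally show ?thesis by (simp add: T_def algebra_simps)
qed

end

section \<open>Initial exponents of generic coordinates\<close>

lemma bsupp_lower_segment: "lower_segment j (bsupp j s)"
  unfolding lower_segment_def bsupp_def by (auto simp: revlex_less_iff mons_def)

context quadric_ci
begin

lemma card_std_increase:
  shows "int (card (std ex j)) \<ge> 2 * int j + 1 - excess (ex k1) j - excess (ex k2) j - excess (ex k3) j +
    int (if j = 0 then 0 else card (std ex (j - 1)))"
proof (cases j)
  case 0
  have "excess (ex k) 0 = 0" for k using ex_pos[of k] by (simp add: excess_def)
  then show ?thesis using 0 card_std_0 by simp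
next
  case (Suc i)
  then show ?thesis using card_std_ge[of i] by simp
qed

text \<open>In the generic case the standard monomials form strings \<open>n, n x\<^sub>4, n x\<^sub>4\<^sup>2, \<dots>\<close> that are
  symmetric about half the socle degree. So a minimal generator divisible by \<open>x\<^sub>4\<close> kills a string at
  its symmetric end, where only monomials with larger \<open>x\<^sub>4\<close>-exponent survive. The generators free of
  \<open>x\<^sub>4\<close> are handled by counting in the same way for \<open>x\<^sub>3\<close>, and by the Borel move.\<close>

lemma generic_almost_revlex:
  fixes E :: "mon4 set"
  assumes E: "up_closed E"
    and card: "\<And>j. card (mons j - E) = card (std ex j)"
    and rank1: "\<And>i. 2 * i \<le> socle \<Longrightarrow>
      card (std ex i) \<le> card ({n\<in>mons (socle - i). socle - 2 * i \<le> cf n 3} - E)"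
    and rank2: "\<And>j s. 0 < s \<Longrightarrow> s \<le> j \<Longrightarrow> j \<le> socle \<Longrightarrow> int (card ((mons j - bsupp j s) - E))
      \<le> max 0 (2 * int j + 1 - excess (ex k1) j - excess (ex k2) j - excess (ex k3) j - excess s j)"
    and borel: "\<And>m m'. m \<in> E \<Longrightarrow> cf m 3 = 0 \<Longrightarrow> cf m' 3 = 0 \<Longrightarrow> cf m' 2 = cf m 2 \<Longrightarrow> mdeg m' = mdeg m \<Longrightarrow>
      cf m' 1 < cf m 1 \<Longrightarrow> m' \<in> E"
    and u: "u \<in> E" "\<And>g k. g \<in> E \<Longrightarrow> u = g + k \<Longrightarrow> k = 0"
    and v: "mdeg v = mdeg u" "revlex_less u v"
  shows "v \<in> E"
proof (rule ccontr)
  assume vE: "v \<notin> E"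
  let ?e = "\<lambda>i n. Poly_Mapping.single (i::4) (n::nat)"
  define j where "j = mdeg u"
  have vj: "v \<in> mons j" "u \<in> mons j" using v by (simp_all add: mons_def j_def)
  have jc: "j \<le> socle"
  proof (rule ccontr)
    assume "\<not> j \<le> socle"
    then have "card (mons j - E) = 0" using std_empty[of ex j] card by simp
    then show False using vj vE by auto
  qed
  \<comment> \<open>By the symmetry of the Hilbert function the multiples of the power of x4 already
    account for all standard monomials of the dual degree.\<close>
  have A1: "socle - 2 * i \<le> cf n 3" if i: "2 * i \<le> socle" and n: "n \<in> mons (socle - i) - E" for i n
  proof -
    let ?N = "{n\<in>mons (socle - i). socle - 2 * i \<le> cf n 3}"
    have "?N - E = mons (socle - i) - E"
    proof (rule card_subset_eq)
      show "finite (mons (socle - i) - E)" by simp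
      show "?N - E \<subseteq> mons (socle - i) - E" by auto
      have "card (mons (socle - i) - E) = card (std ex i)"
        unfolding card using i by (intro card_std_symmetric[OF ex_pos refl]) simp
      moreover have "card (?N - E) \<le> card (mons (socle - i) - E)" by (intro card_mono) auto
      ultimately show "card (?N - E) = card (mons (socle - i) - E)" using rank1[OF i] by simp
    qed
    then show ?thesis using n by auto
  qed
  \<comment> \<open>Dividing by the power of x4 is injective between sets of equal size, hence onto:
    every standard monomial of degree \<open>i\<close> starts a segment of a string that reaches
    degree \<open>socle - i\<close>.\<close>
  have A2: "n + ?e 3 (socle - 2 * i) \<notin> E" if i: "2 * i \<le> socle" and n: "n \<in> mons i - E" for i n
  proof -
    define s where "s = socle - 2 * i"
    have le: "s \<le> cf m 3" if "m \<in> mons (socle - i) - E" for m using A1[OF i that] by (simp add: s_def)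
    have "(\<lambda>m. m - ?e 3 s) ` (mons (socle - i) - E) = mons i - E"
    proof (rule card_subset_eq)
      show "finite (mons i - E)" by simp
      show "(\<lambda>m. m - ?e 3 s) ` (mons (socle - i) - E) \<subseteq> mons i - E"
      proof (rule image_subsetI)
        fix m assume m: "m \<in> mons (socle - i) - E"
        have "mdeg m = s + mdeg (m - ?e 3 s)" using le[OF m] by (rule mdeg_minus_single)
        moreover have "mdeg m = socle - i" using m by (simp add: mons_def)
        ultimately have "mdeg (m - ?e 3 s) = i" using i by (simp add: s_def)
        moreover have "m - ?e 3 s \<notin> E" using m le[OF m] by (intro up_closed_minus_single[OF E]) auto
        ultimately show "m - ?e 3 s \<in> mons i - E" by (simp add: mons_def)
      qed
      have "inj_on (\<lambda>m. m - ?e 3 s) (mons (socle - i) - E)" using le by (rule inj_on_minus_single)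
      then have "card ((\<lambda>m. m - ?e 3 s) ` (mons (socle - i) - E)) = card (std ex (socle - i))"
        by (simp add: card_image card)
      also have "\<dots> = card (mons i - E)"
        unfolding card using i by (intro card_std_symmetric[OF ex_pos refl]) simp
      finally show "card ((\<lambda>m. m - ?e 3 s) ` (mons (socle - i) - E)) = card (mons i - E)" .
    qed
    with n obtain m where m: "m \<in> mons (socle - i) - E" "n = m - ?e 3 s" by auto
    have "n + ?e 3 s = m" using single_factor[OF le[OF m(1)]] m(2) by (simp add: add.commute)
    then show ?thesis using m(1) by (simp add: s_def)
  qed
  have A2': "n + ?e 3 t \<notin> E" if i: "2 * i + t \<le> socle" and n: "n \<in> mons i - E" for i t n
  proof
    assume "n + ?e 3 t \<in> E"
    then have "(n + ?e 3 t) + ?e 3 (socle - 2 * i - t) \<in> E" by (rule up_closedD[OF E])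
    moreover have "(n + ?e 3 t) + ?e 3 (socle - 2 * i - t) = n + ?e 3 (socle - 2 * i)"
      using i by (simp add: add.assoc flip: single_add)
    ultimately show False using A2[OF _ n] i by simp
  qed
  have minimal: "u - ?e i t \<notin> E" "u = u - ?e i t + ?e i t" if "0 < t" "t \<le> cf u i" for i t
  proof -
    show eq: "u = u - ?e i t + ?e i t" using single_factor[OF that(2)] by (simp add: add.commute)
    show "u - ?e i t \<notin> E"
    proof
      assume "u - ?e i t \<in> E"
      from u(2)[OF this eq] have "mdeg (?e i t) = 0" by simp
      then show False using that(1) by (simp only: mdeg_single)
    qed
  qed
  have v3: "cf v 3 \<le> cf u 3" using v by (auto simp: revlex_less_iff)
  show False
  proof (cases "cf u 3 = 0")
    case False
    define t where "t = cf u 3"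
    define i where "i = j - t"
    have tj: "t \<le> j" by (simp add: t_def j_def mdeg_eq)
    have t: "0 < t" "t \<le> cf u 3" using False by (simp_all add: t_def)
    have "mdeg u = t + mdeg (u - ?e 3 t)" using t(2) by (rule mdeg_minus_single)
    then have ui: "u - ?e 3 t \<in> mons i - E"
      using minimal(1)[OF t] by (simp add: mons_def i_def j_def)
    have "\<not> 2 * i + t \<le> socle"
      using A2'[OF _ ui, of t] u(1) unfolding minimal(2)[OF t, symmetric] by blast
    then have it: "socle < 2 * i + t" by simp
    \<comment> \<open>By \<open>it\<close> and j = i + t, this lower bound 2j - \<open>socle\<close>
      exceeds t, whereas \<open>v\<close> is larger than \<open>u\<close> and so has x4-exponent at
      most t.\<close>
    have "socle - 2 * (socle - j) \<le> cf v 3"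
      using vj vE jc it tj by (intro A1) (auto simp: i_def)
    then have "t < cf v 3" using it jc tj unfolding i_def by linarith
    then show False using v3 by (simp add: t_def)
  next
    case True
    have v3: "cf v 3 = 0" using v3 True by simp
    \<comment> \<open>Above the middle degree \<open>A1\<close> would force x4 to divide the
      standard monomial \<open>v\<close>.\<close>
    have half: "2 * j \<le> socle"
    proof (rule ccontr)
      assume "\<not> 2 * j \<le> socle"
      moreover from this have "socle - 2 * (socle - j) \<le> cf v 3"
        using vj vE jc by (intro A1) auto
      ultimately show False using v3 jc by linarith
    qed
    define r where "r = cf u 2"
    have vr: "cf v 2 \<le> r" using v v3 True by (auto simp: revlex_less_iff r_def)
    show False
    proof (cases "cf v 2 = r")
      case eq: True
      then have "cf v 1 < cf u 1" using v v3 True by (auto simp: revlex_less_iff r_def)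
      then have "v \<in> E" using u(1) True v3 eq v(1) by (intro borel[of u v]) (simp_all add: r_def)
      then show False using vE by simp
    next
      case False
      then have r: "0 < r" "r \<le> cf u 2" "cf v 2 < r" using vr by (simp_all add: r_def)
      have rj: "r \<le> j" by (simp add: r_def j_def mdeg_eq)
      define B where "B i = {n\<in>mons i - E. cf n 3 = 0}" for i
      have finB: "finite (B i)" for i by (simp add: B_def)
      define S1 where "S1 = (mons j - bsupp j r) - E"
      define S2 where "S2 = {n\<in>B j. r \<le> cf n 2}"
      have "v \<in> S1" using vj vE v3 r by (simp add: S1_def bsupp_def)
      then have "0 < card S1" by (auto simp: S1_def card_gt_0_iff)
      \<comment> \<open>The monomial \<open>v\<close> makes \<open>S1\<close> nonempty, so the
        maximum in \<open>rank2\<close> is not attained by 0 alone and the other term bounds the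
        count.\<close>
      then have S1: "int (card S1) \<le> 2 * int j + 1 - excess (ex k1) j - excess (ex k2) j - excess (ex k3) j - excess r j"
        using rank2[OF r(1) rj jc] by (simp add: S1_def)
      have "S1 \<inter> S2 = {}" "S1 \<union> S2 = B j" by (auto simp: S1_def S2_def B_def bsupp_def)
      then have BS: "card (B j) = card S1 + card S2"
        using card_Un_disjoint[of S1 S2] by (simp add: S1_def S2_def finB)
      have Bdiff: "card (mons i - E) = card (B i) + card {n\<in>mons i - E. 0 < cf n 3}" for i
      proof -
        have "mons i - E = B i \<union> {n\<in>mons i - E. 0 < cf n 3}" by (auto simp: B_def)
        then have "card (mons i - E) = card (B i \<union> {n\<in>mons i - E. 0 < cf n 3})" by (rule arg_cong)
        also have "\<dots> = card (B i) + card {n\<in>mons i - E. 0 < cf n 3}"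
          by (rule card_Un_disjoint) (auto simp: B_def)
        finally show ?thesis .
      qed
      \<comment> \<open>Multiples of x4 are at most as many as the standard monomials one degree
        lower, so the lower bound on the growth of the Hilbert function passes to
        \<open>B j\<close>.\<close>
      have A5: "int (card (B j)) \<ge> 2 * int j + 1 - excess (ex k1) j - excess (ex k2) j - excess (ex k3) j"
      proof -
        have "card {n\<in>mons j - E. 0 < cf n 3} \<le> (if j = 0 then 0 else card (std ex (j - 1)))"
        proof (cases j)
          case 0
          then have "{n\<in>mons j - E. 0 < cf n 3} = {}" by (auto simp: mons_def)
          then show ?thesis by (simp only: card.empty)
        next
          case (Suc i)
          have "card {n\<in>mons j - E. 0 < cf n 3} \<le> card (mons i - E)"
          proof (rule card_inj_on_le[of "\<lambda>m. m - ?e 3 1"])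
            show "inj_on (\<lambda>m. m - ?e 3 1) {n\<in>mons j - E. 0 < cf n 3}" by (rule inj_on_minus_single) auto
            show "(\<lambda>m. m - ?e 3 1) ` {n\<in>mons j - E. 0 < cf n 3} \<subseteq> mons i - E"
            proof (rule image_subsetI)
              fix m assume m: "m \<in> {n\<in>mons j - E. 0 < cf n 3}"
              then have "mdeg m = 1 + mdeg (m - ?e 3 1)" by (intro mdeg_minus_single) simp
              moreover have "mdeg m = Suc i" using m Suc by (simp add: mons_def)
              ultimately have "mdeg (m - ?e 3 1) = i" by linarith
              moreover have "m - ?e 3 1 \<notin> E" using m by (intro up_closed_minus_single[OF E]) auto
              ultimately show "m - ?e 3 1 \<in> mons i - E" by (simp add: mons_def)
            qed
          qed simp
          then show ?thesis using Suc card[of i] by simp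
        qed
        then show ?thesis using Bdiff[of j] card[of j] card_std_increase[of j] by linarith
      qed
      \<comment> \<open>Up to the middle degree multiplication by x4 is injective on standard
        monomials, so the growth of the Hilbert function bounds \<open>B i\<close> from
        above.\<close>
      have A6: "int (card (B i)) \<le> 2 * int i + 1" if i: "2 * i \<le> socle" for i
      proof (cases i)
        case 0
        have "card (B i) \<le> card (mons i - E)" by (intro card_mono) (auto simp: B_def)
        then show ?thesis using 0 card[of 0] card_std_0 by simp
      next
        case (Suc i')
        have "card (mons i' - E) \<le> card {n\<in>mons i - E. 0 < cf n 3}"
        proof (rule card_inj_on_le[of "\<lambda>m. m + ?e 3 1"])
          show "inj_on (\<lambda>m. m + ?e 3 1) (mons i' - E)" by (rule inj_onI) (simp only: add_right_cancel)
          show "(\<lambda>m. m + ?e 3 1) ` (mons i' - E) \<subseteq> {n\<in>mons i - E. 0 < cf n 3}"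
          proof (rule image_subsetI)
            fix m assume m: "m \<in> mons i' - E"
            have "m + ?e 3 1 \<notin> E" using i Suc by (intro A2'[OF _ m]) simp
            then show "m + ?e 3 1 \<in> {n\<in>mons i - E. 0 < cf n 3}"
              using m Suc by (simp add: mons_def lookup_add)
          qed
        qed simp
        then have "card (std ex i') + card (B i) \<le> card (std ex i)"
          using Bdiff[of i] card[of i] card[of i'] by linarith
        then show ?thesis using card_std_le[of i'] Suc by simp
      qed
      have "excess r j = 2 * int (j - r) + 1" using rj by (simp add: excess_def)
      \<comment> \<open>Subtracting the bound for \<open>S1\<close> from \<open>A5\<close> cancels
        the three generators and leaves \<open>excess r j\<close>, the very number that
        \<open>A6\<close> allows for \<open>B (j - r)\<close>. So division by x3^r maps
        \<open>S2\<close> onto \<open>B (j - r)\<close>. The latter contains \<open>u\<close>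
        divided by x3^r, as \<open>u\<close> is minimal, and hence \<open>u\<close> would be
        standard.\<close>
      then have "int (card (B (j - r))) \<le> int (card S2)"
        using S1 BS A5 A6[of "j - r"] half by linarith
      then have S2card: "card (B (j - r)) \<le> card S2" by simp
      have le: "r \<le> cf m 2" if "m \<in> S2" for m using that by (simp add: S2_def)
      then have inj: "inj_on (\<lambda>m. m - ?e 2 r) S2" by (rule inj_on_minus_single)
      have "(\<lambda>m. m - ?e 2 r) ` S2 = B (j - r)"
      proof (rule card_seteq)
        show "finite (B (j - r))" by (rule finB)
        show "(\<lambda>m. m - ?e 2 r) ` S2 \<subseteq> B (j - r)"
        proof (rule image_subsetI)
          fix m assume m: "m \<in> S2"
          have "mdeg m = r + mdeg (m - ?e 2 r)" using le[OF m] by (rule mdeg_minus_single)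
          moreover have "mdeg m = j" using m by (simp add: S2_def B_def mons_def)
          ultimately have "mdeg (m - ?e 2 r) = j - r" by linarith
          moreover have "m - ?e 2 r \<notin> E"
            using m le[OF m] by (intro up_closed_minus_single[OF E]) (auto simp: S2_def B_def)
          moreover have "cf (m - ?e 2 r) 3 = 0" using m by (simp add: S2_def B_def lookup_minus)
          ultimately show "m - ?e 2 r \<in> B (j - r)" by (simp add: B_def mons_def)
        qed
        show "card (B (j - r)) \<le> card ((\<lambda>m. m - ?e 2 r) ` S2)"
          using S2card inj by (simp add: card_image)
      qed
      moreover have "u - ?e 2 r \<in> B (j - r)"
      proof -
        have "mdeg u = r + mdeg (u - ?e 2 r)" using r(2) by (rule mdeg_minus_single)
        then show ?thesis using minimal(1)[OF r(1,2)] True by (simp add: B_def mons_def j_def lookup_minus)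
      qed
      ultimately obtain m where m: "m \<in> S2" "u - ?e 2 r = m - ?e 2 r" by auto
      have "u = m" using single_factor[OF le[OF m(1)]] single_factor[OF r(2)] m(2) by simp
      then show False using m(1) u(1) by (simp add: S2_def B_def)
    qed
  qed
qed

theorem gin_quadric_ci:
  fixes I :: "'k::field_char_0 poly4 set"
  assumes I: "I = ideal_span (Monom ` powers ex)"
  shows "almost_revlex_ideal (gin I) \<and> hilbert_function (gin I) = hilbert_function I"
proof -
  let ?M = "powers ex"
  obtain D :: "'k ^ 4 ^ 4 \<Rightarrow> 'k" and g0 where D: "D \<in> entry_polys" "D g0 \<noteq> 0"
    and gen: "\<And>g (g1 :: 'k ^ 4 ^ 4) j N. D g \<noteq> 0 \<Longrightarrow> inj (lin_change g1) \<Longrightarrow> j \<le> socle \<Longrightarrow> lower_segment j N \<Longrightarrow>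
       card (N - inexp ?M g1) \<le> card (N - inexp ?M g)"
    by (rule generic_standard_monomials[of socle ?M, where ?'k = 'k]) (rule that)
  have "det (mat 1 :: 'k ^ 4 ^ 4) \<noteq> 0" by simp
  from entry_polys_common_nonzero[OF D(1) entry_polys_det D(2) this] obtain g :: "'k ^ 4 ^ 4"
    where g: "D g \<noteq> 0" "invertible g" unfolding invertible_iff_det by auto
  define E where "E = inexp ?M g"
  have const: "inexp ?M g' = E" if g': "invertible g'" "D g' \<noteq> 0" for g' :: "'k ^ 4 ^ 4"
  proof -
    have "inexp ?M g' \<inter> mons j = E \<inter> mons j" for j
    proof (cases "j \<le> socle")
      case True
      show ?thesis unfolding E_def
      proof (rule inexp_generic_eq)
        fix N assume "lower_segment j N"
        then show "card (N - inexp ?M g') = card (N - inexp ?M g)"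
          using gen[OF g'(2) inj_lin_change[OF g(2)] True] gen[OF g(1) inj_lin_change[OF g'(1)] True]
          by (simp add: le_antisym)
      qed
    next
      \<comment> \<open>Beyond the socle degree both initial ideals contain every monomial, so the
        bounded range of \<open>gen\<close> suffices.\<close>
      case False
      then have "card (mons j - inexp ?M h) = 0" if "invertible h" for h :: "'k ^ 4 ^ 4"
        using card_mons_inexp[OF inj_lin_change[OF that], of j] std_empty[of ex j] by simp
      from this[OF g(2)] this[OF g'(1)] show ?thesis by (auto simp: E_def)
    qed
    then have "m \<in> inexp ?M g' \<inter> mons (mdeg m) \<longleftrightarrow> m \<in> E \<inter> mons (mdeg m)" for m by simp
    then show ?thesis unfolding set_eq_iff by (simp add: mons_def)
  qed
  have upE: "up_closed E" unfolding E_def by (rule up_closed_inexp[OF up_closed_powers g(2)])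
  have gin: "gin I = ideal_span (Monom ` E)"
  proof (rule gin_eqI[OF D])
    fix g' :: "'k ^ 4 ^ 4" assume g': "invertible g'" "D g' \<noteq> 0"
    show "initial_ideal (lin_change g' ` I) = ideal_span (Monom ` E)"
      unfolding I initial_ideal_lin_change[OF up_closed_powers] const[OF g'] ..
  qed
  have card: "card (mons j - E) = card (std ex j)" for j
    unfolding E_def by (rule card_mons_inexp[OF inj_lin_change[OF g(2)]])
  have "almost_revlex_ideal (ideal_span (Monom ` E) :: 'k poly4 set)"
  proof (rule almost_revlex_idealI[OF upE])
    fix u v assume u: "u \<in> E" "\<And>g k. g \<in> E \<Longrightarrow> u = g + k \<Longrightarrow> k = 0" and v: "mdeg v = mdeg u" "revlex_less u v"
    show "v \<in> E"
    proof (rule generic_almost_revlex[OF upE card _ _ _ u v])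
      fix i assume i: "2 * i \<le> socle"
      let ?N = "{n\<in>mons (socle - i). socle - 2 * i \<le> cf n 3}"
      have "lower_segment (socle - i) ?N"
        unfolding lower_segment_def by (auto simp: revlex_less_iff mons_def)
      then have "card (?N - inexp ?M (special :: 'k ^ 4 ^ 4)) \<le> card (?N - E)"
        unfolding E_def using gen[OF g(1) inj_special, of "socle - i" ?N] by simp
      moreover have "card (std ex i) \<le> card (?N - inexp ?M (special :: 'k ^ 4 ^ 4))"
        by (rule special_rank_1[OF i])
      ultimately show "card (std ex i) \<le> card (?N - E)" by linarith
    next
      fix j s :: nat assume s: "0 < s" "s \<le> j" "j \<le> socle"
      let ?S = "special :: 'k ^ 4 ^ 4"
      have sub: "bsupp j s \<subseteq> mons j" by (auto simp: bsupp_def)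
      \<comment> \<open>Genericity bounds standard monomials in lower segments from below. Since the
        total in degree \<open>j\<close> is the same for all changes, the complement of the segment
        gets the upper bound that \<open>rank2\<close> needs.\<close>
      have split: "card (mons j - F) = card (bsupp j s - F) + card ((mons j - bsupp j s) - F)" for F
      proof -
        have "mons j - F = (bsupp j s - F) \<union> ((mons j - bsupp j s) - F)" using sub by auto
        then have "card (mons j - F) = card ((bsupp j s - F) \<union> ((mons j - bsupp j s) - F))" by (rule arg_cong)
        also have "\<dots> = card (bsupp j s - F) + card ((mons j - bsupp j s) - F)"
          using finite_subset[OF sub] by (intro card_Un_disjoint) auto
        finally show ?thesis .
      qed
      have "card (bsupp j s - inexp ?M ?S) \<le> card (bsupp j s - E)"
        unfolding E_def by (rule gen[OF g(1) inj_special s(3) bsupp_lower_segment])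
      then have "card ((mons j - bsupp j s) - E) \<le> card ((mons j - bsupp j s) - inexp ?M ?S)"
        using split[of E] split[of "inexp ?M ?S"] card[of j] card_mons_inexp[of ?S j, OF inj_special] by linarith
      moreover have "int (card ((mons j - bsupp j s) - inexp ?M ?S))
          \<le> max 0 (2 * int j + 1 - excess (ex k1) j - excess (ex k2) j - excess (ex k3) j - excess s j)"
        by (rule special_rank_2[OF s(1,2)])
      ultimately show "int (card ((mons j - bsupp j s) - E))
          \<le> max 0 (2 * int j + 1 - excess (ex k1) j - excess (ex k2) j - excess (ex k3) j - excess s j)"
        by linarith
    next
      fix m m' assume mm: "m \<in> E" "cf m 3 = 0" "cf m' 3 = 0" "cf m' 2 = cf m 2" "mdeg m' = mdeg m" "cf m' 1 < cf m 1"
      show "m' \<in> E" by (rule borel_move[OF D(1) g _ mm]) (rule const)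
    qed
  qed
  moreover have "hilbert_function (gin I) = hilbert_function I"
  proof
    fix i
    show "hilbert_function (gin I) i = hilbert_function I i"
      unfolding gin unfolding I hilbert_function_monomial[OF upE] hilbert_function_monomial[OF up_closed_powers]
        card std_def ..
  qed
  ultimately show ?thesis by (simp only: gin)
qed

end

theorem theorem9:
  fixes a b c d :: nat and I :: "'k::field_char_0 poly4 set"
  assumes "0 < a" "0 < b" "0 < c" "0 < d"
    and "a = 2 \<or> b = 2 \<or> c = 2 \<or> d = 2"
    and "I = ideal_span {Var 0 ^ a, Var 1 ^ b, Var 2 ^ c, Var 3 ^ d}"
  shows "almost_revlex_ideal (gin I) \<and>
    hilbert_function (gin I) = hilbert_function I \<and>
    (\<forall>J. almost_revlex_ideal J \<and> hilbert_function J = hilbert_function I \<longrightarrow> J = gin I)"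
proof -
  define ex :: "4 \<Rightarrow> nat" where "ex i = (if i = 0 then a else if i = 1 then b else if i = 2 then c else d)" for i
  have ex_values: "ex 0 = a" "ex 1 = b" "ex 2 = c" "ex 3 = d" by (simp_all add: ex_def)
  let ?G = "(\<lambda>i. Poly_Mapping.single i (ex i)) ` (UNIV :: 4 set)"
  have "I = ideal_span (Monom ` ?G)"
    unfolding assms(6) Var_power index_UNIV by (simp add: ex_values)
  also have "\<dots> = ideal_span (Monom ` powers ex)"
  proof -
    have "{g + k |g k. g \<in> ?G} = powers ex"
    proof (intro equalityI subsetI)
      fix m assume "m \<in> {g + k |g k. g \<in> ?G}"
      then obtain i k where "m = Poly_Mapping.single i (ex i) + k" by auto
      then have "ex i \<le> cf m i" by (simp add: lookup_add)
      then show "m \<in> powers ex" by (auto simp: powers_def)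
    next
      fix m assume "m \<in> powers ex"
      then obtain i where i: "ex i \<le> cf m i" by (auto simp: powers_def)
      have "m = Poly_Mapping.single i (ex i) + (m - Poly_Mapping.single i (ex i))"
        using single_factor[OF i] by simp
      then show "m \<in> {g + k |g k. g \<in> ?G}" by blast
    qed
    then show ?thesis
      unfolding set_eq_iff monomial_ideal_up_closed[OF up_closed_powers] unfolding monomial_ideal_iff by simp
  qed
  finally have I: "I = ideal_span (Monom ` powers ex)" .
  have pos: "0 < ex i" for i using assms(1-4) by (simp add: ex_def)
  have U: "UNIV = {0, 1, 2, 3 :: 4}" by (rule index_UNIV)
  \<comment> \<open>The exponent two may sit at any variable; each case selects it as
    \<open>k4\<close>.\<close>
  consider "ex 0 = 2" | "ex 1 = 2" | "ex 2 = 2" | "ex 3 = 2" using assms(5) unfolding ex_values by blast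
  then have *: "almost_revlex_ideal (gin I) \<and> hilbert_function (gin I) = hilbert_function I"
  proof cases
    case 1
    interpret quadric_ci ex 1 2 3 0 by unfold_locales (use pos 1 U in auto)
    show ?thesis by (rule gin_quadric_ci[OF I])
  next
    case 2
    interpret quadric_ci ex 0 2 3 1 by unfold_locales (use pos 2 U in auto)
    show ?thesis by (rule gin_quadric_ci[OF I])
  next
    case 3
    interpret quadric_ci ex 0 1 3 2 by unfold_locales (use pos 3 U in auto)
    show ?thesis by (rule gin_quadric_ci[OF I])
  next
    case 4
    interpret quadric_ci ex 0 1 2 3 by unfold_locales (use pos 4 U in auto)
    show ?thesis by (rule gin_quadric_ci[OF I])
  qed
  moreover have "J = gin I" if "almost_revlex_ideal J \<and> hilbert_function J = hilbert_function I" for J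
    using that * by (intro almost_revlex_unique) simp_all
  ultimately show ?thesis by blast
qed

end
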